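(* Let $b\in\mathscr S_d(\mathcal H)$ and let $B=(B^L,B^R)\in\mathscr L_d(\mathcal H)\times\mathscr R_d(\mathcal H)$ be a free Schur class transpose-conjugate pair ($b$ and $B$ non-unital, imaginary constants of the Herglotz functions being normalized as described in the context). Then $B$ is a pair of free lifts of $b$ if and only if $\mu_B\in CP(\mathcal A;\mathcal H)$ is a completely positive extension of $\mu_b\in CP(\mathcal S;\mathcal H)$ to the full free disk operator system $\mathcal A+\mathcal A^*$.
   Context: $d\in\mathbb N$; $\mathcal H$ is a complex Hilbert space; $\mathcal L(\cdot)$ denotes bounded operators. $\mathbb F^d$ is the free unital semigroup of words in the letters $1,\dots,d$, with unit $\emptyset$; $\alpha^T$ is the reversed word; $\lambda:\mathbb F^d\to\mathbb N^d$ is the letter counting map ($\mathbb N$ including $0$). $F^2_d$ is the full Fock space with orthonormal basis $\{e_\alpha\}_{\alpha\in\mathbb F^d}$; $L_ke_\alpha=e_{k\alpha}$; $L^\alpha=L_{i_1}\cdots L_{i_n}$; $L^{\mathbf n}=\sum_{\lambda(\alpha)=\mathbf n}L^\alpha$. $\mathcal A$ is the norm-closed unital algebra generated by $L_1,\dots,L_d$; $\mathcal S\subset\mathcal A$ is the norm-closed linear span of $\{L^{\mathbf n}:\mathbf n\in\mathbb N^d\}$; $\mathcal A+\mathcal A^*$ and $\mathcal S+\mathcal S^*$ mean norm closures; $CP(\mathcal A;\mathcal H)$, $CP(\mathcal S;\mathcal H)$ are the sets of completely positive maps from these operator systems into $\mathcal L(\mathcal H)$. $F^2_d\otimes\mathcal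 H$ is identified with formal series $F(Z)=\sum Z^\alpha F_\alpha$ in non-commuting variables. For $M(Z)=\sum Z^\alpha M_\alpha$, $M_\alpha\in\mathcal L(\mathcal H)$: left product $(MF)_\gamma=\sum_{\alpha\beta=\gamma}M_\alpha F_\beta$, right product $(M\bullet_RF)_\gamma=\sum_{\beta\alpha=\gamma}M_\alpha F_\beta$. $\mathscr L_d(\mathcal H)$ (resp. $\mathscr R_d(\mathcal H)$) is the set of $B(Z)=\sum Z^\alpha B_\alpha$ for which left (resp. right) multiplication is a contraction on $F^2_d\otimes\mathcal H$. $(B^L,B^R)$ is transpose-conjugate if $B^R(Z)=\sum Z^{\alpha^T}B^L_\alpha$. $B$ is non-unital if $I-\sum Z^\alpha\otimes B^L_\alpha$ is invertible for every strict row contraction $Z=(Z_1,\dots,Z_d)$ of $n\times n$ complex matrices, every $n$ (for $B^R$: the same condition transported by the transpose). For non-unital $B$, write $H_B^L=(I-B^L)^{-1}(I+B^L)=\sum Z^\alpha H_\alpha$; the Aleksandrov-Clark map $\mu_B\in CP(\mathcal A;\mathcal H)$ is given by $\mu_B(I)=\mathrm{Re}\,H_\emptyset$, $\mu_B(L^{\alpha^T})^*=\frac12H_\alpha$ for $\alpha\neq\emptyset$. $H^2_d$ is the Drury-Arveson space (kernel $1/(1-zw^* )$ on the unit ball $\mathbb B^d$ of $\mathbb C^d$, $zw^*=\sum z_j\overline{w_j}$). $\mathscr S_d(\mathcal H)$ is the closed unit ball of the multiplier algebra of $H^2_d\otimes\mathcal H$. $b$ is non-unital if $I-b(z)$ is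 invertible for all $z\in\mathbb B^d$; then $H_b(z)=(I-b(z))^{-1}(I+b(z))$, and $\mu_b\in CP(\mathcal S;\mathcal H)$ is the unique completely positive map with $H_b(z)=\mu_b\big((I-zL^* )^{-1}(I+zL^* )\big)+i\,\mathrm{Im}\,H_b(0)$, $zL^*=\sum z_jL_j^*$. The pair $B$ is a pair of free lifts of $b$ if $b$ is obtained from $B^L$ (equivalently $B^R$) by substituting commuting variables: $\sum_\alpha z^\alpha B^L_\alpha=b(z)$ for $z\in\mathbb B^d$, where $z^\alpha=z_{i_1}\cdots z_{i_n}$. (This is the quotient, or symmetrization, map by the commutator ideal.) Normalization: $\mu_B$ and $\mu_b$ determine the Herglotz functions only modulo imaginary constants; it is assumed that these constants agree, $\mathrm{Im}\,H_\emptyset=\mathrm{Im}\,H_b(0)$ (automatic when $B$ is a pair of free lifts of $b$). *)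

theory Defs
  imports "HOL-Analysis.Analysis"
begin

section \<open>Complex Hilbert spaces\<close>

class complex_vector = real_vector +
  fixes scaleC :: "complex \<Rightarrow> 'a \<Rightarrow> 'a" (infixr \<open>*\<^sub>C\<close> 75)
  assumes scaleC_add_right: "c *\<^sub>C (x + y) = c *\<^sub>C x + c *\<^sub>C y"
    and scaleC_add_left: "(c + e) *\<^sub>C x = c *\<^sub>C x + e *\<^sub>C x"
    and scaleC_scaleC: "c *\<^sub>C e *\<^sub>C x = (c * e) *\<^sub>C x"
    and scaleC_of_real: "complex_of_real r *\<^sub>C x = r *\<^sub>R x"

class complex_normed_vector = complex_vector + real_normed_vector +
  assumes norm_scaleC: "norm (c *\<^sub>C x) = cmod c * norm x"

text \<open>The inner product is linear in its second argument.\<close>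

class chilbert_space = complex_normed_vector + real_inner + complete_space +
  fixes cinner :: "'a \<Rightarrow> 'a \<Rightarrow> complex"
  assumes cinner_add_right: "cinner x (y + z) = cinner x y + cinner x z"
    and cinner_scaleC_right: "cinner x (c *\<^sub>C y) = c * cinner x y"
    and cinner_commute: "cinner x y = cnj (cinner y x)"
    and inner_eq_Re_cinner: "x \<bullet> y = Re (cinner x y)"

global_interpretation complex_vector: vector_space "scaleC :: complex \<Rightarrow> 'a \<Rightarrow> 'a::complex_vector"
  defines csubspace = complex_vector.subspace and cspan = complex_vector.span
proof
  show "1 *\<^sub>C x = x" for x :: 'a
    using scaleC_of_real[of 1 x] by simp
qed (simp_all add: scaleC_add_right scaleC_add_left scaleC_scaleC)

lemma bounded_linear_scaleC: "bounded_linear (\<lambda>x :: 'a :: complex_normed_vector. c *\<^sub>C x)"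
proof
  show "c *\<^sub>C r *\<^sub>R x = r *\<^sub>R c *\<^sub>C x" for r and x :: 'a
    by (simp add: scaleC_of_real[symmetric] scaleC_scaleC mult.commute)
  show "\<exists>K. \<forall>x :: 'a. norm (c *\<^sub>C x) \<le> norm x * K"
    by (rule exI[of _ "cmod c"]) (simp add: norm_scaleC mult.commute)
qed (rule scaleC_add_right)

lemma cmod_cinner_le: "cmod (cinner x y) \<le> norm x * norm (y :: 'a :: chilbert_space)"
proof (cases "cinner x y = 0")
  case False
  define u where "u = cnj (sgn (cinner x y))"
  have u: "cmod u = 1"
    using False by (simp add: u_def norm_sgn)
  have "cnj (cinner x y) * cinner x y = complex_of_real (cmod (cinner x y)) * cmod (cinner x y)"
    by (metis complex_norm_square mult.commute power2_eq_square of_real_mult)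
  then have "u * cinner x y = complex_of_real (cmod (cinner x y))"
    using False by (simp add: u_def sgn_eq)
  then have "cmod (cinner x y) = Re (cinner x (u *\<^sub>C y))"
    by (simp add: cinner_scaleC_right)
  also have "\<dots> = x \<bullet> (u *\<^sub>C y)"
    by (simp add: inner_eq_Re_cinner)
  also have "\<dots> \<le> norm x * norm (u *\<^sub>C y)"
    by (rule norm_cauchy_schwarz)
  finally show ?thesis
    by (simp add: norm_scaleC u)
qed simp

instantiation complex :: chilbert_space
begin

definition "scaleC_complex (c :: complex) (x :: complex) = c * x"
definition "cinner_complex (x :: complex) y = cnj x * y"

instance
  by standard
    (simp_all add: scaleC_complex_def cinner_complex_def algebra_simps scaleR_conv_of_real
      norm_mult inner_complex_def)

end


section \<open>Bounded operators\<close>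

instantiation blinfun :: (real_normed_vector, complex_normed_vector) complex_normed_vector
begin

lift_definition scaleC_blinfun :: "complex \<Rightarrow> ('a \<Rightarrow>\<^sub>L 'b) \<Rightarrow> ('a \<Rightarrow>\<^sub>L 'b)"
  is "\<lambda>c T x. c *\<^sub>C T x"
  by (rule bounded_linear_compose[OF bounded_linear_scaleC])

instance
proof
  fix c e :: complex and r :: real and S T :: "'a \<Rightarrow>\<^sub>L 'b"
  show "c *\<^sub>C (S + T) = c *\<^sub>C S + c *\<^sub>C T"
    by (transfer, simp add: scaleC_add_right)
  show "(c + e) *\<^sub>C T = c *\<^sub>C T + e *\<^sub>C T"
    by (transfer, simp add: scaleC_add_left)
  show "c *\<^sub>C e *\<^sub>C T = (c * e) *\<^sub>C T"
    by (transfer, simp add: scaleC_scaleC)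
  show "complex_of_real r *\<^sub>C T = r *\<^sub>R T"
    by (transfer, simp add: scaleC_of_real)
  show "norm (c *\<^sub>C T) = cmod c * norm T"
  proof (transfer, goal_cases)
    case (1 c T)
    show ?case
    proof (cases "c = 0")
      case True
      then show ?thesis by (simp add: onorm_zero)
    next
      case False
      have le: "onorm (\<lambda>x. a *\<^sub>C f x) \<le> cmod a * onorm f"
        if "bounded_linear f" for a and f :: "'a \<Rightarrow> 'b"
        by (rule onorm_bound)
          (auto simp: norm_scaleC mult.assoc onorm_pos_le[OF that]
            intro!: mult_left_mono onorm that)
      have "onorm T = onorm (\<lambda>x. (1 / c) *\<^sub>C c *\<^sub>C T x)"
        using False by (simp add: scaleC_scaleC)
      also have "\<dots> \<le> cmod (1 / c) * onorm (\<lambda>x. c *\<^sub>C T x)"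
        by (rule le) (rule bounded_linear_compose[OF bounded_linear_scaleC 1])
      finally have "cmod c * onorm T \<le> onorm (\<lambda>x. c *\<^sub>C T x)"
        using False by (simp add: norm_divide field_simps)
      then show ?thesis
        using le[OF 1, of c] by simp
    qed
  qed
qed

end

text \<open>The type \<open>'a \<Rightarrow>\<^sub>L 'b\<close> consists of the real-linear bounded maps; \<open>bounded_ops\<close> are the
  complex-linear ones among them.\<close>

definition bounded_ops :: "('a::chilbert_space \<Rightarrow>\<^sub>L 'b::chilbert_space) set" where
  "bounded_ops = {T. \<forall>c x. blinfun_apply T (c *\<^sub>C x) = c *\<^sub>C blinfun_apply T x}"

definition cadjoint :: "('a::chilbert_space \<Rightarrow>\<^sub>L 'b::chilbert_space) \<Rightarrow> ('b \<Rightarrow>\<^sub>L 'a)" where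
  "cadjoint T = (THE S. \<forall>x y. cinner (blinfun_apply T x) y = cinner x (blinfun_apply S y))"

definition op_Re :: "('h::chilbert_space \<Rightarrow>\<^sub>L 'h) \<Rightarrow> ('h \<Rightarrow>\<^sub>L 'h)" where
  "op_Re T = (1/2) *\<^sub>C (T + cadjoint T)"

definition op_Im :: "('h::chilbert_space \<Rightarrow>\<^sub>L 'h) \<Rightarrow> ('h \<Rightarrow>\<^sub>L 'h)" where
  "op_Im T = (1 / (2 * \<i>)) *\<^sub>C (T - cadjoint T)"

definition op_invertible :: "('h::chilbert_space \<Rightarrow>\<^sub>L 'h) \<Rightarrow> bool" where
  "op_invertible T \<longleftrightarrow> (\<exists>S. S o\<^sub>L T = id_blinfun \<and> T o\<^sub>L S = id_blinfun)"

definition op_inverse :: "('h::chilbert_space \<Rightarrow>\<^sub>L 'h) \<Rightarrow> ('h \<Rightarrow>\<^sub>L 'h)" where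
  "op_inverse T = (THE S. S o\<^sub>L T = id_blinfun \<and> T o\<^sub>L S = id_blinfun)"


section \<open>Completely positive maps on operator systems\<close>

text \<open>The operator on the \<open>n\<close>-fold direct sum with matrix entries \<open>T i j\<close>, \<open>i, j < n\<close>, is positive.\<close>

definition block_positive :: "nat \<Rightarrow> (nat \<Rightarrow> nat \<Rightarrow> 'k::chilbert_space \<Rightarrow>\<^sub>L 'k) \<Rightarrow> bool" where
  "block_positive n T \<longleftrightarrow>
     (\<forall>x. (\<Sum>i<n. \<Sum>j<n. cinner (x i) (blinfun_apply (T i j) (x j))) \<in> \<real>\<^sub>\<ge>\<^sub>0)"

definition op_system :: "('k::chilbert_space \<Rightarrow>\<^sub>L 'k) set \<Rightarrow> ('k \<Rightarrow>\<^sub>L 'k) set" where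
  "op_system M = closure {S + cadjoint T | S T. S \<in> M \<and> T \<in> M}"

text \<open>Only the values of a map on the operator system \<open>E\<close> are meaningful.\<close>

definition cp_maps ::
  "('k::chilbert_space \<Rightarrow>\<^sub>L 'k) set \<Rightarrow> (('k \<Rightarrow>\<^sub>L 'k) \<Rightarrow> ('h::chilbert_space \<Rightarrow>\<^sub>L 'h)) set" where
  "cp_maps E = {\<phi>.
     (\<forall>S\<in>E. \<phi> S \<in> bounded_ops) \<and>
     (\<forall>S\<in>E. \<forall>T\<in>E. \<phi> (S + T) = \<phi> S + \<phi> T) \<and>
     (\<forall>c. \<forall>T\<in>E. \<phi> (c *\<^sub>C T) = c *\<^sub>C \<phi> T) \<and>
     (\<forall>n T. (\<forall>i<n. \<forall>j<n. T i j \<in> E) \<and> block_positive n T \<longrightarrow>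
        block_positive n (\<lambda>i j. \<phi> (T i j)))}"

definition cp_extension ::
  "('k::chilbert_space \<Rightarrow>\<^sub>L 'k) set \<Rightarrow> ('k \<Rightarrow>\<^sub>L 'k) set \<Rightarrow>
   (('k \<Rightarrow>\<^sub>L 'k) \<Rightarrow> ('h::chilbert_space \<Rightarrow>\<^sub>L 'h)) \<Rightarrow> (('k \<Rightarrow>\<^sub>L 'k) \<Rightarrow> ('h \<Rightarrow>\<^sub>L 'h)) \<Rightarrow> bool" where
  "cp_extension E E' \<phi> \<psi> \<longleftrightarrow>
     E \<subseteq> E' \<and> \<psi> \<in> cp_maps E' \<and> (\<forall>T\<in>E. \<psi> T = \<phi> T)"


section \<open>Square-summable families\<close>

typedef (overloaded) ('i, 'a) ell2 =
  "{f :: 'i \<Rightarrow> 'a::chilbert_space. (\<lambda>i. (norm (f i))\<^sup>2) summable_on UNIV}"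
  morphisms ell2_nth Abs_ell2
  by (rule exI[of _ "\<lambda>_. 0"]) simp

setup_lifting type_definition_ell2

lemma summable_comparison_real:
  fixes f g :: "'i \<Rightarrow> real"
  assumes "g summable_on A" "\<And>i. 0 \<le> f i" "\<And>i. f i \<le> g i"
  shows "f summable_on A"
  using assms by (intro summable_on_comparison_test[OF assms(1)]) auto

lemma ell2_summable: "(\<lambda>i. (norm (ell2_nth F i))\<^sup>2) summable_on UNIV"
  using ell2_nth[of F] by simp

lemma norm_add_square_le: "(norm (x + y))\<^sup>2 \<le> 2 * (norm x)\<^sup>2 + 2 * (norm (y :: 'a :: real_normed_vector))\<^sup>2"
proof -
  have "(norm (x + y))\<^sup>2 \<le> (norm x + norm y)\<^sup>2"
    by (intro power_mono norm_triangle_ineq norm_ge_zero)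
  also have "\<dots> \<le> 2 * (norm x)\<^sup>2 + 2 * (norm y)\<^sup>2"
    using sum_squares_bound[of "norm x" "norm y"] by (simp add: power2_sum)
  finally show ?thesis .
qed

lemma ell2_add_closed:
  fixes f g :: "'i \<Rightarrow> 'a :: chilbert_space"
  assumes "(\<lambda>i. (norm (f i))\<^sup>2) summable_on UNIV" "(\<lambda>i. (norm (g i))\<^sup>2) summable_on UNIV"
  shows "(\<lambda>i. (norm (f i + g i))\<^sup>2) summable_on UNIV"
  by (rule summable_comparison_real[where g = "\<lambda>i. 2 * (norm (f i))\<^sup>2 + 2 * (norm (g i))\<^sup>2"])
    (auto intro!: summable_on_add summable_on_cmult_right assms norm_add_square_le)

lemma ell2_scale_closed:
  fixes f :: "'i \<Rightarrow> 'a :: chilbert_space"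
  assumes "(\<lambda>i. (norm (f i))\<^sup>2) summable_on UNIV"
  shows "(\<lambda>i. (norm (c *\<^sub>C f i))\<^sup>2) summable_on UNIV"
  using assms by (auto simp: norm_scaleC power_mult_distrib intro!: summable_on_cmult_right)

lemma ell2_cinner_summable:
  "(\<lambda>i. cinner (ell2_nth F i) (ell2_nth G i)) summable_on UNIV"
proof -
  have "(\<lambda>i. cmod (cinner (ell2_nth F i) (ell2_nth G i))) summable_on UNIV"
  proof (rule summable_comparison_real)
    show "(\<lambda>i. (norm (ell2_nth F i))\<^sup>2 + (norm (ell2_nth G i))\<^sup>2) summable_on UNIV"
      by (intro summable_on_add ell2_summable)
    show "cmod (cinner (ell2_nth F i) (ell2_nth G i))
        \<le> (norm (ell2_nth F i))\<^sup>2 + (norm (ell2_nth G i))\<^sup>2" for i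
    proof -
      have "norm (ell2_nth F i) * norm (ell2_nth G i)
          \<le> (norm (ell2_nth F i))\<^sup>2 + (norm (ell2_nth G i))\<^sup>2"
        using sum_squares_bound[of "norm (ell2_nth F i)" "norm (ell2_nth G i)"]
          mult_nonneg_nonneg[of "norm (ell2_nth F i)" "norm (ell2_nth G i)"]
        by (simp del: mult_nonneg_nonneg)
      then show ?thesis
        using cmod_cinner_le order_trans by blast
    qed
  qed auto
  then show ?thesis
    by (rule abs_summable_summable)
qed

instantiation ell2 :: (type, chilbert_space) complex_vector
begin

lift_definition zero_ell2 :: "('a, 'b) ell2" is "\<lambda>_. 0"
  by simp

lift_definition plus_ell2 :: "('a, 'b) ell2 \<Rightarrow> ('a, 'b) ell2 \<Rightarrow> ('a, 'b) ell2"
  is "\<lambda>f g i. f i + g i"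
  using ell2_add_closed by blast

lift_definition uminus_ell2 :: "('a, 'b) ell2 \<Rightarrow> ('a, 'b) ell2" is "\<lambda>f i. - f i"
  by simp

lift_definition minus_ell2 :: "('a, 'b) ell2 \<Rightarrow> ('a, 'b) ell2 \<Rightarrow> ('a, 'b) ell2"
  is "\<lambda>f g i. f i - g i"
  subgoal for f g
    using ell2_add_closed[of f "\<lambda>i. - g i"] by simp
  done

lift_definition scaleC_ell2 :: "complex \<Rightarrow> ('a, 'b) ell2 \<Rightarrow> ('a, 'b) ell2"
  is "\<lambda>c f i. c *\<^sub>C f i"
  using ell2_scale_closed by blast

lift_definition scaleR_ell2 :: "real \<Rightarrow> ('a, 'b) ell2 \<Rightarrow> ('a, 'b) ell2"
  is "\<lambda>r f i. r *\<^sub>R f i"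
  subgoal for r f
    using ell2_scale_closed[of f "complex_of_real r"] by (simp add: scaleC_of_real)
  done

instance
  by standard (transfer; simp add: scaleC_add_right scaleC_add_left scaleC_scaleC scaleC_of_real
      scaleR_add_right scaleR_add_left fun_eq_iff)+

end

lemmas ell2_nth_simps [simp] =
  zero_ell2.rep_eq plus_ell2.rep_eq uminus_ell2.rep_eq minus_ell2.rep_eq scaleC_ell2.rep_eq
  scaleR_ell2.rep_eq

instantiation ell2 :: (type, chilbert_space) real_inner
begin

definition inner_ell2 :: "('a, 'b) ell2 \<Rightarrow> ('a, 'b) ell2 \<Rightarrow> real" where
  "inner_ell2 F G = (\<Sum>\<^sub>\<infinity>i. ell2_nth F i \<bullet> ell2_nth G i)"

definition norm_ell2 :: "('a, 'b) ell2 \<Rightarrow> real" where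
  "norm_ell2 F = sqrt (inner F F)"

definition dist_ell2 :: "('a, 'b) ell2 \<Rightarrow> ('a, 'b) ell2 \<Rightarrow> real" where
  "dist_ell2 F G = norm (F - G)"

definition sgn_ell2 :: "('a, 'b) ell2 \<Rightarrow> ('a, 'b) ell2" where
  "sgn_ell2 F = F /\<^sub>R norm F"

definition uniformity_ell2 :: "(('a, 'b) ell2 \<times> ('a, 'b) ell2) filter" where
  "uniformity_ell2 = (INF e\<in>{0<..}. principal {(x, y). dist x y < e})"

definition open_ell2 :: "('a, 'b) ell2 set \<Rightarrow> bool" where
  "open_ell2 U = (\<forall>x\<in>U. \<forall>\<^sub>F (x', y) in uniformity. x' = x \<longrightarrow> y \<in> U)"

lemma ell2_inner_summable:
  "(\<lambda>i. ell2_nth F i \<bullet> ell2_nth G i) summable_on UNIV" for F G :: "('a, 'b) ell2"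
  unfolding inner_eq_Re_cinner by (intro summable_on_Re ell2_cinner_summable)

instance
proof
  fix F G H :: "('a, 'b) ell2" and r :: real
  show "dist F G = norm (F - G)"
    by (rule dist_ell2_def)
  show "sgn F = F /\<^sub>R norm F"
    by (rule sgn_ell2_def)
  show "(uniformity :: (('a, 'b) ell2 \<times> ('a, 'b) ell2) filter)
      = (INF e\<in>{0<..}. principal {(x, y). dist x y < e})"
    by (rule uniformity_ell2_def)
  show "open U = (\<forall>x\<in>U. \<forall>\<^sub>F (x', y) in uniformity. x' = x \<longrightarrow> y \<in> U)"
    for U :: "('a, 'b) ell2 set"
    by (rule open_ell2_def)
  show "inner F G = inner G F"
    by (simp add: inner_ell2_def inner_commute)
  show "inner (F + G) H = inner F H + inner G H"
    by (simp add: inner_ell2_def inner_add_left infsum_add ell2_inner_summable)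
  show "inner (r *\<^sub>R F) G = r * inner F G"
    by (simp add: inner_ell2_def infsum_cmult_right')
  show "0 \<le> inner F F"
    by (simp add: inner_ell2_def infsum_nonneg)
  show "inner F F = 0 \<longleftrightarrow> F = 0"
  proof
    assume "inner F F = 0"
    then have "ell2_nth F i \<bullet> ell2_nth F i = 0" for i
      by (intro nonneg_infsum_le_0D[where A = UNIV])
        (auto simp: inner_ell2_def ell2_inner_summable)
    then have "ell2_nth F = ell2_nth 0"
      by (simp add: fun_eq_iff)
    then show "F = 0"
      by (rule ell2_nth_inject[THEN iffD1])
  qed (simp add: inner_ell2_def)
  show "norm F = sqrt (inner F F)"
    by (rule norm_ell2_def)
qed

end

lemma norm_ell2_square: "(norm F)\<^sup>2 = (\<Sum>\<^sub>\<infinity>i. (norm (ell2_nth F i))\<^sup>2)"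
  by (simp add: power2_norm_eq_inner inner_ell2_def)

lemma sum_le_norm_ell2_square:
  assumes "finite A"
  shows "(\<Sum>i\<in>A. (norm (ell2_nth F i))\<^sup>2) \<le> (norm F)\<^sup>2"
  unfolding norm_ell2_square
  by (rule finite_sum_le_infsum[OF ell2_summable]) (use assms in auto)

lemma norm_ell2_nth_le: "norm (ell2_nth F i) \<le> norm F"
  using sum_le_norm_ell2_square[of "{i}" F] by (simp add: power2_le_iff_abs_le)

lemma ell2_boundedI:
  fixes f :: "'i \<Rightarrow> 'a :: chilbert_space"
  assumes "\<And>A. finite A \<Longrightarrow> (\<Sum>i\<in>A. (norm (f i))\<^sup>2) \<le> K\<^sup>2" and "0 \<le> K"
  obtains F where "ell2_nth F = f" "norm F \<le> K"
proof -
  have s: "(\<lambda>i. (norm (f i))\<^sup>2) summable_on UNIV"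
    by (rule nonneg_bdd_above_summable_on) (auto intro!: bdd_aboveI[of _ "K\<^sup>2"] assms)
  then have nth: "ell2_nth (Abs_ell2 f) = f"
    by (simp add: Abs_ell2_inverse)
  have "(norm (Abs_ell2 f))\<^sup>2 \<le> K\<^sup>2"
    unfolding norm_ell2_square nth
    by (rule infsum_le_finite_sums) (auto intro: s assms)
  then show ?thesis
    using nth assms(2) that power2_le_imp_le by blast
qed

instance ell2 :: (type, chilbert_space) complete_space
proof
  fix X :: "nat \<Rightarrow> ('a, 'b) ell2"
  assume "Cauchy X"
  have coord: "Cauchy (\<lambda>m. ell2_nth (X m) i)" for i
  proof (rule metric_CauchyI)
    fix e :: real assume "0 < e"
    then obtain M where M: "\<And>m n. m \<ge> M \<Longrightarrow> n \<ge> M \<Longrightarrow> dist (X m) (X n) < e"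
      using metric_CauchyD[OF \<open>Cauchy X\<close>] by blast
    have "dist (ell2_nth (X m) i) (ell2_nth (X n) i) \<le> dist (X m) (X n)" for m n
      using norm_ell2_nth_le[of "X m - X n" i] by (simp add: dist_norm)
    then show "\<exists>M. \<forall>m\<ge>M. \<forall>n\<ge>M. dist (ell2_nth (X m) i) (ell2_nth (X n) i) < e"
      using M by (meson le_less_trans)
  qed
  define g where "g i = lim (\<lambda>m. ell2_nth (X m) i)" for i
  have g: "(\<lambda>m. ell2_nth (X m) i) \<longlonglongrightarrow> g i" for i
    using coord[of i] by (simp add: g_def Cauchy_convergent_iff convergent_LIMSEQ_iff)
  have tail: "\<exists>M. \<forall>m\<ge>M. \<forall>A. finite A \<longrightarrow> (\<Sum>i\<in>A. (norm (ell2_nth (X m) i - g i))\<^sup>2) \<le> e\<^sup>2"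
    if "0 < e" for e
  proof -
    from that obtain M where M: "\<And>m n. m \<ge> M \<Longrightarrow> n \<ge> M \<Longrightarrow> dist (X m) (X n) < e"
      using metric_CauchyD[OF \<open>Cauchy X\<close>] by blast
    have "(\<Sum>i\<in>A. (norm (ell2_nth (X m) i - g i))\<^sup>2) \<le> e\<^sup>2" if "m \<ge> M" "finite A" for m A
    proof (rule tendsto_upperbound)
      show "(\<lambda>n. \<Sum>i\<in>A. (norm (ell2_nth (X m) i - ell2_nth (X n) i))\<^sup>2)
          \<longlonglongrightarrow> (\<Sum>i\<in>A. (norm (ell2_nth (X m) i - g i))\<^sup>2)"
        by (intro tendsto_intros g)
      show "\<forall>\<^sub>F n in sequentially. (\<Sum>i\<in>A. (norm (ell2_nth (X m) i - ell2_nth (X n) i))\<^sup>2) \<le> e\<^sup>2"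
      proof (rule eventually_sequentiallyI)
        fix n assume "M \<le> n"
        have "(\<Sum>i\<in>A. (norm (ell2_nth (X m) i - ell2_nth (X n) i))\<^sup>2) \<le> (norm (X m - X n))\<^sup>2"
          using sum_le_norm_ell2_square[OF \<open>finite A\<close>, of "X m - X n"] by simp
        also have "\<dots> \<le> e\<^sup>2"
          using M[OF \<open>m \<ge> M\<close> \<open>M \<le> n\<close>] by (intro power_mono) (auto simp: dist_norm)
        finally show "(\<Sum>i\<in>A. (norm (ell2_nth (X m) i - ell2_nth (X n) i))\<^sup>2) \<le> e\<^sup>2" .
      qed
    qed simp
    then show ?thesis by blast
  qed
  obtain M where M: "\<And>A. finite A \<Longrightarrow> (\<Sum>i\<in>A. (norm (ell2_nth (X M) i - g i))\<^sup>2) \<le> 1\<^sup>2"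
    using tail[of 1] by auto
  obtain D where D: "ell2_nth D = (\<lambda>i. ell2_nth (X M) i - g i)"
    using ell2_boundedI[of "\<lambda>i. ell2_nth (X M) i - g i" 1] M by auto
  define G where "G = X M - D"
  have G: "ell2_nth G i = g i" for i
    by (simp add: G_def D)
  have "X \<longlonglongrightarrow> G"
  proof (rule metric_LIMSEQ_I)
    fix e :: real assume "0 < e"
    then obtain N where N: "\<And>m A. m \<ge> N \<Longrightarrow> finite A \<Longrightarrow>
        (\<Sum>i\<in>A. (norm (ell2_nth (X m) i - g i))\<^sup>2) \<le> (e/2)\<^sup>2"
      using tail[of "e/2"] by auto
    have "dist (X m) G < e" if "m \<ge> N" for m
    proof -
      obtain E where E: "ell2_nth E = (\<lambda>i. ell2_nth (X m) i - g i)" "norm E \<le> e/2"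
        using ell2_boundedI[of "\<lambda>i. ell2_nth (X m) i - g i" "e/2"] N \<open>m \<ge> N\<close> \<open>0 < e\<close> by auto
      have "E = X m - G"
        by (simp add: ell2_nth_inject[symmetric] E(1) G fun_eq_iff)
      then show ?thesis
        using E(2) \<open>0 < e\<close> by (simp add: dist_norm)
    qed
    then show "\<exists>N. \<forall>m\<ge>N. dist (X m) G < e" by blast
  qed
  then show "convergent X"
    by (rule convergentI)
qed

instantiation ell2 :: (type, chilbert_space) chilbert_space
begin

definition cinner_ell2 :: "('a, 'b) ell2 \<Rightarrow> ('a, 'b) ell2 \<Rightarrow> complex" where
  "cinner_ell2 F G = (\<Sum>\<^sub>\<infinity>i. cinner (ell2_nth F i) (ell2_nth G i))"

instance
proof
  fix F G H :: "('a, 'b) ell2" and c :: complex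
  have "(norm (c *\<^sub>C F))\<^sup>2 = (cmod c * norm F)\<^sup>2"
    by (simp add: norm_ell2_square norm_scaleC power_mult_distrib infsum_cmult_right')
  then show "norm (c *\<^sub>C F) = cmod c * norm F"
    by (rule power2_eq_imp_eq) auto
  show "cinner F (G + H) = cinner F G + cinner F H"
    by (simp add: cinner_ell2_def cinner_add_right infsum_add ell2_cinner_summable)
  show "cinner F (c *\<^sub>C G) = c * cinner F G"
    by (simp add: cinner_ell2_def cinner_scaleC_right infsum_cmult_right')
  show "cinner F G = cnj (cinner G F)"
    unfolding cinner_ell2_def by (subst cinner_commute) (rule infsum_cnj)
  show "F \<bullet> G = Re (cinner F G)"
    by (simp add: cinner_ell2_def inner_ell2_def inner_eq_Re_cinner infsum_Re ell2_cinner_summable)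
qed

end


section \<open>The full Fock space and the free disk system\<close>

text \<open>Words are lists over the finite alphabet \<open>'d\<close>. The type \<open>('d, 'h) fock\<close> is the tensor product
  of the full Fock space with \<open>'h\<close>, an element being the family of coefficients of a formal series
  \<open>\<Sum> Z\<^sup>\<alpha> F\<^sub>\<alpha>\<close>; the full Fock space itself is \<open>('d, complex) fock\<close>.\<close>

type_synonym ('d, 'h) fock = "('d list, 'h) ell2"

type_synonym 'd fock_op = "('d, complex) fock \<Rightarrow>\<^sub>L ('d, complex) fock"

lift_definition fock_basis :: "'d list \<Rightarrow> ('d, complex) fock"
  is "\<lambda>\<alpha> \<beta>. if \<beta> = \<alpha> then 1 else 0"
proof -
  fix \<alpha> :: "'d list"
  have "{\<beta> \<in> UNIV. (cmod (if \<beta> = \<alpha> then 1 else 0))\<^sup>2 \<noteq> 0} = {\<alpha>}"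
    by auto
  then show "(\<lambda>\<beta>. (cmod (if \<beta> = \<alpha> then 1 else 0))\<^sup>2) summable_on UNIV"
    by (intro finite_nonzero_values_imp_summable_on) simp
qed

text \<open>On coefficients, \<open>L\<^sub>k\<close> moves the entry at \<open>\<beta>\<close> to \<open>k # \<beta>\<close>.\<close>

definition shift_family :: "'d \<Rightarrow> ('d list \<Rightarrow> complex) \<Rightarrow> 'd list \<Rightarrow> complex" where
  "shift_family k f \<gamma> = (case \<gamma> of [] \<Rightarrow> 0 | j # \<beta> \<Rightarrow> if j = k then f \<beta> else 0)"

lemma shift_family_has_sum:
  assumes "((\<lambda>i. (cmod (f i))\<^sup>2) has_sum s) UNIV"
  shows "((\<lambda>i. (cmod (shift_family k f i))\<^sup>2) has_sum s) UNIV"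
proof -
  have "((\<lambda>i. (cmod (shift_family k f i))\<^sup>2) has_sum s) (range ((#) k))"
    using assms by (subst has_sum_reindex) (auto simp: o_def shift_family_def)
  also have "?this \<longleftrightarrow> ((\<lambda>i. (cmod (shift_family k f i))\<^sup>2) has_sum s) UNIV"
    by (rule has_sum_cong_neutral) (auto simp: shift_family_def image_iff split: list.splits)
  finally show ?thesis .
qed

lift_definition left_shift :: "'d \<Rightarrow> ('d, complex) fock \<Rightarrow> ('d, complex) fock"
  is shift_family
  unfolding summable_on_def by (elim exE) (rule exI, erule shift_family_has_sum)

lemma norm_left_shift: "norm (left_shift k F) = norm F"
proof -
  have "(norm (left_shift k F))\<^sup>2 = (norm F)\<^sup>2"
    unfolding norm_ell2_square left_shift.rep_eq
    by (intro infsumI shift_family_has_sum has_sum_infsum ell2_summable)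
  then show ?thesis
    by (rule power2_eq_imp_eq) auto
qed

lift_definition creation :: "'d \<Rightarrow> 'd fock_op" is left_shift
proof
  fix k :: 'd and F G :: "('d, complex) fock" and r :: real
  show "left_shift k (F + G) = left_shift k F + left_shift k G"
    by (transfer, auto simp: shift_family_def fun_eq_iff split: list.splits)
  show "left_shift k (r *\<^sub>R F) = r *\<^sub>R left_shift k F"
    by (transfer, auto simp: shift_family_def fun_eq_iff split: list.splits)
  show "\<exists>K. \<forall>F. norm (left_shift k F) \<le> norm F * K"
    by (rule exI[of _ 1]) (simp add: norm_left_shift)
qed

lemma creation_fock_basis: "creation k (fock_basis \<alpha>) = fock_basis (k # \<alpha>)"
  by (auto simp: creation.rep_eq left_shift.rep_eq fock_basis.rep_eq shift_family_def fun_eq_iff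
      simp flip: ell2_nth_inject split: list.splits)

lemma creation_in_bounded_ops: "creation k \<in> bounded_ops"
  unfolding bounded_ops_def
  by (auto simp: creation.rep_eq left_shift.rep_eq shift_family_def fun_eq_iff
      simp flip: ell2_nth_inject split: list.splits)

fun creation_word :: "'d list \<Rightarrow> 'd fock_op" where
  "creation_word [] = id_blinfun"
| "creation_word (k # \<alpha>) = creation k o\<^sub>L creation_word \<alpha>"

text \<open>\<open>count_list \<alpha>\<close> is the letter count of \<open>\<alpha>\<close>.\<close>

definition creation_sym :: "('d::finite \<Rightarrow> nat) \<Rightarrow> 'd fock_op" where
  "creation_sym n = (\<Sum>\<alpha> | count_list \<alpha> = n. creation_word \<alpha>)"

lemma finite_count_list_eq: "finite {\<alpha> :: 'd::finite list. count_list \<alpha> = n}"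
proof (rule finite_subset)
  show "{\<alpha>. count_list \<alpha> = n} \<subseteq> {\<alpha>. set \<alpha> \<subseteq> UNIV \<and> length \<alpha> = sum n UNIV}"
  proof safe
    fix \<alpha> :: "'d list"
    have "(\<Sum>k\<in>UNIV. count_list \<alpha> k) = length \<alpha>"
      using sum_count_set[of \<alpha> UNIV] by simp
    then show "length \<alpha> = sum (count_list \<alpha>) UNIV" by simp
  qed auto
qed (rule finite_lists_length_eq, simp)

definition free_disk_algebra :: "'d::finite fock_op set" where
  "free_disk_algebra =
     (\<lambda>X. csubspace X \<and> closed X \<and> id_blinfun \<in> X \<and> (\<forall>S\<in>X. \<forall>T\<in>X. S o\<^sub>L T \<in> X))
       hull range creation"

definition sym_disk_space :: "'d::finite fock_op set" where
  "sym_disk_space = closure (cspan (range creation_sym))"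


section \<open>Free Schur classes and free Aleksandrov-Clark maps\<close>

text \<open>A formal series \<open>\<Sum> Z\<^sup>\<alpha> M\<^sub>\<alpha>\<close> is given by its coefficient family \<open>M\<close>.\<close>

type_synonym ('d, 'h) nc_series = "'d list \<Rightarrow> 'h \<Rightarrow>\<^sub>L 'h"

definition left_times ::
  "('d, 'h::chilbert_space) nc_series \<Rightarrow> ('d list \<Rightarrow> 'h) \<Rightarrow> 'd list \<Rightarrow> 'h" where
  "left_times M F \<gamma> = (\<Sum>(\<alpha>, \<beta>) | \<alpha> @ \<beta> = \<gamma>. blinfun_apply (M \<alpha>) (F \<beta>))"

definition right_times ::
  "('d, 'h::chilbert_space) nc_series \<Rightarrow> ('d list \<Rightarrow> 'h) \<Rightarrow> 'd list \<Rightarrow> 'h" where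
  "right_times M F \<gamma> = (\<Sum>(\<alpha>, \<beta>) | \<beta> @ \<alpha> = \<gamma>. blinfun_apply (M \<alpha>) (F \<beta>))"

definition fock_contraction :: "(('d list \<Rightarrow> 'h::chilbert_space) \<Rightarrow> 'd list \<Rightarrow> 'h) \<Rightarrow> bool" where
  "fock_contraction m \<longleftrightarrow>
     (\<forall>F :: ('d, 'h) fock. \<exists>G :: ('d, 'h) fock. ell2_nth G = m (ell2_nth F) \<and> norm G \<le> norm F)"

definition left_schur_class :: "('d::finite, 'h::chilbert_space) nc_series set" where
  "left_schur_class = {B. range B \<subseteq> bounded_ops \<and> fock_contraction (left_times B)}"

definition right_schur_class :: "('d::finite, 'h::chilbert_space) nc_series set" where
  "right_schur_class = {B. range B \<subseteq> bounded_ops \<and> fock_contraction (right_times B)}"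

definition transpose_conjugate :: "('d, 'h::chilbert_space) nc_series \<Rightarrow> ('d, 'h) nc_series \<Rightarrow> bool" where
  "transpose_conjugate BL BR \<longleftrightarrow> (\<forall>\<alpha>. BR (rev \<alpha>) = BL \<alpha>)"

text \<open>Here \<open>Z k i j\<close>, \<open>i, j < n\<close>, are the entries of the \<open>n \<times> n\<close> matrix \<open>Z\<^sub>k\<close>; indices outside
  this range are ignored.\<close>

definition strict_row_contraction :: "nat \<Rightarrow> ('d::finite \<Rightarrow> nat \<Rightarrow> nat \<Rightarrow> complex) \<Rightarrow> bool" where
  "strict_row_contraction n Z \<longleftrightarrow>
     (\<exists>r. 0 \<le> r \<and> r < 1 \<and>
        (\<forall>x. sqrt (\<Sum>i<n. (cmod (\<Sum>k\<in>UNIV. \<Sum>j<n. Z k i j * x k j))\<^sup>2)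
           \<le> r * sqrt (\<Sum>k\<in>UNIV. \<Sum>j<n. (cmod (x k j))\<^sup>2)))"

fun matrix_word :: "nat \<Rightarrow> ('d \<Rightarrow> nat \<Rightarrow> nat \<Rightarrow> complex) \<Rightarrow> 'd list \<Rightarrow> nat \<Rightarrow> nat \<Rightarrow> complex" where
  "matrix_word n Z [] = (\<lambda>i j. if i = j then 1 else 0)"
| "matrix_word n Z (k # \<alpha>) = (\<lambda>i j. \<Sum>l<n. Z k i l * matrix_word n Z \<alpha> l j)"

definition block_id :: "nat \<Rightarrow> nat \<Rightarrow> 'h::chilbert_space \<Rightarrow>\<^sub>L 'h" where
  "block_id i j = (if i = j then id_blinfun else 0)"

definition block_invertible :: "nat \<Rightarrow> (nat \<Rightarrow> nat \<Rightarrow> 'h::chilbert_space \<Rightarrow>\<^sub>L 'h) \<Rightarrow> bool" where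
  "block_invertible n T \<longleftrightarrow>
     (\<exists>S. \<forall>i<n. \<forall>j<n. S i j \<in> bounded_ops \<and>
        (\<Sum>l<n. S i l o\<^sub>L T l j) = block_id i j \<and> (\<Sum>l<n. T i l o\<^sub>L S l j) = block_id i j)"

text \<open>The \<open>(i, j)\<close> block of \<open>\<Sum> Z\<^sup>\<alpha> \<otimes> B\<^sub>\<alpha>\<close> is \<open>\<Sum> (Z\<^sup>\<alpha>)\<^sub>i\<^sub>j B\<^sub>\<alpha>\<close>. For \<open>B\<close> in the left Schur class the
  column \<open>(B\<^sub>\<alpha>)\<close> is a contraction and the row \<open>(Z\<^sup>\<alpha>)\<close> has finite norm, so the sum converges
  unconditionally in operator norm.\<close>

definition nc_non_unital_series :: "('d::finite, 'h::chilbert_space) nc_series \<Rightarrow> bool" where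
  "nc_non_unital_series B \<longleftrightarrow>
     (\<forall>n Z. strict_row_contraction n Z \<longrightarrow>
        block_invertible n (\<lambda>i j. block_id i j - (\<Sum>\<^sub>\<infinity>\<alpha>. matrix_word n Z \<alpha> i j *\<^sub>C B \<alpha>)))"

definition nc_non_unital ::
  "('d::finite, 'h::chilbert_space) nc_series \<Rightarrow> ('d, 'h) nc_series \<Rightarrow> bool" where
  "nc_non_unital BL BR \<longleftrightarrow> nc_non_unital_series BL \<and> nc_non_unital_series (\<lambda>\<alpha>. BR (rev \<alpha>))"

definition nc_mult ::
  "('d, 'h::chilbert_space) nc_series \<Rightarrow> ('d, 'h) nc_series \<Rightarrow> ('d, 'h) nc_series" where
  "nc_mult M N \<gamma> = (\<Sum>(\<alpha>, \<beta>) | \<alpha> @ \<beta> = \<gamma>. M \<alpha> o\<^sub>L N \<beta>)"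

definition nc_one :: "('d, 'h::chilbert_space) nc_series" where
  "nc_one \<alpha> = (if \<alpha> = [] then id_blinfun else 0)"

definition nc_inverse :: "('d, 'h::chilbert_space) nc_series \<Rightarrow> ('d, 'h) nc_series" where
  "nc_inverse M = (THE N. nc_mult N M = nc_one \<and> nc_mult M N = nc_one)"

definition nc_herglotz :: "('d, 'h::chilbert_space) nc_series \<Rightarrow> ('d, 'h) nc_series" where
  "nc_herglotz B = nc_mult (nc_inverse (\<lambda>\<alpha>. nc_one \<alpha> - B \<alpha>)) (\<lambda>\<alpha>. nc_one \<alpha> + B \<alpha>)"

definition nc_clark_map ::
  "('d::finite, 'h::chilbert_space) nc_series \<Rightarrow> ('d fock_op \<Rightarrow> ('h \<Rightarrow>\<^sub>L 'h)) \<Rightarrow> bool" where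
  "nc_clark_map BL \<mu> \<longleftrightarrow>
     \<mu> \<in> cp_maps (op_system free_disk_algebra) \<and>
     \<mu> id_blinfun = op_Re (nc_herglotz BL []) \<and>
     (\<forall>\<alpha>. \<alpha> \<noteq> [] \<longrightarrow> cadjoint (\<mu> (creation_word (rev \<alpha>))) = (1/2) *\<^sub>C nc_herglotz BL \<alpha>)"


section \<open>The Schur class of Drury-Arveson space and its Aleksandrov-Clark maps\<close>

text \<open>\<open>(V, ip)\<close> is the Hilbert space of \<open>'h\<close>-valued functions on \<open>X\<close> with reproducing kernel
  \<open>K(z, w) I\<close>. Functions on \<open>X\<close> are represented by their extensions by zero.\<close>

definition is_rkhs ::
  "'x set \<Rightarrow> ('x \<Rightarrow> 'x \<Rightarrow> complex) \<Rightarrow> ('x \<Rightarrow> 'h::chilbert_space) set \<Rightarrow>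
   (('x \<Rightarrow> 'h) \<Rightarrow> ('x \<Rightarrow> 'h) \<Rightarrow> complex) \<Rightarrow> bool" where
  "is_rkhs X K V ip \<longleftrightarrow>
     (\<forall>f\<in>V. \<forall>z. z \<notin> X \<longrightarrow> f z = 0) \<and>
     (\<lambda>_. 0) \<in> V \<and>
     (\<forall>f\<in>V. \<forall>g\<in>V. (\<lambda>z. f z + g z) \<in> V) \<and>
     (\<forall>c. \<forall>f\<in>V. (\<lambda>z. c *\<^sub>C f z) \<in> V) \<and>
     (\<forall>f\<in>V. \<forall>g\<in>V. \<forall>h\<in>V. ip f (\<lambda>z. g z + h z) = ip f g + ip f h) \<and>
     (\<forall>c. \<forall>f\<in>V. \<forall>g\<in>V. ip f (\<lambda>z. c *\<^sub>C g z) = c * ip f g) \<and>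
     (\<forall>f\<in>V. \<forall>g\<in>V. ip f g = cnj (ip g f)) \<and>
     (\<forall>f\<in>V. f \<noteq> (\<lambda>_. 0) \<longrightarrow> 0 < Re (ip f f)) \<and>
     (\<forall>u :: nat \<Rightarrow> 'x \<Rightarrow> 'h.
        range u \<subseteq> V \<and>
        (\<forall>e>0. \<exists>N. \<forall>m\<ge>N. \<forall>n\<ge>N.
           sqrt (Re (ip (\<lambda>z. u m z - u n z) (\<lambda>z. u m z - u n z))) < e) \<longrightarrow>
        (\<exists>f\<in>V. (\<lambda>m. sqrt (Re (ip (\<lambda>z. u m z - f z) (\<lambda>z. u m z - f z)))) \<longlonglongrightarrow> 0)) \<and>
     (\<forall>w\<in>X. \<forall>h. (\<lambda>z. if z \<in> X then K z w *\<^sub>C h else 0) \<in> V) \<and>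
     (\<forall>w\<in>X. \<forall>h. \<forall>f\<in>V. ip (\<lambda>z. if z \<in> X then K z w *\<^sub>C h else 0) f = cinner h (f w))"

definition drury_arveson_kernel :: "complex ^ 'd::finite \<Rightarrow> complex ^ 'd \<Rightarrow> complex" where
  "drury_arveson_kernel z w = 1 / (1 - (\<Sum>j\<in>UNIV. z $ j * cnj (w $ j)))"

text \<open>A kernel has exactly one reproducing kernel Hilbert space, so the existential quantifier
  below only names that space.\<close>

definition schur_class :: "(complex ^ 'd::finite \<Rightarrow> 'h::chilbert_space \<Rightarrow>\<^sub>L 'h) set" where
  "schur_class = {b. (\<forall>z\<in>ball 0 1. b z \<in> bounded_ops) \<and>
     (\<exists>V ip. is_rkhs (ball 0 1) drury_arveson_kernel V ip \<and>
        (\<forall>f\<in>V. (\<lambda>z. blinfun_apply (b z) (f z)) \<in> V \<and>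
           sqrt (Re (ip (\<lambda>z. blinfun_apply (b z) (f z)) (\<lambda>z. blinfun_apply (b z) (f z))))
             \<le> sqrt (Re (ip f f))))}"

definition non_unital :: "(complex ^ 'd::finite \<Rightarrow> 'h::chilbert_space \<Rightarrow>\<^sub>L 'h) \<Rightarrow> bool" where
  "non_unital b \<longleftrightarrow> (\<forall>z\<in>ball 0 1. op_invertible (id_blinfun - b z))"

definition herglotz ::
  "(complex ^ 'd::finite \<Rightarrow> 'h::chilbert_space \<Rightarrow>\<^sub>L 'h) \<Rightarrow> complex ^ 'd \<Rightarrow> 'h \<Rightarrow>\<^sub>L 'h" where
  "herglotz b z = op_inverse (id_blinfun - b z) o\<^sub>L (id_blinfun + b z)"

definition zL_star :: "complex ^ 'd::finite \<Rightarrow> 'd fock_op" where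
  "zL_star z = (\<Sum>j\<in>UNIV. (z $ j) *\<^sub>C cadjoint (creation j))"

definition clark_map ::
  "(complex ^ 'd::finite \<Rightarrow> 'h::chilbert_space \<Rightarrow>\<^sub>L 'h) \<Rightarrow> ('d fock_op \<Rightarrow> ('h \<Rightarrow>\<^sub>L 'h)) \<Rightarrow> bool" where
  "clark_map b \<mu> \<longleftrightarrow>
     \<mu> \<in> cp_maps (op_system sym_disk_space) \<and>
     (\<forall>z\<in>ball 0 1. herglotz b z =
        \<mu> (op_inverse (id_blinfun - zL_star z) o\<^sub>L (id_blinfun + zL_star z))
          + \<i> *\<^sub>C op_Im (herglotz b 0))"


section \<open>Free lifts\<close>

definition symmetrizes_to ::
  "('d::finite, 'h::chilbert_space) nc_series \<Rightarrow> (complex ^ 'd \<Rightarrow> 'h \<Rightarrow>\<^sub>L 'h) \<Rightarrow> bool" where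
  "symmetrizes_to B b \<longleftrightarrow>
     (\<forall>z\<in>ball 0 1. ((\<lambda>\<alpha>. (\<Prod>k\<leftarrow>\<alpha>. z $ k) *\<^sub>C B \<alpha>) has_sum b z) UNIV)"

definition free_lifts ::
  "('d::finite, 'h::chilbert_space) nc_series \<Rightarrow> ('d, 'h) nc_series \<Rightarrow>
   (complex ^ 'd \<Rightarrow> 'h \<Rightarrow>\<^sub>L 'h) \<Rightarrow> bool" where
  "free_lifts BL BR b \<longleftrightarrow> symmetrizes_to BL b \<and> symmetrizes_to BR b"

end

theory Submission
  imports Defs
begin

text \<open>
  Both conditions say the same thing about the operators
  \<open>K(z) = (I - zL\<^sup>*)\<^sup>-\<^sup>1 (I + zL\<^sup>*)\<close>, for \<open>z\<close> in the unit ball, namely \<open>\<mu>\<^sub>b(K(z)) = \<mu>\<^sub>B(K(z))\<close>.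

  Let \<open>H\<close> be the Herglotz series of \<open>B\<close>. Since \<open>(zL\<^sup>*)\<^sup>k\<close> is the sum of the \<open>z\<^sup>\<alpha> (L\<^bsup>rev \<alpha>\<^esup>)\<^sup>*\<close> over the
  words \<open>\<alpha>\<close> of length \<open>k\<close>, the definition of \<open>\<mu>\<^sub>B\<close> says that the homogeneous part of degree \<open>k\<close> of \<open>H\<close>
  at the commuting variables \<open>z\<close> is \<open>\<mu>\<^sub>B\<close> of the term of degree \<open>k\<close> in the expansion
  \<open>K(z) = I + 2 zL\<^sup>* + 2 (zL\<^sup>*)\<^sup>2 + \<dots>\<close>, up to an imaginary constant in degree \<open>0\<close>
  (\<open>nc_clark_map_homogeneous_part\<close>). As \<open>\<parallel>zL\<^sup>*\<parallel> \<le> \<parallel>z\<parallel>\<close> and completely positive maps are bounded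
  (\<open>cp_maps_norm_le\<close>), \<open>H\<close> converges on the ball when it is summed by degree, with value
  \<open>\<mu>\<^sub>B(K(z)) + \<i> Im H\<^sub>\<emptyset>\<close>. \<open>B\<close> converges as well, because its coefficients form a contractive column; let \<open>\<beta>(z)\<close>
  be its value. The formal identity \<open>(1 - B) H = 1 + B\<close> may then be evaluated at \<open>z\<close>, which shows that
  \<open>\<mu>\<^sub>B(K(z)) + \<i> Im H\<^sub>\<emptyset>\<close> is the Cayley transform of \<open>\<beta>(z)\<close> (\<open>herglotz_of_symmetrization\<close>). By the
  Herglotz representation, \<open>\<mu>\<^sub>b(K(z)) + \<i> Im H\<^sub>b(0)\<close> is the Cayley transform of \<open>b(z)\<close>. The imaginary
  constants agree and the Cayley transform is injective (\<open>herglotz_determines\<close>), so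
  \<open>\<beta>(z) = b(z)\<close> iff \<open>\<mu>\<^sub>b(K(z)) = \<mu>\<^sub>B(K(z))\<close>.

  The \<open>K(z)\<close> lie in the symmetrized operator system, so \<open>\<mu>\<^sub>b\<close> and \<open>\<mu>\<^sub>B\<close> agree on them if \<open>\<mu>\<^sub>B\<close>
  extends \<open>\<mu>\<^sub>b\<close>. Conversely the \<open>K(z)\<close> determine a completely positive map on that system
  (\<open>cp_maps_eq_of_herglotz_kernels\<close>): grouping words by their letter count gives
  \<open>(zL\<^sup>*)\<^sup>k = \<Sum> z\<^sup>n (L\<^sup>n)\<^sup>*\<close>, so that comparing coefficients of power series gives equality on all
  \<open>(L\<^sup>n)\<^sup>*\<close>, hence on all \<open>L\<^sup>n\<close> as completely positive maps preserve adjoints, and by continuity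
  everywhere.
\<close>


section \<open>Inner products, representation of functionals, adjoints\<close>

instance chilbert_space \<subseteq> banach ..

lemma cinner_add_left: "cinner (x + y) z = cinner x z + cinner y (z :: 'a :: chilbert_space)"
  by (metis cinner_add_right cinner_commute complex_cnj_add)

lemma cinner_scaleC_left: "cinner (c *\<^sub>C x) y = cnj c * cinner x (y :: 'a :: chilbert_space)"
  by (metis cinner_commute cinner_scaleC_right complex_cnj_mult)

lemma bounded_linear_cinner_right: "bounded_linear (\<lambda>y. cinner x (y :: 'a :: chilbert_space))"
proof
  show "cinner x (r *\<^sub>R y) = r *\<^sub>R cinner x y" for r y
    by (simp add: scaleC_of_real[symmetric] cinner_scaleC_right scaleC_complex_def)
  show "\<exists>K. \<forall>y. norm (cinner x y) \<le> norm y * K"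
    by (metis cmod_cinner_le mult.commute)
qed (rule cinner_add_right)

lemma bounded_linear_cinner_left: "bounded_linear (\<lambda>x. cinner x (y :: 'a :: chilbert_space))"
proof -
  have "bounded_linear (\<lambda>x. cnj (cinner y x))"
    by (rule bounded_linear_compose[OF bounded_linear_cnj bounded_linear_cinner_right])
  then show ?thesis
    by (simp flip: cinner_commute)
qed

lemmas cinner_diff_right = linear_diff[OF bounded_linear.linear[OF bounded_linear_cinner_right]]
lemmas cinner_sum_right = linear_sum[OF bounded_linear.linear[OF bounded_linear_cinner_right]]
lemmas cinner_zero_right [simp] = linear_0[OF bounded_linear.linear[OF bounded_linear_cinner_right]]
lemmas cinner_zero_left [simp] = linear_0[OF bounded_linear.linear[OF bounded_linear_cinner_left]]
lemmas cinner_diff_left = linear_diff[OF bounded_linear.linear[OF bounded_linear_cinner_left]]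

lemma cinner_self: "cinner x x = complex_of_real ((norm (x :: 'a :: chilbert_space))\<^sup>2)"
proof -
  have "cinner x x = cnj (cinner x x)"
    by (rule cinner_commute)
  then have "Im (cinner x x) = 0"
    by (metis Reals_cnj_iff complex_is_Real_iff)
  then show ?thesis
    by (simp add: complex_eq_iff power2_norm_eq_inner inner_eq_Re_cinner)
qed

lemma cinner_right_eqI:
  fixes y z :: "'a :: chilbert_space"
  assumes "\<And>x. cinner x y = cinner x z"
  shows "y = z"
proof -
  have "cinner (y - z) (y - z) = 0"
    using assms[of "y - z"] by (simp add: cinner_diff_right)
  then show ?thesis
    by (simp add: cinner_self)
qed

text \<open>The vector \<open>w\<close> represents \<open>f\<close> iff it is a critical point of \<open>J x = \<parallel>x\<parallel>\<^sup>2 / 2 - f x\<close>. By the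
  parallelogram identity \<open>J\<close> is uniformly convex, so that its minimizing sequences are Cauchy and a
  minimizer exists.\<close>

lemma riesz_representation:
  fixes f :: "'a :: {real_inner, complete_space} \<Rightarrow> real"
  assumes "bounded_linear f"
  obtains w where "\<And>x. inner w x = f x"
proof -
  interpret f: bounded_linear f by fact
  define J where "J x = (norm x)\<^sup>2 / 2 - f x" for x
  have low: "- ((onorm f)\<^sup>2 / 2) \<le> J x" for x
  proof -
    have "f x \<le> onorm f * norm x"
      using onorm[OF assms, of x] by simp
    moreover have "0 \<le> (norm x - onorm f)\<^sup>2" by simp
    ultimately show ?thesis
      by (simp add: J_def power2_diff algebra_simps)
  qed
  have bdd: "bdd_below (range J)"
    using low by (intro bdd_belowI[of _ "- ((onorm f)\<^sup>2 / 2)"]) auto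
  define m where "m = (INF x. J x)"
  have m_le: "m \<le> J x" for x
    unfolding m_def by (rule cINF_lower[OF bdd]) simp
  have convex: "(norm (x - y))\<^sup>2 \<le> 4 * (J x - m) + 4 * (J y - m)" for x y
  proof -
    have "(norm (x - y))\<^sup>2 = 4 * J x + 4 * J y - 8 * J ((1/2) *\<^sub>R (x + y))"
      by (simp add: J_def power_mult_distrib f.add f.scaleR power2_norm_eq_inner field_simps
          inner_add_left inner_add_right inner_diff_left inner_diff_right inner_commute)
    then show ?thesis
      using m_le[of "(1/2) *\<^sub>R (x + y)"] by simp
  qed
  have "\<exists>x. J x < m + 1 / real (Suc n)" for n
    using cINF_less_iff[of UNIV J, OF _ bdd, of "m + 1 / real (Suc n)"]
    by (auto simp: m_def[symmetric])
  then obtain u where u: "\<And>n. J (u n) < m + 1 / real (Suc n)"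
    by metis
  have "Cauchy u"
  proof (rule metric_CauchyI)
    fix e :: real assume "0 < e"
    then obtain N where N: "8 / (e\<^sup>2) < real N"
      using reals_Archimedean2 by blast
    have "dist (u i) (u j) < e" if "N \<le> i" "N \<le> j" for i j
    proof -
      have le: "1 / real (Suc i) \<le> 1 / real (Suc N)" "1 / real (Suc j) \<le> 1 / real (Suc N)"
        using that by (auto intro!: divide_left_mono)
      have "(norm (u i - u j))\<^sup>2 \<le> 8 * (1 / real (Suc N))"
        using convex[of "u i" "u j"] u[of i] u[of j] le by argo
      also have "\<dots> < e\<^sup>2"
        using N \<open>0 < e\<close> by (simp add: field_simps) (smt (verit) zero_less_power)
      finally show ?thesis
        using \<open>0 < e\<close> by (simp add: dist_norm power2_less_imp_less)
    qed
    then show "\<exists>M. \<forall>i\<ge>M. \<forall>j\<ge>M. dist (u i) (u j) < e" by blast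
  qed
  then obtain w where w: "u \<longlonglongrightarrow> w"
    using Cauchy_convergent_iff convergent_def by blast
  have "(\<lambda>n. J (u n)) \<longlonglongrightarrow> J w"
    unfolding J_def by (intro tendsto_intros w f.tendsto) simp
  moreover have "(\<lambda>n. m + 1 / real (Suc n)) \<longlonglongrightarrow> m + 0"
    by (intro tendsto_intros LIMSEQ_Suc[OF lim_1_over_n])
  ultimately have "J w \<le> m"
    using u by (intro LIMSEQ_le[of "\<lambda>n. J (u n)" _ "\<lambda>n. m + 1 / real (Suc n)"]) (auto intro: less_imp_le)
  have "inner w x = f x" for x
  proof (rule ccontr)
    assume ne: "inner w x \<noteq> f x"
    define a where "a = inner w x - f x"
    have ineq: "0 \<le> t * a + t\<^sup>2 * (norm x)\<^sup>2 / 2" for t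
    proof -
      have "J w \<le> J (w + t *\<^sub>R x)"
        using \<open>J w \<le> m\<close> m_le order_trans by blast
      then show ?thesis
        by (simp add: J_def a_def f.add f.scaleR power2_norm_eq_inner inner_add_left
            inner_add_right inner_commute power2_eq_square[of t] algebra_simps)
    qed
    \<comment> \<open>For \<open>t = - a / N\<close> the linear term \<open>- a\<^sup>2 / N\<close> beats the quadratic one, which is at most
      \<open>a\<^sup>2 / (2 N)\<close>.\<close>
    define N where "N = (norm x)\<^sup>2 + 1"
    have "N > 0" by (simp add: N_def add_nonneg_pos)
    have "0 \<le> (- (a / N)) * a + (- (a / N))\<^sup>2 * (norm x)\<^sup>2 / 2" by (rule ineq)
    also have "\<dots> \<le> (- (a / N)) * a + (- (a / N))\<^sup>2 * N / 2"
      by (intro add_left_mono divide_right_mono mult_left_mono) (auto simp: N_def)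
    also have "\<dots> = - (a\<^sup>2 / (2 * N))"
      using \<open>N > 0\<close> by (simp add: power2_eq_square field_simps)
    also have "\<dots> < 0"
      using \<open>N > 0\<close> ne by (simp add: a_def)
    finally show False by simp
  qed
  then show ?thesis using that by blast
qed

lemma bounded_opsD: "T \<in> bounded_ops \<Longrightarrow> blinfun_apply T (c *\<^sub>C x) = c *\<^sub>C blinfun_apply T x"
  by (simp add: bounded_ops_def)

text \<open>The Riesz representation supplies the real part of the identity; applying it at \<open>\<i> x\<close> gives the
  imaginary part.\<close>

lemma adjoint_exists:
  fixes T :: "'a::chilbert_space \<Rightarrow>\<^sub>L 'b::chilbert_space"
  assumes "T \<in> bounded_ops"
  shows "\<exists>S. \<forall>x y. cinner (blinfun_apply T x) y = cinner x (blinfun_apply S y)"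
proof -
  have "\<exists>w. \<forall>x. cinner (blinfun_apply T x) y = cinner x w" for y
  proof -
    have "bounded_linear (\<lambda>x. inner (blinfun_apply T x) y)"
      by (intro bounded_linear_inner_left_comp blinfun.bounded_linear_right)
    then obtain w where w: "\<And>x. inner w x = inner (blinfun_apply T x) y"
      using riesz_representation by blast
    have Re: "Re (cinner (blinfun_apply T x) y) = Re (cinner x w)" for x
      using w[of x] by (simp add: inner_eq_Re_cinner[symmetric] inner_commute)
    have "cinner (blinfun_apply T x) y = cinner x w" for x
      using Re[of x] Re[of "\<i> *\<^sub>C x"]
      by (simp add: bounded_opsD[OF assms] cinner_scaleC_left complex_eq_iff)
    then show ?thesis by blast
  qed
  then obtain S where S: "\<And>x y. cinner (blinfun_apply T x) y = cinner x (S y)"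
    by metis
  have "bounded_linear S"
  proof
    show "S (y + z) = S y + S z" for y z
      by (rule cinner_right_eqI) (simp add: S[symmetric] cinner_add_right)
    show "S (r *\<^sub>R y) = r *\<^sub>R S y" for r y
      by (rule cinner_right_eqI)
        (simp add: S[symmetric] cinner_scaleC_right scaleC_of_real[symmetric])
    show "\<exists>K. \<forall>y. norm (S y) \<le> norm y * K"
    proof (intro exI allI)
      fix y
      have "(norm (S y))\<^sup>2 = cmod (cinner (blinfun_apply T (S y)) y)"
        by (simp add: S cinner_self norm_power)
      also have "\<dots> \<le> (norm T * norm (S y)) * norm y"
        by (rule order_trans[OF cmod_cinner_le mult_right_mono[OF norm_blinfun norm_ge_zero]])
      finally have "norm (S y) * norm (S y) \<le> norm (S y) * (norm y * norm T)"
        by (simp add: power2_eq_square mult_ac)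
      then show "norm (S y) \<le> norm y * norm T"
        by (cases "S y = 0") auto
    qed
  qed
  then show ?thesis
    using S by (intro exI[of _ "Blinfun S"]) (simp add: bounded_linear_Blinfun_apply)
qed

lemma cadjoint_eqI:
  assumes "\<And>x y. cinner (blinfun_apply T x) y = cinner x (blinfun_apply S y)"
  shows "cadjoint T = S"
  unfolding cadjoint_def
proof (rule the_equality)
  fix S' assume "\<forall>x y. cinner (blinfun_apply T x) y = cinner x (blinfun_apply S' y)"
  with assms show "S' = S"
    by - (rule blinfun_eqI, rule cinner_right_eqI, metis)
qed (use assms in blast)

lemma cinner_cadjoint:
  assumes "T \<in> bounded_ops"
  shows "cinner (blinfun_apply T x) y = cinner x (blinfun_apply (cadjoint T) y)"
  using adjoint_exists[OF assms] cadjoint_eqI[of T] by blast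

lemma cinner_cadjoint_left:
  assumes "T \<in> bounded_ops"
  shows "cinner (blinfun_apply (cadjoint T) x) y = cinner x (blinfun_apply T y)"
  by (metis assms cinner_cadjoint cinner_commute)

lemma cadjoint_bounded_ops:
  assumes "T \<in> bounded_ops"
  shows "cadjoint T \<in> bounded_ops"
proof -
  have "blinfun_apply (cadjoint T) (c *\<^sub>C x) = c *\<^sub>C blinfun_apply (cadjoint T) x" for c x
    by (rule cinner_right_eqI) (simp add: cinner_cadjoint[OF assms, symmetric] cinner_scaleC_right)
  then show ?thesis
    by (simp add: bounded_ops_def)
qed

lemma cadjoint_cadjoint: "T \<in> bounded_ops \<Longrightarrow> cadjoint (cadjoint T) = T"
  by (rule cadjoint_eqI) (rule cinner_cadjoint_left)

lemma bounded_ops_add: "S \<in> bounded_ops \<Longrightarrow> T \<in> bounded_ops \<Longrightarrow> S + T \<in> bounded_ops"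
  by (simp add: bounded_ops_def blinfun.add_left scaleC_add_right)

lemma bounded_ops_scaleC: "T \<in> bounded_ops \<Longrightarrow> c *\<^sub>C T \<in> bounded_ops"
  by (simp add: bounded_ops_def scaleC_blinfun.rep_eq scaleC_scaleC mult.commute)

lemma bounded_ops_compose: "S \<in> bounded_ops \<Longrightarrow> T \<in> bounded_ops \<Longrightarrow> S o\<^sub>L T \<in> bounded_ops"
  by (simp add: bounded_ops_def)

lemma bounded_ops_id: "id_blinfun \<in> bounded_ops"
  by (simp add: bounded_ops_def)

lemma bounded_ops_zero: "0 \<in> bounded_ops"
  using bounded_ops_scaleC[OF bounded_ops_id, of 0] by (simp add: bounded_ops_def)

lemma csubspace_bounded_ops: "csubspace bounded_ops"
  by (simp add: complex_vector.subspace_def bounded_ops_add bounded_ops_scaleC bounded_ops_zero)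

lemma bounded_ops_diff: "S \<in> bounded_ops \<Longrightarrow> T \<in> bounded_ops \<Longrightarrow> S - T \<in> bounded_ops"
  by (rule complex_vector.subspace_diff[OF csubspace_bounded_ops])

lemma closed_bounded_ops: "closed (bounded_ops :: ('a::chilbert_space \<Rightarrow>\<^sub>L 'b::chilbert_space) set)"
proof -
  have eq: "bounded_ops = (\<Inter>c. \<Inter>x. {T :: 'a \<Rightarrow>\<^sub>L 'b. blinfun_apply T (c *\<^sub>C x) = c *\<^sub>C blinfun_apply T x})"
    by (auto simp: bounded_ops_def)
  show ?thesis
    unfolding eq
    by (intro closed_INT ballI closed_Collect_eq continuous_intros
        bounded_linear.continuous_on[OF bounded_linear_scaleC])
qed

lemma cadjoint_add:
  "S \<in> bounded_ops \<Longrightarrow> T \<in> bounded_ops \<Longrightarrow> cadjoint (S + T) = cadjoint S + cadjoint T"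
  by (rule cadjoint_eqI)
    (simp add: blinfun.add_left cinner_add_left cinner_add_right cinner_cadjoint)

lemma cadjoint_scaleC: "T \<in> bounded_ops \<Longrightarrow> cadjoint (c *\<^sub>C T) = cnj c *\<^sub>C cadjoint T"
  by (rule cadjoint_eqI)
    (simp add: scaleC_blinfun.rep_eq cinner_scaleC_left cinner_scaleC_right cinner_cadjoint)

lemma cadjoint_compose:
  "S \<in> bounded_ops \<Longrightarrow> T \<in> bounded_ops \<Longrightarrow> cadjoint (S o\<^sub>L T) = cadjoint T o\<^sub>L cadjoint S"
  by (rule cadjoint_eqI) (simp add: cinner_cadjoint)

lemma cadjoint_id: "cadjoint id_blinfun = id_blinfun"
  by (rule cadjoint_eqI) simp

lemma cadjoint_zero [simp]: "cadjoint 0 = 0"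
  by (rule cadjoint_eqI) simp

lemma cadjoint_diff:
  assumes "S \<in> bounded_ops" "T \<in> bounded_ops"
  shows "cadjoint (S - T) = cadjoint S - cadjoint T"
  by (rule cadjoint_eqI)
    (simp add: blinfun.diff_left cinner_diff_left cinner_diff_right cinner_cadjoint assms)

lemma cadjoint_sum:
  assumes "\<And>i. i \<in> I \<Longrightarrow> T i \<in> bounded_ops"
  shows "cadjoint (\<Sum>i\<in>I. T i) = (\<Sum>i\<in>I. cadjoint (T i))"
  using assms
  by (induction I rule: infinite_finite_induct)
    (auto simp: cadjoint_add complex_vector.subspace_sum[OF csubspace_bounded_ops])

lemma norm_cadjoint_le:
  assumes "S \<in> bounded_ops"
  shows "norm (cadjoint S) \<le> norm S"
proof (rule norm_blinfun_bound)
  fix y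
  let ?w = "blinfun_apply (cadjoint S) y"
  have "(norm ?w)\<^sup>2 = cmod (cinner (blinfun_apply S ?w) y)"
    by (simp add: cinner_cadjoint[OF assms] cinner_self norm_power)
  also have "\<dots> \<le> (norm S * norm ?w) * norm y"
    by (rule order_trans[OF cmod_cinner_le mult_right_mono[OF norm_blinfun norm_ge_zero]])
  finally have "norm ?w * norm ?w \<le> norm ?w * (norm S * norm y)"
    by (simp add: power2_eq_square mult_ac)
  then show "norm ?w \<le> norm S * norm y"
    by (cases "?w = 0") auto
qed simp

lemma norm_cadjoint: "T \<in> bounded_ops \<Longrightarrow> norm (cadjoint T) = norm T"
  using norm_cadjoint_le[of T] norm_cadjoint_le[OF cadjoint_bounded_ops, of T]
  by (simp add: cadjoint_cadjoint)

lemma cadjoint_tendsto: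
  assumes "(f \<longlongrightarrow> T) F" "\<And>i. f i \<in> bounded_ops" "T \<in> bounded_ops"
  shows "((\<lambda>i. cadjoint (f i)) \<longlongrightarrow> cadjoint T) F"
proof (rule Lim_null[THEN iffD2], rule tendsto_norm_zero_cancel)
  have "norm (cadjoint (f i) - cadjoint T) = norm (f i - T)" for i
    by (simp add: cadjoint_diff[symmetric] norm_cadjoint bounded_ops_diff assms)
  then show "((\<lambda>i. norm (cadjoint (f i) - cadjoint T)) \<longlongrightarrow> 0) F"
    using tendsto_norm_zero[OF Lim_null[THEN iffD1, OF assms(1)]] by simp
qed

lemma scaleC_minus_one: "(- 1) *\<^sub>C x = - (x :: 'a :: complex_vector)"
  by (metis complex_vector.scale_minus_left complex_vector.scale_one)

lemma sesquilinear_polarization: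
  assumes "T \<in> bounded_ops"
  shows "4 * cinner x (blinfun_apply T y) =
    cinner (x + y) (blinfun_apply T (x + y)) - cinner (x - y) (blinfun_apply T (x - y))
    - \<i> * cinner (x + \<i> *\<^sub>C y) (blinfun_apply T (x + \<i> *\<^sub>C y))
    + \<i> * cinner (x - \<i> *\<^sub>C y) (blinfun_apply T (x - \<i> *\<^sub>C y))"
  by (simp add: blinfun.add_right blinfun.diff_right bounded_opsD[OF assms] cinner_add_left
      cinner_add_right cinner_diff_left cinner_diff_right cinner_scaleC_left cinner_scaleC_right
      algebra_simps)


section \<open>Operator systems\<close>

text \<open>Norm closedness makes the sums of norm convergent series available, and complex linearity
  guarantees that adjoints exist.\<close>

definition operator_system :: "('k::chilbert_space \<Rightarrow>\<^sub>L 'k) set \<Rightarrow> bool" where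
  "operator_system E \<longleftrightarrow> csubspace E \<and> closed E \<and> E \<subseteq> bounded_ops \<and> id_blinfun \<in> E \<and>
     (\<forall>T\<in>E. cadjoint T \<in> E)"

lemma csubspace_closure:
  fixes M :: "'a::complex_normed_vector set"
  assumes "csubspace M"
  shows "csubspace (closure M)"
proof (rule complex_vector.subspaceI)
  show "0 \<in> closure M"
    using complex_vector.subspace_0[OF assms] closure_subset by blast
  show "x + y \<in> closure M" if "x \<in> closure M" "y \<in> closure M" for x y
  proof -
    from that obtain u v where uv: "\<And>n. u n \<in> M" "u \<longlonglongrightarrow> x" "\<And>n. v n \<in> M" "v \<longlonglongrightarrow> y"
      by (metis closure_sequential)
    have "u n + v n \<in> M" for n
      by (rule complex_vector.subspace_add[OF assms uv(1) uv(3)])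
    moreover have "(\<lambda>n. u n + v n) \<longlonglongrightarrow> x + y"
      by (rule tendsto_add[OF uv(2) uv(4)])
    ultimately show ?thesis
      unfolding closure_sequential by (intro exI[of _ "\<lambda>n. u n + v n"]) simp
  qed
  show "c *\<^sub>C x \<in> closure M" if "x \<in> closure M" for c x
  proof -
    from that obtain u where u: "\<And>n. u n \<in> M" "u \<longlonglongrightarrow> x"
      by (metis closure_sequential)
    have "c *\<^sub>C u n \<in> M" for n
      by (rule complex_vector.subspace_scale[OF assms u(1)])
    moreover have "(\<lambda>n. c *\<^sub>C u n) \<longlonglongrightarrow> c *\<^sub>C x"
      by (rule bounded_linear.tendsto[OF bounded_linear_scaleC u(2)])
    ultimately show ?thesis
      unfolding closure_sequential by (intro exI[of _ "\<lambda>n. c *\<^sub>C u n"]) simp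
  qed
qed

lemma operator_system_op_system:
  fixes M :: "('k::chilbert_space \<Rightarrow>\<^sub>L 'k) set"
  assumes M: "csubspace M" "M \<subseteq> bounded_ops" "id_blinfun \<in> M"
  shows "operator_system (op_system M)"
proof -
  let ?D = "{S + cadjoint T | S T. S \<in> M \<and> T \<in> M}"
  have 0: "0 \<in> M"
    by (rule complex_vector.subspace_0[OF M(1)])
  have D: "?D \<subseteq> bounded_ops"
    using M(2) by (auto intro!: bounded_ops_add cadjoint_bounded_ops)
  have "csubspace ?D"
  proof (rule complex_vector.subspaceI)
    show "0 \<in> ?D"
      using 0 by force
    show "x + y \<in> ?D" if "x \<in> ?D" "y \<in> ?D" for x y
    proof -
      from that obtain S T S' T' where *: "x = S + cadjoint T" "y = S' + cadjoint T'"
        "S \<in> M" "T \<in> M" "S' \<in> M" "T' \<in> M" by blast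
      then have "x + y = (S + S') + cadjoint (T + T')"
        using M(2) by (simp add: cadjoint_add subset_iff)
      then show ?thesis
        using * complex_vector.subspace_add[OF M(1)] by blast
    qed
    show "c *\<^sub>C x \<in> ?D" if "x \<in> ?D" for c x
    proof -
      from that obtain S T where *: "x = S + cadjoint T" "S \<in> M" "T \<in> M" by blast
      then have "c *\<^sub>C x = c *\<^sub>C S + cadjoint (cnj c *\<^sub>C T)"
        using M(2) by (simp add: cadjoint_scaleC subset_iff scaleC_add_right)
      then show ?thesis
        using * complex_vector.subspace_scale[OF M(1)] by blast
    qed
  qed
  then have sub: "csubspace (op_system M)"
    unfolding op_system_def by (rule csubspace_closure)
  have bd: "op_system M \<subseteq> bounded_ops"
    unfolding op_system_def by (rule closure_minimal[OF D closed_bounded_ops])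
  have "id_blinfun = id_blinfun + cadjoint (0 :: 'k \<Rightarrow>\<^sub>L 'k)"
    by simp
  then have "id_blinfun \<in> ?D"
    using M(3) 0 by blast
  then have id: "id_blinfun \<in> op_system M"
    unfolding op_system_def by (rule subsetD[OF closure_subset])
  have adj: "cadjoint T \<in> op_system M" if "T \<in> op_system M" for T
  proof -
    from that have "\<exists>u. (\<forall>n. u n \<in> ?D) \<and> u \<longlonglongrightarrow> T"
      unfolding op_system_def closure_sequential .
    then obtain u where u: "\<forall>n. u n \<in> ?D" "u \<longlonglongrightarrow> T"
      by (elim exE conjE)
    have "cadjoint (u n) \<in> ?D" for n
    proof -
      have "u n \<in> ?D"
        using u(1) by (rule spec)
      then obtain R S where *: "u n = R + cadjoint S" "R \<in> M" "S \<in> M" by blast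
      then have "cadjoint (u n) = S + cadjoint R"
        using M(2) by (simp add: cadjoint_add subset_iff cadjoint_bounded_ops cadjoint_cadjoint)
      then show ?thesis
        using * by blast
    qed
    moreover have "(\<lambda>n. cadjoint (u n)) \<longlonglongrightarrow> cadjoint T"
      using u D bd that by (intro cadjoint_tendsto) blast+
    ultimately show ?thesis
      unfolding op_system_def closure_sequential by (intro exI[of _ "\<lambda>n. cadjoint (u n)"]) simp
  qed
  show ?thesis
    using sub bd id adj by (simp add: operator_system_def op_system_def)
qed

lemma op_system_mono: "M \<subseteq> N \<Longrightarrow> op_system M \<subseteq> op_system N"
  unfolding op_system_def by (rule closure_mono) blast

lemma subset_op_system:
  assumes "csubspace M"
  shows "M \<subseteq> op_system M"
proof
  fix S assume "S \<in> M"
  moreover have "0 \<in> M"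
    by (rule complex_vector.subspace_0[OF assms])
  moreover have "S = S + cadjoint 0" by simp
  ultimately have "S \<in> {S + cadjoint T | S T. S \<in> M \<and> T \<in> M}"
    by blast
  then show "S \<in> op_system M"
    unfolding op_system_def by (rule subsetD[OF closure_subset])
qed


section \<open>Completely positive maps are bounded and preserve adjoints\<close>

lemma cp_maps_add: "\<phi> \<in> cp_maps E \<Longrightarrow> S \<in> E \<Longrightarrow> T \<in> E \<Longrightarrow> \<phi> (S + T) = \<phi> S + \<phi> T"
  by (simp add: cp_maps_def)

lemma cp_maps_scaleC: "\<phi> \<in> cp_maps E \<Longrightarrow> T \<in> E \<Longrightarrow> \<phi> (c *\<^sub>C T) = c *\<^sub>C \<phi> T"
  by (simp add: cp_maps_def)

lemma cp_maps_bounded_ops: "\<phi> \<in> cp_maps E \<Longrightarrow> T \<in> E \<Longrightarrow> \<phi> T \<in> bounded_ops"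
  by (simp add: cp_maps_def)

lemma cp_maps_diff:
  assumes "\<phi> \<in> cp_maps E" "operator_system E" "S \<in> E" "T \<in> E"
  shows "\<phi> (S - T) = \<phi> S - \<phi> T"
proof -
  have "(- 1) *\<^sub>C T \<in> E"
    using assms(2,4) unfolding operator_system_def by (intro complex_vector.subspace_scale) auto
  then have "\<phi> (S + (- 1) *\<^sub>C T) = \<phi> S + (- 1) *\<^sub>C \<phi> T"
    using assms by (simp only: cp_maps_add[OF assms(1)] cp_maps_scaleC[OF assms(1)])
  then show ?thesis
    by (simp add: scaleC_minus_one)
qed

lemma cp_maps_sum:
  assumes "\<phi> \<in> cp_maps E" "operator_system E" "\<And>i. i \<in> I \<Longrightarrow> T i \<in> E"
  shows "\<phi> (\<Sum>i\<in>I. T i) = (\<Sum>i\<in>I. \<phi> (T i))"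
proof -
  have E: "csubspace E"
    using assms(2) by (simp add: operator_system_def)
  have "\<phi> 0 = 0"
    using cp_maps_scaleC[OF assms(1) complex_vector.subspace_0[OF E], of 0] by simp
  then show ?thesis
    using assms(3)
    by (induction I rule: infinite_finite_induct)
      (auto simp: cp_maps_add[OF assms(1)] complex_vector.subspace_sum[OF E])
qed

lemma cp_maps_positive:
  assumes "\<phi> \<in> cp_maps E" "T \<in> E" "\<And>x. cinner x (blinfun_apply T x) \<in> \<real>\<^sub>\<ge>\<^sub>0"
  shows "cinner y (blinfun_apply (\<phi> T) y) \<in> \<real>\<^sub>\<ge>\<^sub>0"
proof -
  have "block_positive 1 (\<lambda>_ _. T)"
    using assms(3) by (simp add: block_positive_def)
  then have "block_positive 1 (\<lambda>_ _. \<phi> T)"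
    using assms(1,2) by (simp add: cp_maps_def)
  then show ?thesis
    unfolding block_positive_def by (auto dest: spec[of _ "\<lambda>_. y"])
qed

lemma cinner_selfadjoint_real:
  assumes "T \<in> bounded_ops" "cadjoint T = T"
  shows "Im (cinner x (blinfun_apply T x)) = 0"
proof -
  have "cinner x (blinfun_apply T x) = cnj (cinner x (blinfun_apply T x))"
    by (metis assms cinner_cadjoint cinner_commute)
  then show ?thesis
    by (metis Reals_cnj_iff complex_is_Real_iff)
qed

text \<open>For self-adjoint \<open>T\<close> both \<open>\<parallel>T\<parallel> I \<plusminus> T\<close> are positive, and so are their images.\<close>

lemma cp_maps_selfadjoint_bound:
  assumes "\<phi> \<in> cp_maps E" "operator_system E" "T \<in> E" "cadjoint T = T"
  shows "Im (cinner x (blinfun_apply (\<phi> T) x)) = 0"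
    and "\<bar>Re (cinner x (blinfun_apply (\<phi> T) x))\<bar> \<le> norm T * (norm (\<phi> id_blinfun) * (norm x)\<^sup>2)"
proof -
  define r where "r = complex_of_real (norm T)"
  have E: "id_blinfun \<in> E" "r *\<^sub>C id_blinfun \<in> E"
      "T \<in> bounded_ops"
    using assms(2,3) by (auto simp: operator_system_def complex_vector.subspace_scale)
  have sum: "r *\<^sub>C id_blinfun + T \<in> E" "r *\<^sub>C id_blinfun - T \<in> E"
    using assms(2,3) E
    by (auto simp: operator_system_def complex_vector.subspace_add complex_vector.subspace_diff)
  have bnd: "\<bar>Re (cinner y (blinfun_apply T y))\<bar> \<le> norm T * (norm y)\<^sup>2" for y
  proof -
    have "cmod (cinner y (blinfun_apply T y)) \<le> norm y * (norm T * norm y)"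
      using cmod_cinner_le norm_blinfun mult_left_mono norm_ge_zero order_trans
      by (metis (no_types, opaque_lifting))
    then show ?thesis
      using abs_Re_le_cmod[of "cinner y (blinfun_apply T y)"]
      by (simp add: power2_eq_square mult_ac)
  qed
  have real: "Im (cinner y (blinfun_apply T y)) = 0" for y
    by (rule cinner_selfadjoint_real[OF E(3) assms(4)])
  have pos: "cinner y (blinfun_apply (r *\<^sub>C id_blinfun + T) y) \<in> \<real>\<^sub>\<ge>\<^sub>0"
      "cinner y (blinfun_apply (r *\<^sub>C id_blinfun - T) y) \<in> \<real>\<^sub>\<ge>\<^sub>0" for y
    using bnd[of y] real[of y]
    by (auto simp: complex_nonneg_Reals_iff blinfun.add_left blinfun.diff_left cinner_add_right
        cinner_diff_right scaleC_blinfun.rep_eq cinner_scaleC_right cinner_self r_def)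
  define q where "q = cinner x (blinfun_apply (\<phi> id_blinfun) x)"
  define p where "p = cinner x (blinfun_apply (\<phi> T) x)"
  have "\<phi> (r *\<^sub>C id_blinfun + T) = r *\<^sub>C \<phi> id_blinfun + \<phi> T"
      "\<phi> (r *\<^sub>C id_blinfun - T) = r *\<^sub>C \<phi> id_blinfun - \<phi> T"
    using E assms(3)
    by (simp_all add: cp_maps_add[OF assms(1)] cp_maps_diff[OF assms(1,2)] cp_maps_scaleC[OF assms(1)])
  then have "r * q + p \<in> \<real>\<^sub>\<ge>\<^sub>0" "r * q - p \<in> \<real>\<^sub>\<ge>\<^sub>0"
    using cp_maps_positive[OF assms(1) sum(1) pos(1), of x]
      cp_maps_positive[OF assms(1) sum(2) pos(2), of x]
    by (simp_all add: q_def p_def blinfun.add_left blinfun.diff_left cinner_add_right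
        cinner_diff_right scaleC_blinfun.rep_eq cinner_scaleC_right)
  moreover have "q \<in> \<real>\<^sub>\<ge>\<^sub>0"
    unfolding q_def
    by (rule cp_maps_positive[OF assms(1) E(1)]) (simp add: cinner_self complex_nonneg_Reals_iff)
  ultimately have "Im p = 0" "\<bar>Re p\<bar> \<le> norm T * Re q"
    by (auto simp: complex_nonneg_Reals_iff r_def)
  then show "Im (cinner x (blinfun_apply (\<phi> T) x)) = 0"
    by (simp add: p_def)
  have "Re q \<le> norm x * (norm (\<phi> id_blinfun) * norm x)"
    unfolding q_def
    using complex_Re_le_cmod cmod_cinner_le norm_blinfun mult_left_mono norm_ge_zero order_trans
    by (metis (no_types, opaque_lifting))
  then have "norm T * Re q \<le> norm T * (norm (\<phi> id_blinfun) * (norm x)\<^sup>2)"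
    by (intro mult_left_mono) (simp_all add: power2_eq_square mult_ac)
  then show "\<bar>Re (cinner x (blinfun_apply (\<phi> T) x))\<bar> \<le> norm T * (norm (\<phi> id_blinfun) * (norm x)\<^sup>2)"
    using \<open>\<bar>Re p\<bar> \<le> norm T * Re q\<close> by (simp add: p_def)
qed

lemma op_Re_plus_op_Im: "op_Re T + \<i> *\<^sub>C op_Im T = T"
proof -
  have "op_Re T + \<i> *\<^sub>C op_Im T = (1/2) *\<^sub>C (T + cadjoint T) + (1/2) *\<^sub>C (T - cadjoint T)"
    by (simp add: op_Re_def op_Im_def scaleC_scaleC)
  also have "\<dots> = (1/2) *\<^sub>C (T + T)"
    by (simp flip: scaleC_add_right)
  also have "\<dots> = T"
    by (simp add: scaleC_add_right flip: scaleC_add_left)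
  finally show ?thesis .
qed

lemma selfadjoint_parts:
  assumes "operator_system E" "T \<in> E"
  shows "op_Re T \<in> E" "op_Im T \<in> E" "cadjoint (op_Re T) = op_Re T" "cadjoint (op_Im T) = op_Im T"
    "norm (op_Re T) \<le> norm T" "norm (op_Im T) \<le> norm T" 
    "T = op_Re T + \<i> *\<^sub>C op_Im T"
proof -
  have E: "csubspace E"
    using assms(1) by (simp add: operator_system_def)
  have T: "T \<in> bounded_ops" "cadjoint T \<in> E" "cadjoint T \<in> bounded_ops"
    using assms by (auto simp: operator_system_def)
  show "op_Re T \<in> E" "op_Im T \<in> E"
    unfolding op_Re_def op_Im_def
    by (intro complex_vector.subspace_scale[OF E] complex_vector.subspace_add[OF E]
        complex_vector.subspace_diff[OF E] assms(2) T(2))+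
  show "cadjoint (op_Re T) = op_Re T"
    using T by (simp add: op_Re_def cadjoint_scaleC bounded_ops_add cadjoint_add cadjoint_cadjoint
        add.commute)
  have "cadjoint (op_Im T) = cnj (1 / (2 * \<i>)) *\<^sub>C cadjoint (T - cadjoint T)"
    unfolding op_Im_def by (rule cadjoint_scaleC[OF bounded_ops_diff[OF T(1,3)]])
  also have "\<dots> = (- (1 / (2 * \<i>))) *\<^sub>C (- (T - cadjoint T))"
    using T by (simp add: cadjoint_diff cadjoint_cadjoint del: minus_divide_left)
  also have "\<dots> = op_Im T"
    unfolding op_Im_def by (simp only: complex_vector.scale_minus_left
        complex_vector.scale_minus_right minus_minus)
  finally show "cadjoint (op_Im T) = op_Im T" .
  have "norm (T + cadjoint T) \<le> 2 * norm T" "norm (T - cadjoint T) \<le> 2 * norm T"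
    using norm_triangle_ineq[of T "cadjoint T"] norm_triangle_ineq4[of T "cadjoint T"]
    by (simp_all add: norm_cadjoint[OF T(1)])
  then show "norm (op_Re T) \<le> norm T" "norm (op_Im T) \<le> norm T"
    by (simp_all add: op_Re_def op_Im_def norm_scaleC norm_divide norm_mult)
  show "T = op_Re T + \<i> *\<^sub>C op_Im T"
    by (simp add: op_Re_plus_op_Im)
qed

lemma quadratic_form_eqI:
  assumes "S \<in> bounded_ops" "T \<in> bounded_ops"
    and "\<And>x. cinner x (blinfun_apply S x) = cinner x (blinfun_apply T x)"
  shows "S = T"
proof (rule blinfun_eqI, rule cinner_right_eqI)
  fix x y
  have "4 * cinner y (blinfun_apply S x) = 4 * cinner y (blinfun_apply T x)"
    unfolding sesquilinear_polarization[OF assms(1)] sesquilinear_polarization[OF assms(2)] assms(3) ..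
  then show "cinner y (blinfun_apply S x) = cinner y (blinfun_apply T x)"
    by simp
qed

text \<open>The quadratic forms of \<open>\<phi> (T\<^sup>*)\<close> and \<open>(\<phi> T)\<^sup>*\<close> agree, because \<open>\<phi>\<close> maps the self-adjoint parts
  of \<open>T\<close> to operators with real quadratic form.\<close>

lemma cp_maps_cadjoint:
  assumes "\<phi> \<in> cp_maps E" "operator_system E" "T \<in> E"
  shows "\<phi> (cadjoint T) = cadjoint (\<phi> T)"
proof -
  note parts = selfadjoint_parts[OF assms(2,3)]
  define A where "A = op_Re T"
  define C where "C = op_Im T"
  have E: "A \<in> E" "C \<in> E" "\<i> *\<^sub>C C \<in> E"
    using parts(1,2) assms(2)
    by (auto simp: A_def C_def operator_system_def complex_vector.subspace_scale)
  have T: "T = A + \<i> *\<^sub>C C"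
    unfolding A_def C_def by (rule parts(7))
  have bd: "A \<in> bounded_ops" "C \<in> bounded_ops"
    using E assms(2) by (auto simp: operator_system_def)
  have Tad: "cadjoint T = A - \<i> *\<^sub>C C"
    using bd parts(3,4)[folded A_def C_def]
    by (subst T) (simp add: cadjoint_add cadjoint_scaleC bounded_ops_scaleC)
  have ph: "\<phi> T = \<phi> A + \<i> *\<^sub>C \<phi> C" "\<phi> (cadjoint T) = \<phi> A - \<i> *\<^sub>C \<phi> C"
    using E unfolding Tad
    by (subst T, simp_all add: cp_maps_add[OF assms(1)] cp_maps_diff[OF assms(1,2)]
        cp_maps_scaleC[OF assms(1)])
  have bd': "\<phi> T \<in> bounded_ops" "\<phi> (cadjoint T) \<in> bounded_ops"
    using assms by (auto simp: operator_system_def intro: cp_maps_bounded_ops)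
  show ?thesis
  proof (rule quadratic_form_eqI)
    fix x
    have "Im (cinner x (blinfun_apply (\<phi> A) x)) = 0" "Im (cinner x (blinfun_apply (\<phi> C) x)) = 0"
      using cp_maps_selfadjoint_bound(1)[OF assms(1,2)] E parts(3,4) by (simp_all add: A_def C_def)
    then have "cinner x (blinfun_apply (\<phi> (cadjoint T)) x) = cnj (cinner x (blinfun_apply (\<phi> T) x))"
      unfolding ph
      by (simp add: complex_eq_iff blinfun.add_left blinfun.diff_left cinner_add_right
        cinner_diff_right scaleC_blinfun.rep_eq cinner_scaleC_right)
    also have "\<dots> = cinner x (blinfun_apply (cadjoint (\<phi> T)) x)"
      by (metis bd'(1) cinner_cadjoint cinner_commute)
    finally show "cinner x (blinfun_apply (\<phi> (cadjoint T)) x)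
      = cinner x (blinfun_apply (cadjoint (\<phi> T)) x)" .
  qed (use bd' cadjoint_bounded_ops in auto)
qed

lemma norm_scaleC_i [simp]: "norm (\<i> *\<^sub>C x) = norm (x :: 'a :: complex_normed_vector)"
  by (simp add: norm_scaleC)

text \<open>The quadratic form of \<open>\<phi> T\<close> is bounded by \<open>2 \<parallel>\<phi> I\<parallel> \<parallel>T\<parallel>\<close>, a summand \<open>\<parallel>\<phi> I\<parallel> \<parallel>T\<parallel>\<close> for each of the two
  self-adjoint parts of \<open>T\<close>; polarization doubles the constant. The bound serves to
  exchange \<open>\<phi>\<close> with norm convergent series.\<close>

lemma cp_maps_norm_le:
  assumes "\<phi> \<in> cp_maps E" "operator_system E" "T \<in> E"
  shows "norm (\<phi> T) \<le> 4 * norm (\<phi> id_blinfun) * norm T"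
proof -
  note parts = selfadjoint_parts[OF assms(2,3)]
  define K where "K = norm (\<phi> id_blinfun) * norm T"
  have K: "K \<ge> 0" by (simp add: K_def)
  have bd: "\<phi> T \<in> bounded_ops"
    by (rule cp_maps_bounded_ops[OF assms(1,3)])
  have part: "cmod (cinner x (blinfun_apply (\<phi> A) x)) \<le> K * (norm x)\<^sup>2"
    if "A \<in> E" "cadjoint A = A" "norm A \<le> norm T" for A x
  proof -
    have "cmod (cinner x (blinfun_apply (\<phi> A) x)) = \<bar>Re (cinner x (blinfun_apply (\<phi> A) x))\<bar>"
      using cp_maps_selfadjoint_bound(1)[OF assms(1,2) that(1,2)]
      by (simp add: cmod_eq_Re)
    also have "\<dots> \<le> norm A * (norm (\<phi> id_blinfun) * (norm x)\<^sup>2)"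
      by (rule cp_maps_selfadjoint_bound(2)[OF assms(1,2) that(1,2)])
    also have "\<dots> \<le> norm T * (norm (\<phi> id_blinfun) * (norm x)\<^sup>2)"
      by (intro mult_right_mono that) auto
    finally show ?thesis
      by (simp add: K_def mult_ac)
  qed
  have quad: "cmod (cinner x (blinfun_apply (\<phi> T) x)) \<le> 2 * K * (norm x)\<^sup>2" for x
  proof -
    have "\<phi> T = \<phi> (op_Re T + \<i> *\<^sub>C op_Im T)"
      using parts(7) by simp
    also have "\<dots> = \<phi> (op_Re T) + \<i> *\<^sub>C \<phi> (op_Im T)"
      using parts(1,2) assms(2)
      by (simp add: cp_maps_add[OF assms(1)] cp_maps_scaleC[OF assms(1)] operator_system_def
          complex_vector.subspace_scale)
    finally have "cinner x (blinfun_apply (\<phi> T) x) = cinner x (blinfun_apply (\<phi> (op_Re T)) x)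
        + \<i> * cinner x (blinfun_apply (\<phi> (op_Im T)) x)"
      by (simp add: blinfun.add_left cinner_add_right scaleC_blinfun.rep_eq cinner_scaleC_right)
    also have "cmod \<dots> \<le> cmod (cinner x (blinfun_apply (\<phi> (op_Re T)) x))
        + cmod (cinner x (blinfun_apply (\<phi> (op_Im T)) x))"
      by (rule order_trans[OF norm_triangle_ineq]) (simp add: norm_mult)
    also have "\<dots> \<le> K * (norm x)\<^sup>2 + K * (norm x)\<^sup>2"
      by (intro add_mono part parts)
    finally show ?thesis by simp
  qed
  have unit: "cmod (cinner x (blinfun_apply (\<phi> T) y)) \<le> 4 * K" if "norm x = 1" "norm y = 1" for x y
  proof -
    have par: "(norm (x + v))\<^sup>2 + (norm (x - v))\<^sup>2 = 4" if "norm v = 1" for v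
      using \<open>norm x = 1\<close> that
      by (simp add: power2_norm_eq_inner inner_add_left inner_add_right inner_diff_left
          inner_diff_right norm_eq_1 inner_commute)
    have tri: "cmod (p - q - \<i> * r + \<i> * s) \<le> cmod p + cmod q + cmod r + cmod s" for p q r s
      using norm_triangle_ineq[of "p - q - \<i> * r" "\<i> * s"] norm_triangle_ineq4[of "p - q" "\<i> * r"]
        norm_triangle_ineq4[of p q] by (simp add: norm_mult)
    have "cmod (4 * cinner x (blinfun_apply (\<phi> T) y))
      \<le> 2 * K * (norm (x + y))\<^sup>2 + 2 * K * (norm (x - y))\<^sup>2 +
        2 * K * (norm (x + \<i> *\<^sub>C y))\<^sup>2 + 2 * K * (norm (x - \<i> *\<^sub>C y))\<^sup>2"
      unfolding sesquilinear_polarization[OF bd]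
      by (rule order_trans[OF tri]) (intro add_mono quad)
    also have "\<dots> = 2 * K * ((norm (x + y))\<^sup>2 + (norm (x - y))\<^sup>2) +
        2 * K * ((norm (x + \<i> *\<^sub>C y))\<^sup>2 + (norm (x - \<i> *\<^sub>C y))\<^sup>2)"
      by (simp add: algebra_simps)
    also have "\<dots> = 16 * K"
      using par[of y] par[of "\<i> *\<^sub>C y"] that by simp
    finally show ?thesis
      by (simp add: norm_mult)
  qed
  have "norm (blinfun_apply (\<phi> T) v) \<le> 4 * K * norm v" for v
  proof (cases "blinfun_apply (\<phi> T) v = 0")
    case False
    then have v: "v \<noteq> 0" by (auto simp: blinfun.zero_right)
    define w where "w = blinfun_apply (\<phi> T) v"
    have w: "w \<noteq> 0" using False by (simp add: w_def)
    have "cinner (complex_of_real (1 / norm w) *\<^sub>C w)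
        (blinfun_apply (\<phi> T) (complex_of_real (1 / norm v) *\<^sub>C v))
      = complex_of_real (1 / norm w) * (complex_of_real (1 / norm v) * complex_of_real ((norm w)\<^sup>2))"
      by (simp add: bounded_opsD[OF bd] w_def[symmetric] cinner_scaleC_left cinner_scaleC_right
          cinner_self)
    also have "\<dots> = complex_of_real (norm w / norm v)"
      using w by (simp add: power2_eq_square)
    finally have "cmod (complex_of_real (norm w / norm v)) \<le> 4 * K"
      using unit[of "complex_of_real (1 / norm w) *\<^sub>C w" "complex_of_real (1 / norm v) *\<^sub>C v"] v w
      by (simp add: norm_scaleC norm_divide)
    then show ?thesis
      using v by (simp add: w_def norm_divide field_simps)
  qed (simp add: K)
  then show ?thesis
    using norm_blinfun_bound[of "4 * K" "\<phi> T"] K by (simp add: K_def mult_ac)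
qed

lemma cp_maps_tendsto:
  assumes "\<phi> \<in> cp_maps E" "operator_system E" "(f \<longlongrightarrow> T) F" "\<And>i. f i \<in> E" "T \<in> E"
  shows "((\<lambda>i. \<phi> (f i)) \<longlongrightarrow> \<phi> T) F"
proof (rule Lim_null[THEN iffD2], rule Lim_null_comparison)
  have "norm (\<phi> (f i) - \<phi> T) \<le> 4 * norm (\<phi> id_blinfun) * norm (f i - T)" for i
    using cp_maps_norm_le[OF assms(1,2), of "f i - T"] assms(2,4,5)
    by (simp add: cp_maps_diff[OF assms(1,2)] operator_system_def complex_vector.subspace_diff)
  then show "\<forall>\<^sub>F i in F. norm (\<phi> (f i) - \<phi> T) \<le> 4 * norm (\<phi> id_blinfun) * norm (f i - T)"
    by simp
  show "((\<lambda>i. 4 * norm (\<phi> id_blinfun) * norm (f i - T)) \<longlongrightarrow> 0) F"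
    by (intro tendsto_mult_right_zero tendsto_norm_zero Lim_null[THEN iffD1] assms(3))
qed

lemma cp_maps_sums:
  assumes "\<phi> \<in> cp_maps E" "operator_system E" "f sums T" "\<And>i. f i \<in> E"
  shows "T \<in> E" "(\<lambda>i. \<phi> (f i)) sums \<phi> T"
proof -
  have part: "(\<Sum>i<n. f i) \<in> E" for n
    using assms(2,4) by (simp add: operator_system_def complex_vector.subspace_sum)
  moreover have "closed E"
    using assms(2) by (simp add: operator_system_def)
  ultimately show T: "T \<in> E"
    using assms(3)[unfolded sums_def] closed_sequentially[of E "\<lambda>n. \<Sum>i<n. f i" T] by simp
  show "(\<lambda>i. \<phi> (f i)) sums \<phi> T"
    using cp_maps_tendsto[OF assms(1,2) _ part T, where F = sequentially] assms(3,4)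
    by (simp add: sums_def cp_maps_sum[OF assms(1,2)])
qed

text \<open>The operators on which two completely positive maps agree form a norm closed self-adjoint
  subspace.\<close>

lemma cp_maps_eq_on_op_system:
  assumes "\<phi> \<in> cp_maps E" "\<psi> \<in> cp_maps E" "operator_system E" "G \<subseteq> E"
    and eq: "\<And>T. T \<in> G \<Longrightarrow> \<phi> T = \<psi> T" and "T \<in> op_system (closure (cspan G))"
  shows "\<phi> T = \<psi> T"
proof -
  define A where "A = {T \<in> E. \<phi> T = \<psi> T}"
  have E: "csubspace E" "closed E" "\<And>T. T \<in> E \<Longrightarrow> cadjoint T \<in> E"
    using assms(3) by (auto simp: operator_system_def)
  have "\<phi> 0 = \<psi> 0"
    using cp_maps_sum[OF assms(1,3), of "{}"] cp_maps_sum[OF assms(2,3), of "{}"] by simp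
  then have sub: "csubspace A"
    by (intro complex_vector.subspaceI)
      (auto simp: A_def complex_vector.subspace_0[OF E(1)] complex_vector.subspace_add[OF E(1)]
        complex_vector.subspace_scale[OF E(1)] cp_maps_add[OF assms(1)]
        cp_maps_add[OF assms(2)] cp_maps_scaleC[OF assms(1)] cp_maps_scaleC[OF assms(2)])
  have closed: "closed A"
    unfolding closed_sequential_limits
  proof safe
    fix f T assume f: "\<forall>n. f n \<in> A" "f \<longlonglongrightarrow> T"
    then have fE: "f n \<in> E" for n by (simp add: A_def)
    then have T: "T \<in> E"
      using E(2) f(2) closed_sequentially by blast
    have "(\<lambda>n. \<phi> (f n)) \<longlonglongrightarrow> \<phi> T"
      by (rule cp_maps_tendsto[OF assms(1,3) f(2) fE T])
    moreover have "(\<lambda>n. \<phi> (f n)) \<longlonglongrightarrow> \<psi> T"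
      using cp_maps_tendsto[OF assms(2,3) f(2) fE T] f(1) by (simp add: A_def)
    ultimately show "T \<in> A"
      using T LIMSEQ_unique by (auto simp: A_def)
  qed
  have adj: "cadjoint T \<in> A" if "T \<in> A" for T
    using that E(3) cp_maps_cadjoint[OF assms(1,3)] cp_maps_cadjoint[OF assms(2,3)]
    by (simp add: A_def)
  have "G \<subseteq> A"
    using assms(4) eq by (auto simp: A_def)
  then have "closure (cspan G) \<subseteq> A"
    by (intro closure_minimal closed complex_vector.span_minimal sub)
  then have "op_system (closure (cspan G)) \<subseteq> A"
    unfolding op_system_def
    by (intro closure_minimal closed) (auto intro!: complex_vector.subspace_add[OF sub] adj)
  then show ?thesis
    using assms(6) by (auto simp: A_def)
qed


section \<open>Powers and Neumann series\<close>

fun op_power :: "('k::chilbert_space \<Rightarrow>\<^sub>L 'k) \<Rightarrow> nat \<Rightarrow> ('k \<Rightarrow>\<^sub>L 'k)" where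
  "op_power T 0 = id_blinfun"
| "op_power T (Suc k) = T o\<^sub>L op_power T k"

lemma blinfun_compose_id [simp]: "id_blinfun o\<^sub>L T = T" "T o\<^sub>L id_blinfun = T"
  by (auto intro: blinfun_eqI)

lemma blinfun_compose_assoc: "(R o\<^sub>L S) o\<^sub>L T = R o\<^sub>L (S o\<^sub>L T)"
  by (auto intro: blinfun_eqI)

lemmas compose_add_right = bounded_bilinear.add_right[OF bounded_bilinear_blinfun_compose]
lemmas compose_diff_left = bounded_bilinear.diff_left[OF bounded_bilinear_blinfun_compose]
lemmas compose_diff_right = bounded_bilinear.diff_right[OF bounded_bilinear_blinfun_compose]
lemmas compose_sum_left = bounded_bilinear.sum_left[OF bounded_bilinear_blinfun_compose]
lemmas compose_sum_right = bounded_bilinear.sum_right[OF bounded_bilinear_blinfun_compose]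

lemma compose_scaleC_left: "(c *\<^sub>C S) o\<^sub>L T = c *\<^sub>C (S o\<^sub>L T)"
  by (rule blinfun_eqI) (simp add: scaleC_blinfun.rep_eq)

lemma compose_scaleC_right: "S \<in> bounded_ops \<Longrightarrow> S o\<^sub>L (c *\<^sub>C T) = c *\<^sub>C (S o\<^sub>L T)"
  by (rule blinfun_eqI) (simp add: scaleC_blinfun.rep_eq bounded_opsD)

lemma op_power_commute: "op_power T k o\<^sub>L T = T o\<^sub>L op_power T k"
  by (induction k) (simp_all add: blinfun_compose_assoc)

lemma norm_op_power_le: "norm (op_power T k) \<le> norm T ^ k"
proof (induction k)
  case 0
  show ?case by (simp add: norm_blinfun_id_le)
next
  case (Suc k)
  have "norm (T o\<^sub>L op_power T k) \<le> norm T * norm (op_power T k)"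
    by (rule norm_blinfun_compose)
  also have "\<dots> \<le> norm T * norm T ^ k"
    by (intro mult_left_mono Suc.IH) simp
  finally show ?case by simp
qed

lemma op_inverse_eqI:
  assumes "S o\<^sub>L T = id_blinfun" "T o\<^sub>L S = id_blinfun"
  shows "op_inverse T = S"
  unfolding op_inverse_def
proof (rule the_equality)
  fix R assume R: "R o\<^sub>L T = id_blinfun \<and> T o\<^sub>L R = id_blinfun"
  have "R = R o\<^sub>L (T o\<^sub>L S)" by (simp add: assms)
  also have "\<dots> = S" using R by (simp flip: blinfun_compose_assoc)
  finally show "R = S" .
qed (simp add: assms)

text \<open>The Taylor coefficients of \<open>(1 + t) / (1 - t)\<close>.\<close>

definition herglotz_coeff :: "nat \<Rightarrow> complex" where
  "herglotz_coeff k = (if k = 0 then 1 else 2)"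

text \<open>By the Neumann series \<open>S\<close> of \<open>(1 - T)\<^sup>-\<^sup>1\<close>: the operator in question is \<open>S + (S - 1)\<close>.\<close>

lemma herglotz_kernel_sums:
  fixes T :: "'k::chilbert_space \<Rightarrow>\<^sub>L 'k"
  assumes "norm T < 1"
  shows "(\<lambda>k. herglotz_coeff k *\<^sub>C op_power T k) sums
    (op_inverse (id_blinfun - T) o\<^sub>L (id_blinfun + T))"
proof -
  have "summable (\<lambda>k. norm (op_power T k))"
    using assms
    by (intro summable_comparison_test'[OF summable_geometric[of "norm T"], of 0])
      (auto simp: norm_op_power_le)
  then have "summable (op_power T)"
    by (rule summable_norm_cancel)
  then obtain S where S: "op_power T sums S"
    by (auto simp: summable_def)
  have Suc: "(\<lambda>k. op_power T (Suc k)) sums (S - id_blinfun)"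
    using S by (subst sums_Suc_iff) simp
  moreover have "(\<lambda>k. op_power T (Suc k)) sums (T o\<^sub>L S)"
    using bounded_linear.sums[OF bounded_bilinear.bounded_linear_right[OF bounded_bilinear_blinfun_compose] S, of T]
    by simp
  moreover have "(\<lambda>k. op_power T (Suc k)) sums (S o\<^sub>L T)"
    using bounded_linear.sums[OF bounded_bilinear.bounded_linear_left[OF bounded_bilinear_blinfun_compose] S, of T]
    by (simp add: op_power_commute)
  ultimately have TS: "T o\<^sub>L S = S - id_blinfun" and ST: "S o\<^sub>L T = S - id_blinfun"
    using sums_unique2 by blast+
  have "op_inverse (id_blinfun - T) = S"
    by (rule op_inverse_eqI) (simp_all add: compose_diff_left compose_diff_right TS ST)
  then have val: "op_inverse (id_blinfun - T) o\<^sub>L (id_blinfun + T) = S + (S - id_blinfun)"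
    by (simp add: compose_add_right ST)
  have "(\<lambda>k. if k = 0 then 0 else op_power T k) sums (S - id_blinfun)"
  proof -
    have "(\<lambda>k. (if Suc k = 0 then 0 else op_power T (Suc k))) sums (S - id_blinfun - 0)"
      using Suc by simp
    then show ?thesis
      by (subst (asm) sums_Suc_iff) simp
  qed
  from sums_add[OF S this] show ?thesis
    unfolding val
    by (rule sums_cong[THEN iffD1, rotated])
      (auto simp: herglotz_coeff_def scaleC_add_left[of 1 1, simplified])
qed


section \<open>Words\<close>

definition words :: "nat \<Rightarrow> 'd list set" where
  "words k = {\<alpha>. length \<alpha> = k}"

definition monomial :: "complex ^ 'd::finite \<Rightarrow> 'd list \<Rightarrow> complex" where
  "monomial z \<alpha> = (\<Prod>k\<leftarrow>\<alpha>. z $ k)"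

lemma finite_words [simp]: "finite (words k :: 'd::finite list set)"
  using finite_lists_length_eq[of "UNIV :: 'd set" k] by (simp add: words_def)

lemma words_0 [simp]: "words 0 = {[]}"
  by (auto simp: words_def)

lemma words_disjoint: "i \<noteq> k \<Longrightarrow> words i \<inter> words k = {}"
  by (auto simp: words_def)

lemma sum_words_Suc:
  fixes f :: "'d::finite list \<Rightarrow> 'a::comm_monoid_add"
  shows "(\<Sum>\<alpha>\<in>words (Suc k). f \<alpha>) = (\<Sum>j\<in>UNIV. \<Sum>\<alpha>\<in>words k. f (j # \<alpha>))"
proof -
  have "(\<Sum>j\<in>UNIV. \<Sum>\<alpha>\<in>words k. f (j # \<alpha>)) = (\<Sum>(j, \<alpha>)\<in>UNIV \<times> words k. f (j # \<alpha>))"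
    by (rule sum.cartesian_product)
  also have "\<dots> = (\<Sum>\<alpha>\<in>words (Suc k). f \<alpha>)"
    by (rule sum.reindex_bij_witness[of _ "\<lambda>\<alpha>. (hd \<alpha>, tl \<alpha>)" "\<lambda>(j, \<alpha>). j # \<alpha>"])
      (auto simp: words_def length_Suc_conv)
  finally show ?thesis by simp
qed

lemma monomial_simps [simp]:
  "monomial z [] = 1" "monomial z (k # \<alpha>) = z $ k * monomial z \<alpha>"
  by (simp_all add: monomial_def)

lemma monomial_append: "monomial z (\<alpha> @ \<beta>) = monomial z \<alpha> * monomial z \<beta>"
  by (simp add: monomial_def)

lemma monomial_rev: "monomial z (rev \<alpha>) = monomial z \<alpha>"
  by (induction \<alpha>) (simp_all add: monomial_append)

lemma monomial_count_list: "monomial z \<alpha> = (\<Prod>j\<in>UNIV. z $ j ^ count_list \<alpha> j)"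
proof (induction \<alpha>)
  case (Cons k \<alpha>)
  have "(\<Prod>j\<in>UNIV. z $ j ^ count_list (k # \<alpha>) j)
      = (\<Prod>j\<in>UNIV. (if j = k then z $ k else 1) * z $ j ^ count_list \<alpha> j)"
    by (rule prod.cong) auto
  also have "\<dots> = z $ k * (\<Prod>j\<in>UNIV. z $ j ^ count_list \<alpha> j)"
    by (simp add: prod.distrib)
  finally show ?case
    by (simp add: Cons.IH)
qed simp

lemma sum_cmod_monomial: "(\<Sum>\<alpha>\<in>words k. (cmod (monomial z \<alpha>))\<^sup>2) = (norm z ^ k)\<^sup>2"
proof (induction k)
  case (Suc k)
  have "(\<Sum>\<alpha>\<in>words (Suc k). (cmod (monomial z \<alpha>))\<^sup>2)
      = (\<Sum>j\<in>UNIV. (cmod (z $ j))\<^sup>2) * (\<Sum>\<alpha>\<in>words k. (cmod (monomial z \<alpha>))\<^sup>2)"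
    by (simp add: sum_words_Suc norm_mult power_mult_distrib sum_product)
  also have "(\<Sum>j\<in>UNIV. (cmod (z $ j))\<^sup>2) = (norm z)\<^sup>2"
    by (simp add: norm_vec_def L2_set_def sum_nonneg)
  finally show ?case
    by (simp add: Suc.IH power_mult_distrib)
qed simp

lemma length_eq_sum_count_list: "length \<alpha> = (\<Sum>k\<in>UNIV. count_list \<alpha> (k :: 'd::finite))"
  using sum_count_set[of \<alpha> UNIV] by simp


section \<open>The free disk system\<close>

lemma creation_word_append: "creation_word (\<alpha> @ \<beta>) = creation_word \<alpha> o\<^sub>L creation_word \<beta>"
  by (induction \<alpha>) (simp_all add: blinfun_compose_assoc)

lemma free_disk_algebra_closed:
  defines "P \<equiv> (\<lambda>X. csubspace X \<and> closed X \<and> id_blinfun \<in> X \<and>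
      (\<forall>S\<in>X. \<forall>T\<in>X. (S :: 'd::finite fock_op) o\<^sub>L T \<in> X))"
  shows "P free_disk_algebra"
  unfolding free_disk_algebra_def P_def[symmetric]
  by (rule hull_in) (auto simp: P_def intro!: complex_vector.subspace_Inter closed_Inter)

lemma csubspace_free_disk_algebra: "csubspace free_disk_algebra"
  and closed_free_disk_algebra: "closed free_disk_algebra"
  and id_in_free_disk_algebra: "id_blinfun \<in> free_disk_algebra"
  and compose_in_free_disk_algebra:
    "S \<in> free_disk_algebra \<Longrightarrow> T \<in> free_disk_algebra \<Longrightarrow> S o\<^sub>L T \<in> free_disk_algebra"
  using free_disk_algebra_closed by auto

lemma free_disk_algebra_bounded_ops: "free_disk_algebra \<subseteq> bounded_ops"
  unfolding free_disk_algebra_def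
  by (rule hull_minimal)
    (auto simp: creation_in_bounded_ops csubspace_bounded_ops closed_bounded_ops bounded_ops_id
      bounded_ops_compose)

lemma creation_in_free_disk_algebra: "creation k \<in> free_disk_algebra"
  unfolding free_disk_algebra_def by (rule subsetD[OF hull_subset]) simp

lemma creation_word_in_free_disk_algebra: "creation_word \<alpha> \<in> free_disk_algebra"
  by (induction \<alpha>)
    (simp_all add: id_in_free_disk_algebra creation_in_free_disk_algebra compose_in_free_disk_algebra)

lemma creation_word_bounded_ops: "creation_word (\<alpha> :: 'd::finite list) \<in> bounded_ops"
  using creation_word_in_free_disk_algebra free_disk_algebra_bounded_ops by blast

lemma sym_disk_space_subset: "sym_disk_space \<subseteq> free_disk_algebra"
  unfolding sym_disk_space_def creation_sym_def
  by (intro closure_minimal closed_free_disk_algebra complex_vector.span_minimal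
      csubspace_free_disk_algebra)
    (auto intro!: complex_vector.subspace_sum[OF csubspace_free_disk_algebra]
      creation_word_in_free_disk_algebra)

lemma csubspace_sym_disk_space: "csubspace sym_disk_space"
  unfolding sym_disk_space_def by (rule csubspace_closure) (rule complex_vector.subspace_span)

lemma creation_sym_in_sym_disk_space: "creation_sym n \<in> sym_disk_space"
  unfolding sym_disk_space_def
  using closure_subset complex_vector.span_base[of "creation_sym n" "range creation_sym"] by blast

lemma creation_sym_bounded_ops: "creation_sym n \<in> bounded_ops"
  using creation_sym_in_sym_disk_space sym_disk_space_subset free_disk_algebra_bounded_ops by blast

lemma creation_sym_0: "creation_sym (\<lambda>_ :: 'd::finite. 0) = id_blinfun"
proof -
  have "{\<alpha> :: 'd list. count_list \<alpha> = (\<lambda>_. 0)} = {[]}"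
  proof safe
    fix \<alpha> :: "'d list" assume "count_list \<alpha> = (\<lambda>_. 0)"
    then have "length \<alpha> = 0"
      by (subst length_eq_sum_count_list) simp
    then show "\<alpha> = []" by simp
  qed auto
  then show ?thesis
    by (simp add: creation_sym_def)
qed

lemma operator_system_free: "operator_system (op_system free_disk_algebra)"
  by (rule operator_system_op_system[OF csubspace_free_disk_algebra free_disk_algebra_bounded_ops
        id_in_free_disk_algebra])

lemma operator_system_sym: "operator_system (op_system (sym_disk_space :: 'd::finite fock_op set))"
proof (rule operator_system_op_system[OF csubspace_sym_disk_space])
  show "sym_disk_space \<subseteq> (bounded_ops :: 'd fock_op set)"
    using sym_disk_space_subset free_disk_algebra_bounded_ops by blast
  show "id_blinfun \<in> (sym_disk_space :: 'd fock_op set)"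
    using creation_sym_in_sym_disk_space by (simp flip: creation_sym_0)
qed

lemma csubspace_op_system_free: "csubspace (op_system free_disk_algebra)"
  and csubspace_op_system_sym: "csubspace (op_system sym_disk_space)"
  using operator_system_free operator_system_sym by (auto simp: operator_system_def)

lemma op_system_sym_subset: "op_system sym_disk_space \<subseteq> op_system free_disk_algebra"
  by (rule op_system_mono[OF sym_disk_space_subset])


section \<open>The operators \<open>zL\<^sup>*\<close>\<close>

lemma creation_orthogonal:
  assumes "i \<noteq> j"
  shows "orthogonal (blinfun_apply (creation i) F) (blinfun_apply (creation j) G)"
proof -
  have "ell2_nth (blinfun_apply (creation i) F) \<gamma> \<bullet> ell2_nth (blinfun_apply (creation j) G) \<gamma> = 0" for \<gamma>
    using assms
    by (simp add: creation.rep_eq left_shift.rep_eq shift_family_def split: list.splits)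
  then show ?thesis
    by (simp add: orthogonal_def inner_ell2_def)
qed

lemma orthogonal_scaleC:
  assumes "\<And>c. orthogonal x (c *\<^sub>C y)"
  shows "orthogonal (a *\<^sub>C x) (c *\<^sub>C (y :: 'a :: chilbert_space))"
proof -
  have "orthogonal x ((cnj a * c) *\<^sub>C y)" by (rule assms)
  then show ?thesis
    by (simp add: orthogonal_def inner_eq_Re_cinner cinner_scaleC_left cinner_scaleC_right algebra_simps)
qed

text \<open>The \<open>L\<^sub>j\<close> are isometries with orthogonal ranges.\<close>

lemma norm_creation_combination_le:
  fixes c :: "'d::finite \<Rightarrow> complex"
  shows "norm (\<Sum>j\<in>UNIV. c j *\<^sub>C creation j) \<le> sqrt (\<Sum>j\<in>UNIV. (cmod (c j))\<^sup>2)"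
proof (rule norm_blinfun_bound)
  fix F :: "('d, complex) fock"
  have orth: "orthogonal (c i *\<^sub>C blinfun_apply (creation i) F) (c j *\<^sub>C blinfun_apply (creation j) F)"
    if "i \<noteq> j" for i j
  proof (rule orthogonal_scaleC)
    fix a
    show "orthogonal (blinfun_apply (creation i) F) (a *\<^sub>C blinfun_apply (creation j) F)"
      using creation_orthogonal[OF that, of F "a *\<^sub>C F"]
      by (simp add: bounded_opsD[OF creation_in_bounded_ops])
  qed
  have "(norm (blinfun_apply (\<Sum>j\<in>UNIV. c j *\<^sub>C creation j) F))\<^sup>2
      = (norm (\<Sum>j\<in>UNIV. c j *\<^sub>C blinfun_apply (creation j) F))\<^sup>2"
    by (simp add: blinfun.sum_left scaleC_blinfun.rep_eq)
  also have "\<dots> = (\<Sum>j\<in>UNIV. (norm (c j *\<^sub>C blinfun_apply (creation j) F))\<^sup>2)"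
    by (rule norm_sum_Pythagorean) (auto simp: pairwise_def orth)
  also have "\<dots> = (\<Sum>j\<in>UNIV. (cmod (c j))\<^sup>2) * (norm F)\<^sup>2"
    by (simp add: norm_scaleC power_mult_distrib creation.rep_eq norm_left_shift sum_distrib_right)
  also have "\<dots> = (sqrt (\<Sum>j\<in>UNIV. (cmod (c j))\<^sup>2) * norm F)\<^sup>2"
    by (simp add: power_mult_distrib sum_nonneg)
  finally have "norm (blinfun_apply (\<Sum>j\<in>UNIV. c j *\<^sub>C creation j) F)
      = sqrt (\<Sum>j\<in>UNIV. (cmod (c j))\<^sup>2) * norm F"
    by (rule power2_eq_imp_eq) (auto intro!: mult_nonneg_nonneg sum_nonneg)
  then show "norm (blinfun_apply (\<Sum>j\<in>UNIV. c j *\<^sub>C creation j) F)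
      \<le> sqrt (\<Sum>j\<in>UNIV. (cmod (c j))\<^sup>2) * norm F"
    by simp
qed (auto intro: sum_nonneg)

lemma zL_star_eq_cadjoint: "zL_star z = cadjoint (\<Sum>j\<in>UNIV. cnj (z $ j) *\<^sub>C creation j)"
  by (simp add: zL_star_def cadjoint_sum cadjoint_scaleC bounded_ops_scaleC creation_in_bounded_ops)

lemma creation_combination_bounded_ops: "(\<Sum>j\<in>UNIV. c j *\<^sub>C creation j) \<in> bounded_ops"
  by (intro complex_vector.subspace_sum[OF csubspace_bounded_ops] bounded_ops_scaleC
      creation_in_bounded_ops)

lemma zL_star_bounded_ops: "zL_star z \<in> bounded_ops"
  unfolding zL_star_eq_cadjoint by (rule cadjoint_bounded_ops[OF creation_combination_bounded_ops])

lemma norm_zL_star_le: "norm (zL_star z) \<le> norm z"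
proof -
  have "norm (zL_star z) = norm (\<Sum>j\<in>UNIV. cnj (z $ j) *\<^sub>C creation j)"
    unfolding zL_star_eq_cadjoint by (rule norm_cadjoint[OF creation_combination_bounded_ops])
  also have "\<dots> \<le> sqrt (\<Sum>j\<in>UNIV. (cmod (cnj (z $ j)))\<^sup>2)"
    by (rule norm_creation_combination_le)
  also have "\<dots> = norm z"
    by (simp add: norm_vec_def L2_set_def)
  finally show ?thesis .
qed

text \<open>Taking adjoints reverses the order of the factors.\<close>

lemma zL_star_power:
  "op_power (zL_star z) k = (\<Sum>\<alpha>\<in>words k. monomial z \<alpha> *\<^sub>C cadjoint (creation_word (rev \<alpha>)))"
proof (induction k)
  case 0
  show ?case
    by (simp add: cadjoint_id complex_vector.scale_one)
next
  case (Suc k)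
  have step: "cadjoint (creation j) o\<^sub>L cadjoint (creation_word (rev \<alpha>)) = cadjoint (creation_word (rev (j # \<alpha>)))"
    for j and \<alpha> :: "'a list"
    by (simp add: creation_word_append cadjoint_compose creation_word_bounded_ops creation_in_bounded_ops)
  show ?case
    unfolding op_power.simps Suc.IH unfolding zL_star_def sum_words_Suc
    by (simp add: compose_sum_left compose_sum_right compose_scaleC_left compose_scaleC_right
        cadjoint_bounded_ops creation_in_bounded_ops step scaleC_scaleC
        complex_vector.scale_sum_right del: rev.simps) (rule sum.swap)
qed

text \<open>Collecting the words with the same letter count turns the coefficients into the \<open>(L\<^sup>n)\<^sup>*\<close>.\<close>

lemma zL_star_power_sym:
  fixes z :: "complex ^ 'd::finite"
  shows "op_power (zL_star z) k = (\<Sum>n\<in>count_list ` words k.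
    (\<Prod>j\<in>UNIV. z $ j ^ n j) *\<^sub>C cadjoint (creation_sym n))"
proof -
  have "op_power (zL_star z) k = (\<Sum>n\<in>count_list ` words k. \<Sum>\<alpha> | \<alpha> \<in> words k \<and> count_list \<alpha> = n.
      monomial z \<alpha> *\<^sub>C cadjoint (creation_word (rev \<alpha>)))"
    unfolding zL_star_power by (rule sum.image_gen) simp
  also have "\<dots> = (\<Sum>n\<in>count_list ` words k. (\<Prod>j\<in>UNIV. z $ j ^ n j) *\<^sub>C cadjoint (creation_sym n))"
  proof (rule sum.cong[OF refl])
    fix n :: "'d \<Rightarrow> nat" assume "n \<in> count_list ` words k"
    then have eq: "{\<alpha>. \<alpha> \<in> words k \<and> count_list \<alpha> = n} = {\<alpha>. count_list \<alpha> = n}"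
      by (auto simp: words_def length_eq_sum_count_list)
    have "(\<Sum>\<alpha> | count_list \<alpha> = n. creation_word (rev \<alpha>)) = creation_sym n"
      unfolding creation_sym_def by (rule sum.reindex_bij_witness[of _ rev rev]) auto
    then have "cadjoint (creation_sym n) = (\<Sum>\<alpha> | count_list \<alpha> = n. cadjoint (creation_word (rev \<alpha>)))"
      by (simp add: cadjoint_sum creation_word_bounded_ops flip: \<open>_ = creation_sym n\<close>)
    then show "(\<Sum>\<alpha> | \<alpha> \<in> words k \<and> count_list \<alpha> = n. monomial z \<alpha> *\<^sub>C cadjoint (creation_word (rev \<alpha>)))
      = (\<Prod>j\<in>UNIV. z $ j ^ n j) *\<^sub>C cadjoint (creation_sym n)"
      unfolding eq by (simp add: monomial_count_list complex_vector.scale_sum_right)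
  qed
  finally show ?thesis .
qed

lemma cadjoint_creation_sym_in: "cadjoint (creation_sym n) \<in> op_system sym_disk_space"
  using operator_system_sym subset_op_system[OF csubspace_sym_disk_space]
    creation_sym_in_sym_disk_space by (auto simp: operator_system_def)

lemma zL_star_power_in: "op_power (zL_star z) k \<in> op_system sym_disk_space"
  unfolding zL_star_power_sym using operator_system_sym
  by (auto simp: operator_system_def intro!: complex_vector.subspace_sum complex_vector.subspace_scale
      cadjoint_creation_sym_in)


section \<open>Coefficients of vanishing power series\<close>

text \<open>By induction on the degree: once the lower coefficients vanish, the next one is the limit at \<open>0\<close>
  of the quotient of the series by the corresponding power of \<open>t\<close>.\<close>

lemma powser_zero_imp_coeff_zero:
  fixes a :: "nat \<Rightarrow> complex"
  assumes "\<And>t. cmod t < 1 \<Longrightarrow> (\<lambda>k. a k * t ^ k) sums 0"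
  shows "a k = 0"
proof (induction k rule: less_induct)
  case (less m)
  have "(\<lambda>k. a (k + m) * t ^ k) sums 0" if "t \<noteq> 0" "norm t < 1" for t
  proof -
    have "(\<lambda>k. a (k + m) * t ^ (k + m)) sums 0"
      using sums_split_initial_segment[OF assms[OF that(2)], of m] less.IH by simp
    then have "(\<lambda>k. a (k + m) * t ^ (k + m) * inverse (t ^ m)) sums (0 * inverse (t ^ m))"
      by (rule sums_mult2)
    then show ?thesis
      using that(1) by (simp add: power_add field_simps)
  qed
  then have "((\<lambda>_ :: complex. 0) \<longlongrightarrow> a (0 + m)) (at 0)"
    by - (rule powser_limit_0_strong[of 1 "\<lambda>k. a (k + m)" "\<lambda>_. 0"], auto)
  then have "0 = a (0 + m)"
    by (rule LIM_const_eq)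
  then show ?case by simp
qed

text \<open>Digits: with the weights \<open>1, k + 1, (k + 1)\<^sup>2, \<dots>\<close> the weighted sum of the exponents determines
  the exponents, as long as they are at most \<open>k\<close>. The weights are built one variable at a time.\<close>

lemma separating_weights:
  assumes "finite S"
  shows "\<exists>w :: 'd \<Rightarrow> nat. (\<forall>j. 1 \<le> w j) \<and>
    inj_on (\<lambda>n. \<Sum>j\<in>S. w j * n j) {n. (\<forall>j. n j \<le> k) \<and> (\<forall>j. j \<notin> S \<longrightarrow> n j = 0)}"
  using assms
proof (induction S)
  case empty
  show ?case
    by (intro exI[of _ "\<lambda>_. 1"] conjI) (auto simp: inj_on_def fun_eq_iff)
next
  case (insert a S)
  then obtain w :: "'d \<Rightarrow> nat" where w: "\<And>j. 1 \<le> w j"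
    and inj: "inj_on (\<lambda>n. \<Sum>j\<in>S. w j * n j) {n. (\<forall>j. n j \<le> k) \<and> (\<forall>j. j \<notin> S \<longrightarrow> n j = 0)}"
    by blast
  define c where "c = (\<Sum>j\<in>S. w j * k) + 1"
  define w' where "w' = w(a := c)"
  have split: "(\<Sum>j\<in>insert a S. w' j * n j) = c * n a + (\<Sum>j\<in>S. w j * (n(a := 0)) j)" for n :: "'d \<Rightarrow> nat"
  proof -
    have "(\<Sum>j\<in>S. w' j * n j) = (\<Sum>j\<in>S. w j * (n(a := 0)) j)"
      using insert.hyps(2) by (intro sum.cong) (auto simp: w'_def)
    then show ?thesis
      using insert.hyps by (simp add: w'_def)
  qed
  have small: "(\<Sum>j\<in>S. w j * (n(a := 0)) j) < c" if "\<forall>j. n j \<le> k" for n :: "'d \<Rightarrow> nat"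
  proof -
    have "(\<Sum>j\<in>S. w j * (n(a := 0)) j) \<le> (\<Sum>j\<in>S. w j * k)"
      using that by (intro sum_mono mult_left_mono) auto
    then show ?thesis
      by (simp add: c_def)
  qed
  have "inj_on (\<lambda>n. \<Sum>j\<in>insert a S. w' j * n j)
      {n. (\<forall>j. n j \<le> k) \<and> (\<forall>j. j \<notin> insert a S \<longrightarrow> n j = 0)}"
  proof (rule inj_onI, clarify)
    fix m n :: "'d \<Rightarrow> nat"
    assume le: "\<forall>j. m j \<le> k" "\<forall>j. n j \<le> k"
      and supp: "\<forall>j. j \<notin> insert a S \<longrightarrow> m j = 0" "\<forall>j. j \<notin> insert a S \<longrightarrow> n j = 0"
      and "(\<Sum>j\<in>insert a S. w' j * m j) = (\<Sum>j\<in>insert a S. w' j * n j)"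
    then have eq: "c * m a + (\<Sum>j\<in>S. w j * (m(a := 0)) j) = c * n a + (\<Sum>j\<in>S. w j * (n(a := 0)) j)"
      by (simp only: split)
    have "m a = n a"
      using arg_cong[OF eq, of "\<lambda>s. s div c"] small[OF le(1)] small[OF le(2)] by simp
    moreover have "(\<Sum>j\<in>S. w j * (m(a := 0)) j) = (\<Sum>j\<in>S. w j * (n(a := 0)) j)"
      using eq calculation by simp
    then have "m(a := 0) = n(a := 0)"
      by (rule inj_onD[OF inj]) (use le supp in auto)
    ultimately show "m = n"
      by (metis fun_upd_triv fun_upd_upd)
  qed
  moreover have "\<forall>j. 1 \<le> w' j"
    using w by (simp add: w'_def c_def)
  ultimately show ?case by blast
qed

text \<open>Substituting \<open>z\<^sub>j = t\<^bsup>w j\<^esup>\<close> with separating weights turns distinct monomials into distinct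
  powers of \<open>t\<close>, which reduces the claim to one variable.\<close>

lemma multivariate_coeff_zero:
  fixes c :: "('d::finite \<Rightarrow> nat) \<Rightarrow> complex"
  assumes "finite N" "n0 \<in> N"
    and zero: "\<And>z :: complex ^ 'd. norm z < 1 \<Longrightarrow> (\<Sum>n\<in>N. (\<Prod>j\<in>UNIV. z $ j ^ n j) * c n) = 0"
  shows "c n0 = 0"
proof -
  define k where "k = Max ((\<lambda>(n, j). n j) ` (N \<times> UNIV))"
  have k: "n j \<le> k" if "n \<in> N" for n j
    unfolding k_def using assms(1) that by (intro Max_ge) (auto simp: image_iff)
  obtain w :: "'d \<Rightarrow> nat" where w: "\<And>j. 1 \<le> w j"
    and inj: "inj_on (\<lambda>n. \<Sum>j\<in>UNIV. w j * n j) {n. (\<forall>j. n j \<le> k) \<and> (\<forall>j. j \<notin> UNIV \<longrightarrow> n j = 0)}"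
    using separating_weights[of "UNIV :: 'd set" k] by auto
  let ?e = "\<lambda>n :: 'd \<Rightarrow> nat. \<Sum>j\<in>UNIV. w j * n j"
  have inj': "?e n = ?e n0 \<longleftrightarrow> n = n0" if "n \<in> N" for n
    using inj_onD[OF inj, of n n0] k that assms(2) by auto
  define p where "p = (\<Sum>n\<in>N. monom (c n) (?e n))"
  \<comment> \<open>For \<open>t < s\<close> the point with coordinates \<open>t\<^bsup>w j\<^esup> \<le> t\<close> has norm at most \<open>CARD('d) * t < 1\<close>.\<close>
  define s where "s = 1 / (real CARD('d) + 1)"
  have root: "poly p (complex_of_real t) = 0" if "0 < t" "t < s" for t
  proof -
    define z :: "complex ^ 'd" where "z = (\<chi> j. complex_of_real t ^ w j)"
    have "t \<le> 1"
      using that by (simp add: s_def field_simps) (smt (verit) mult_nonneg_nonneg of_nat_0_le_iff)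
    have "norm z \<le> (\<Sum>j\<in>UNIV. cmod (z $ j))"
      by (simp add: norm_vec_def L2_set_le_sum)
    also have "\<dots> \<le> (\<Sum>j\<in>(UNIV :: 'd set). t)"
    proof (rule sum_mono)
      fix j
      have "t ^ w j \<le> t ^ 1"
        using that \<open>t \<le> 1\<close> w by (intro power_decreasing) auto
      then show "cmod (z $ j) \<le> t"
        using that by (simp add: z_def norm_power)
    qed
    also have "\<dots> < 1"
      using that by (simp add: s_def field_simps)
    finally have "norm z < 1" .
    from zero[OF this] have "(\<Sum>n\<in>N. (\<Prod>j\<in>UNIV. z $ j ^ n j) * c n) = 0" .
    moreover have "(\<Prod>j\<in>UNIV. z $ j ^ n j) = complex_of_real t ^ ?e n" for n
      by (simp add: z_def power_mult[symmetric] power_sum)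
    ultimately show ?thesis
      by (simp add: p_def poly_sum poly_monom mult.commute)
  qed
  have "complex_of_real ` {0<..<s} \<subseteq> {x. poly p x = 0}"
    using root by auto
  moreover have "infinite (complex_of_real ` {0<..<s})"
    by (subst finite_image_iff) (auto simp: inj_on_def s_def intro!: infinite_Ioo divide_pos_pos add_nonneg_pos)
  ultimately have "p = 0"
    using poly_roots_finite finite_subset by blast
  then have "0 = coeff p (?e n0)" by simp
  also have "\<dots> = (\<Sum>n\<in>N. if n = n0 then c n else 0)"
    unfolding p_def coeff_sum by (rule sum.cong) (auto simp: inj')
  also have "\<dots> = c n0"
    using assms(1,2) by simp
  finally show ?thesis by simp
qed


section \<open>Cauchy products of operator series\<close>

text \<open>The double family \<open>a\<^sub>i c\<^sub>j\<close> is absolutely summable; its sum is computed by rows and by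
  antidiagonals.\<close>

lemma blinfun_Cauchy_product_sums:
  fixes a :: "nat \<Rightarrow> ('b::banach \<Rightarrow>\<^sub>L 'c::banach)" and c :: "nat \<Rightarrow> ('a::banach \<Rightarrow>\<^sub>L 'b)"
  assumes "summable (\<lambda>k. norm (a k))" "summable (\<lambda>k. norm (c k))" "a sums A" "c sums C"
  shows "(\<lambda>k. \<Sum>i\<le>k. a i o\<^sub>L c (k - i)) sums (A o\<^sub>L C)"
proof -
  let ?f = "\<lambda>(i, j). a i o\<^sub>L c j"
  have A: "(a has_sum A) UNIV" and C: "(c has_sum C) UNIV"
    by (rule norm_summable_imp_has_sum[OF assms(1,3)], rule norm_summable_imp_has_sum[OF assms(2,4)])
  have na: "(\<lambda>k. norm (a k)) summable_on UNIV" and nc: "(\<lambda>k. norm (c k)) summable_on UNIV"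
    using assms(1,2) by (auto simp: summable_on_UNIV_nonneg_real_iff)
  have "(\<lambda>(i, j). norm (a i) * norm (c j)) summable_on (UNIV \<times> UNIV)"
  proof (rule summable_on_SigmaI)
    show "((\<lambda>j. case (i, j) of (i, j) \<Rightarrow> norm (a i) * norm (c j))
        has_sum (norm (a i) * (\<Sum>\<^sub>\<infinity>j. norm (c j)))) UNIV" for i
      using has_sum_cmult_right[OF has_sum_infsum[OF nc], of "norm (a i)"] by simp
    show "(\<lambda>i. norm (a i) * (\<Sum>\<^sub>\<infinity>j. norm (c j))) summable_on UNIV"
      by (rule summable_on_cmult_left[OF na])
  qed auto
  then have "?f abs_summable_on (UNIV \<times> UNIV)"
    by (rule summable_on_comparison_test) (auto simp: norm_blinfun_compose)
  then have "?f summable_on (UNIV \<times> UNIV)"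
    by (rule abs_summable_summable)
  then obtain s where s: "(?f has_sum s) (UNIV \<times> UNIV)"
    by (auto simp: summable_on_def)
  have "((\<lambda>i. a i o\<^sub>L C) has_sum s) UNIV"
  proof (rule has_sum_SigmaD[OF s])
    show "((\<lambda>j. ?f (i, j)) has_sum (a i o\<^sub>L C)) UNIV" for i
      using has_sum_bounded_linear[OF bounded_bilinear.bounded_linear_right[OF bounded_bilinear_blinfun_compose] C, of "a i"]
      by simp
  qed
  moreover have "((\<lambda>i. a i o\<^sub>L C) has_sum (A o\<^sub>L C)) UNIV"
    by (rule has_sum_bounded_linear[OF bounded_bilinear.bounded_linear_left[OF bounded_bilinear_blinfun_compose] A])
  ultimately have "s = A o\<^sub>L C"
    by (rule has_sum_unique)
  have "((\<lambda>(k, i). a i o\<^sub>L c (k - i)) has_sum s) (Sigma UNIV (\<lambda>k. {..k}))"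
    using s
    by (subst has_sum_reindex_bij_witness[of _ "\<lambda>(i, j). (i + j, i)" "\<lambda>(k, i). (i, k - i)"
          "UNIV \<times> UNIV" ?f _ s]) auto
  then have "((\<lambda>k. \<Sum>i\<le>k. a i o\<^sub>L c (k - i)) has_sum s) UNIV"
    by (rule has_sum_SigmaD) (auto intro!: has_sum_finite)
  then show ?thesis
    unfolding \<open>s = A o\<^sub>L C\<close> by (rule has_sum_imp_sums)
qed


section \<open>Formal series with operator coefficients\<close>

lemma finite_splits [simp]: "finite {(\<alpha>, \<beta>). \<alpha> @ \<beta> = (\<gamma> :: 'd list)}"
proof (rule finite_subset)
  show "{(\<alpha>, \<beta>). \<alpha> @ \<beta> = \<gamma>} \<subseteq> (\<lambda>i. (take i \<gamma>, drop i \<gamma>)) ` {..length \<gamma>}"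
  proof clarify
    fix \<alpha> \<beta>
    assume "\<gamma> = \<alpha> @ \<beta>"
    then show "(\<alpha>, \<beta>) \<in> (\<lambda>i. (take i (\<alpha> @ \<beta>), drop i (\<alpha> @ \<beta>))) ` {..length (\<alpha> @ \<beta>)}"
      by (intro image_eqI[of _ _ "length \<alpha>"]) auto
  qed
qed simp

lemma nc_mult_assoc: "nc_mult (nc_mult L M) N = nc_mult L (nc_mult M N)"
proof
  fix \<gamma>
  let ?s = "\<lambda>\<gamma>. {(\<alpha>, \<beta>). \<alpha> @ \<beta> = \<gamma>}"
  have "nc_mult (nc_mult L M) N \<gamma> = (\<Sum>x\<in>?s \<gamma>. \<Sum>y\<in>?s (fst x). (L (fst y) o\<^sub>L M (snd y)) o\<^sub>L N (snd x))"
    by (simp add: nc_mult_def compose_sum_left case_prod_beta)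
  also have "\<dots> = (\<Sum>(x, y)\<in>Sigma (?s \<gamma>) (\<lambda>x. ?s (fst x)). (L (fst y) o\<^sub>L M (snd y)) o\<^sub>L N (snd x))"
    by (rule sum.Sigma) auto
  also have "\<dots> = (\<Sum>(x, y)\<in>Sigma (?s \<gamma>) (\<lambda>x. ?s (snd x)). L (fst x) o\<^sub>L (M (fst y) o\<^sub>L N (snd y)))"
    by (rule sum.reindex_bij_witness[of _ "\<lambda>((a, bc), (b, c)). ((a @ b, c), (a, b))"
          "\<lambda>((ab, c), (a, b)). ((a, b @ c), (b, c))"]) (auto simp: blinfun_compose_assoc)
  also have "\<dots> = (\<Sum>x\<in>?s \<gamma>. \<Sum>y\<in>?s (snd x). L (fst x) o\<^sub>L (M (fst y) o\<^sub>L N (snd y)))"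
    by (rule sum.Sigma[symmetric]) auto
  also have "\<dots> = nc_mult L (nc_mult M N) \<gamma>"
    by (simp add: nc_mult_def compose_sum_right case_prod_beta)
  finally show "nc_mult (nc_mult L M) N \<gamma> = nc_mult L (nc_mult M N) \<gamma>" .
qed

lemma nc_mult_splits: "nc_mult M N \<gamma> = (\<Sum>i\<le>length \<gamma>. M (take i \<gamma>) o\<^sub>L N (drop i \<gamma>))"
  unfolding nc_mult_def
  by (rule sum.reindex_bij_witness[of _ "\<lambda>i. (take i \<gamma>, drop i \<gamma>)" "\<lambda>(\<alpha>, \<beta>). length \<alpha>"]) auto

lemma nc_mult_one_left: "nc_mult nc_one N = N"
proof
  fix \<gamma>
  have "nc_mult nc_one N \<gamma> = (\<Sum>i\<le>length \<gamma>. if i = 0 then N \<gamma> else 0)"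
    unfolding nc_mult_splits by (rule sum.cong) (auto simp: nc_one_def)
  then show "nc_mult nc_one N \<gamma> = N \<gamma>" by simp
qed

lemma nc_mult_one_right: "nc_mult N nc_one = N"
proof
  fix \<gamma>
  have "nc_mult N nc_one \<gamma> = (\<Sum>i\<le>length \<gamma>. if i = length \<gamma> then N \<gamma> else 0)"
    unfolding nc_mult_splits by (rule sum.cong) (auto simp: nc_one_def)
  then show "nc_mult N nc_one \<gamma> = N \<gamma>" by simp
qed

context
  notes sum.cong [fundef_cong]
begin

text \<open>The right inverse of \<open>M\<close>, where \<open>R\<close> inverts the constant coefficient: the equation for the word
  \<open>\<gamma>\<close> is solved for the coefficient at \<open>\<gamma>\<close>.\<close>

fun nc_right_inverse :: "('d, 'h::chilbert_space) nc_series \<Rightarrow> ('h \<Rightarrow>\<^sub>L 'h) \<Rightarrow> ('d, 'h) nc_series" where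
  "nc_right_inverse M R \<gamma> = (if \<gamma> = [] then R else
     - (R o\<^sub>L (\<Sum>i<length \<gamma>. M (take (Suc i) \<gamma>) o\<^sub>L nc_right_inverse M R (drop (Suc i) \<gamma>))))"

end

declare nc_right_inverse.simps [simp del]

lemma nc_mult_right_inverse:
  assumes "M [] o\<^sub>L R = id_blinfun"
  shows "nc_mult M (nc_right_inverse M R) = nc_one"
proof
  fix \<gamma>
  let ?N = "nc_right_inverse M R"
  show "nc_mult M ?N \<gamma> = nc_one \<gamma>"
  proof (cases "\<gamma> = []")
    case True
    then show ?thesis
      by (simp add: nc_mult_splits nc_one_def nc_right_inverse.simps assms)
  next
    case False
    let ?S = "\<Sum>i<length \<gamma>. M (take (Suc i) \<gamma>) o\<^sub>L ?N (drop (Suc i) \<gamma>)"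
    have "nc_mult M ?N \<gamma> = (M [] o\<^sub>L ?N \<gamma>) + ?S"
      unfolding nc_mult_splits lessThan_Suc_atMost[symmetric] sum.lessThan_Suc_shift by simp
    also have "?N \<gamma> = - (R o\<^sub>L ?S)"
      using False by (subst nc_right_inverse.simps) simp
    also have "M [] o\<^sub>L (- (R o\<^sub>L ?S)) = - ((M [] o\<^sub>L R) o\<^sub>L ?S)"
      by (simp add: bounded_bilinear.minus_right[OF bounded_bilinear_blinfun_compose] blinfun_compose_assoc)
    finally show ?thesis
      using False by (simp add: assms nc_one_def)
  qed
qed

lemma nc_right_inverse_bounded_ops:
  assumes "range M \<subseteq> bounded_ops" "R \<in> bounded_ops"
  shows "nc_right_inverse M R \<gamma> \<in> bounded_ops"
proof (induction \<gamma> rule: length_induct)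
  case (1 \<gamma>)
  have "(\<Sum>i<length \<gamma>. M (take (Suc i) \<gamma>) o\<^sub>L nc_right_inverse M R (drop (Suc i) \<gamma>)) \<in> bounded_ops"
    using 1 assms(1)
    by (intro complex_vector.subspace_sum[OF csubspace_bounded_ops] bounded_ops_compose) auto
  then have "- (R o\<^sub>L (\<Sum>i<length \<gamma>. M (take (Suc i) \<gamma>) o\<^sub>L nc_right_inverse M R (drop (Suc i) \<gamma>))) \<in> bounded_ops"
    by (intro complex_vector.subspace_neg[OF csubspace_bounded_ops] bounded_ops_compose assms(2))
  then show ?case
    using assms(2) by (subst nc_right_inverse.simps) simp
qed

text \<open>A right inverse \<open>N\<close> of \<open>M\<close> has a right inverse of its own, which can only be \<open>M\<close>; hence \<open>N\<close> is
  two-sided.\<close>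

lemma nc_inverse_eq_right_inverse:
  assumes "M [] o\<^sub>L R = id_blinfun" "R o\<^sub>L M [] = id_blinfun"
  shows "nc_inverse M = nc_right_inverse M R"
proof -
  define N where "N = nc_right_inverse M R"
  define P where "P = nc_right_inverse N (M [])"
  have MN: "nc_mult M N = nc_one"
    unfolding N_def by (rule nc_mult_right_inverse[of M R, OF assms(1)])
  have NP: "nc_mult N P = nc_one"
    unfolding P_def using assms(2)
    by (intro nc_mult_right_inverse) (simp add: N_def nc_right_inverse.simps)
  have "M = nc_mult M (nc_mult N P)"
    by (simp add: NP nc_mult_one_right)
  also have "\<dots> = P"
    by (simp add: MN nc_mult_one_left flip: nc_mult_assoc)
  finally have NM: "nc_mult N M = nc_one"
    using NP by simp
  show ?thesis
    unfolding nc_inverse_def N_def[symmetric]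
  proof (rule the_equality)
    fix N' assume N': "nc_mult N' M = nc_one \<and> nc_mult M N' = nc_one"
    have "N' = nc_mult N (nc_mult M N')"
      by (simp add: NM nc_mult_one_left flip: nc_mult_assoc)
    also have "\<dots> = N"
      using N' by (simp add: nc_mult_one_right)
    finally show "N' = N" .
  qed (simp add: MN NM)
qed

text \<open>The form \<open>(1 - B) H = 1 + B\<close> of the definition of \<open>H\<close> contains no inverse and can be evaluated at
  points \<open>z\<close>, where convergence of the series \<open>(1 - B)\<^sup>-\<^sup>1\<close> is not obvious.\<close>

lemma nc_herglotz_equation:
  assumes "range B \<subseteq> bounded_ops" "R \<in> bounded_ops"
    and "(id_blinfun - B []) o\<^sub>L R = id_blinfun" "R o\<^sub>L (id_blinfun - B []) = id_blinfun"
  shows "nc_mult (\<lambda>\<alpha>. nc_one \<alpha> - B \<alpha>) (nc_herglotz B) = (\<lambda>\<alpha>. nc_one \<alpha> + B \<alpha>)"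
    and "range (nc_herglotz B) \<subseteq> bounded_ops"
proof -
  let ?M = "\<lambda>\<alpha>. nc_one \<alpha> - B \<alpha>"
  let ?N = "nc_right_inverse ?M R"
  have M: "?M [] o\<^sub>L R = id_blinfun" "R o\<^sub>L ?M [] = id_blinfun"
    using assms(3,4) by (simp_all add: nc_one_def)
  have H: "nc_herglotz B = nc_mult ?N (\<lambda>\<alpha>. nc_one \<alpha> + B \<alpha>)"
    by (simp add: nc_herglotz_def nc_inverse_eq_right_inverse[of ?M R, OF M])
  show "nc_mult ?M (nc_herglotz B) = (\<lambda>\<alpha>. nc_one \<alpha> + B \<alpha>)"
    unfolding H nc_mult_assoc[symmetric] nc_mult_right_inverse[of ?M R, OF M(1)]
    by (rule nc_mult_one_left)
  have one: "nc_one \<alpha> \<in> bounded_ops" for \<alpha> :: "'b list"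
    by (simp add: nc_one_def bounded_ops_id bounded_ops_zero)
  have "?N \<alpha> \<in> bounded_ops" for \<alpha>
    using assms(1,2) by (intro nc_right_inverse_bounded_ops) (auto intro!: bounded_ops_diff one)
  then show "range (nc_herglotz B) \<subseteq> bounded_ops"
    unfolding H nc_mult_splits using assms(1)
    by (auto intro!: complex_vector.subspace_sum[OF csubspace_bounded_ops] bounded_ops_compose
        bounded_ops_add one)
qed

text \<open>The zero \<open>1 \<times> 1\<close> matrices form a strict row contraction, at which only the constant coefficient
  of the series survives.\<close>

lemma nc_non_unital_constant_coefficient:
  fixes B :: "('d::finite, 'h::chilbert_space) nc_series"
  assumes "nc_non_unital_series B"
  obtains R where "R \<in> bounded_ops" "(id_blinfun - B []) o\<^sub>L R = id_blinfun"
    "R o\<^sub>L (id_blinfun - B []) = id_blinfun"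
proof -
  let ?Z = "\<lambda>(_ :: 'd) (_ :: nat) (_ :: nat). 0 :: complex"
  have "strict_row_contraction 1 ?Z"
    by (auto simp: strict_row_contraction_def intro!: exI[of _ 0])
  then have "block_invertible 1 (\<lambda>i j. block_id i j - (\<Sum>\<^sub>\<infinity>\<alpha>. matrix_word 1 ?Z \<alpha> i j *\<^sub>C B \<alpha>))"
    using assms unfolding nc_non_unital_series_def by blast
  moreover have "(\<Sum>\<^sub>\<infinity>\<alpha>. matrix_word 1 ?Z \<alpha> 0 0 *\<^sub>C B \<alpha>) = B []"
  proof -
    have w: "matrix_word (Suc 0) ?Z \<alpha> 0 0 = (if \<alpha> = [] then 1 else 0)" for \<alpha>
      by (cases \<alpha>) auto
    have "(\<Sum>\<^sub>\<infinity>\<alpha>. matrix_word 1 ?Z \<alpha> 0 0 *\<^sub>C B \<alpha>) = (\<Sum>\<^sub>\<infinity>\<alpha>\<in>{[]}. B \<alpha>)"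
      by (rule infsum_cong_neutral) (auto simp: w)
    then show ?thesis by simp
  qed
  ultimately show ?thesis
    using that by (auto simp: block_invertible_def block_id_def)
qed


section \<open>Homogeneous components\<close>

text \<open>The part of degree \<open>k\<close> of the series, at commuting variables. Summation by degree is better
  behaved than summation over words: on the whole ball, the parts of a Schur class series and of its
  Herglotz series decay geometrically.\<close>

definition homogeneous_part ::
  "('d::finite, 'h::chilbert_space) nc_series \<Rightarrow> complex ^ 'd \<Rightarrow> nat \<Rightarrow> ('h \<Rightarrow>\<^sub>L 'h)" where
  "homogeneous_part M z k = (\<Sum>\<alpha>\<in>words k. monomial z \<alpha> *\<^sub>C M \<alpha>)"

lemma homogeneous_part_mult:
  fixes M :: "('d::finite, 'h::chilbert_space) nc_series"
  assumes "range M \<subseteq> bounded_ops"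
  shows "homogeneous_part (nc_mult M N) z k =
    (\<Sum>i\<le>k. homogeneous_part M z i o\<^sub>L homogeneous_part N z (k - i))"
proof -
  let ?g = "\<lambda>(\<alpha>, \<beta>). (monomial z \<alpha> *\<^sub>C M \<alpha>) o\<^sub>L (monomial z \<beta> *\<^sub>C N \<beta>)"
  have factor: "monomial z (\<alpha> @ \<beta>) *\<^sub>C (M \<alpha> o\<^sub>L N \<beta>) =
      ((monomial z \<alpha> *\<^sub>C M \<alpha>) o\<^sub>L (monomial z \<beta> *\<^sub>C N \<beta>))" for \<alpha> \<beta>
    using assms by (simp add: monomial_append compose_scaleC_left compose_scaleC_right scaleC_scaleC
        image_subset_iff)
  have "homogeneous_part (nc_mult M N) z k = (\<Sum>\<gamma>\<in>words k. \<Sum>x\<in>{(\<alpha>, \<beta>). \<alpha> @ \<beta> = \<gamma>}. ?g x)"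
    unfolding homogeneous_part_def nc_mult_def complex_vector.scale_sum_right
    by (intro sum.cong refl) (auto simp: words_def case_prod_beta simp flip: factor)
  also have "\<dots> = (\<Sum>(\<gamma>, x)\<in>Sigma (words k) (\<lambda>\<gamma>. {(\<alpha>, \<beta>). \<alpha> @ \<beta> = \<gamma>}). ?g x)"
    by (rule sum.Sigma) auto
  also have "\<dots> = (\<Sum>(i, x)\<in>Sigma {..k} (\<lambda>i. words i \<times> words (k - i)). ?g x)"
    by (rule sum.reindex_bij_witness[of _ "\<lambda>(i, (\<alpha>, \<beta>)). (\<alpha> @ \<beta>, (\<alpha>, \<beta>))"
          "\<lambda>(\<gamma>, (\<alpha>, \<beta>)). (length \<alpha>, (\<alpha>, \<beta>))"]) (auto simp: words_def)
  also have "\<dots> = (\<Sum>i\<le>k. \<Sum>x\<in>words i \<times> words (k - i). ?g x)"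
    by (rule sum.Sigma[symmetric]) auto
  also have "\<dots> = (\<Sum>i\<le>k. homogeneous_part M z i o\<^sub>L homogeneous_part N z (k - i))"
    unfolding homogeneous_part_def compose_sum_left unfolding compose_sum_right
    by (subst sum.cartesian_product) (rule refl)
  finally show ?thesis .
qed


section \<open>The Schur class and convergence on the ball\<close>

text \<open>Left multiplication by \<open>B\<close> maps a constant \<open>h\<close> to the series with coefficients \<open>B\<^sub>\<alpha> h\<close>,
  whose norm is therefore at most \<open>\<parallel>h\<parallel>\<close>.\<close>

lemma left_schur_column_contractive:
  fixes B :: "('d::finite, 'h::chilbert_space) nc_series"
  assumes "B \<in> left_schur_class" "finite A"
  shows "(\<Sum>\<alpha>\<in>A. (norm (blinfun_apply (B \<alpha>) h))\<^sup>2) \<le> (norm h)\<^sup>2"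
proof -
  let ?f = "\<lambda>\<beta> :: 'd list. if \<beta> = [] then h else 0"
  have "(\<Sum>\<beta>\<in>A. (norm (?f \<beta>))\<^sup>2) \<le> (norm h)\<^sup>2" if "finite A" for A
  proof -
    have "(\<Sum>\<beta>\<in>A. (norm (?f \<beta>))\<^sup>2) = (\<Sum>\<beta>\<in>A. if \<beta> = [] then (norm h)\<^sup>2 else 0)"
      by (rule sum.cong) auto
    then show ?thesis
      using that by simp
  qed
  then obtain F :: "('d, 'h) fock" where F: "ell2_nth F = ?f" "norm F \<le> norm h"
    using ell2_boundedI[of ?f "norm h"] by auto
  obtain G :: "('d, 'h) fock" where G: "ell2_nth G = left_times B (ell2_nth F)" "norm G \<le> norm F"
    using assms(1) unfolding left_schur_class_def fock_contraction_def by blast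
  have "ell2_nth G \<alpha> = blinfun_apply (B \<alpha>) h" for \<alpha>
  proof -
    have "ell2_nth G \<alpha> = (\<Sum>x\<in>{(\<beta>, \<gamma>). \<beta> @ \<gamma> = \<alpha>}. if x = (\<alpha>, []) then blinfun_apply (B \<alpha>) h else 0)"
      unfolding G left_times_def F by (rule sum.cong) (auto simp: blinfun.zero_right split: if_splits)
    also have "\<dots> = blinfun_apply (B \<alpha>) h"
      by (subst sum.delta) auto
    finally show ?thesis .
  qed
  then have "(\<Sum>\<alpha>\<in>A. (norm (blinfun_apply (B \<alpha>) h))\<^sup>2) \<le> (norm G)\<^sup>2"
    using sum_le_norm_ell2_square[OF assms(2), of G] by simp
  also have "\<dots> \<le> (norm h)\<^sup>2"
    using G(2) F(2) by (intro power_mono) auto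
  finally show ?thesis .
qed

text \<open>By the Cauchy-Schwarz inequality, since the column of the \<open>B\<^sub>\<alpha>\<close> is a contraction.\<close>

lemma left_schur_norm_sum_le:
  assumes "B \<in> left_schur_class" "finite A"
  shows "norm (\<Sum>\<alpha>\<in>A. c \<alpha> *\<^sub>C B \<alpha>) \<le> sqrt (\<Sum>\<alpha>\<in>A. (cmod (c \<alpha>))\<^sup>2)"
proof (rule norm_blinfun_bound)
  fix h
  have "norm (blinfun_apply (\<Sum>\<alpha>\<in>A. c \<alpha> *\<^sub>C B \<alpha>) h) = norm (\<Sum>\<alpha>\<in>A. c \<alpha> *\<^sub>C blinfun_apply (B \<alpha>) h)"
    by (simp add: blinfun.sum_left scaleC_blinfun.rep_eq)
  also have "\<dots> \<le> (\<Sum>\<alpha>\<in>A. \<bar>cmod (c \<alpha>)\<bar> * \<bar>norm (blinfun_apply (B \<alpha>) h)\<bar>)"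
    by (rule order_trans[OF norm_sum]) (simp add: norm_scaleC)
  also have "\<dots> \<le> L2_set (\<lambda>\<alpha>. cmod (c \<alpha>)) A * L2_set (\<lambda>\<alpha>. norm (blinfun_apply (B \<alpha>) h)) A"
    by (rule L2_set_mult_ineq)
  also have "\<dots> \<le> sqrt (\<Sum>\<alpha>\<in>A. (cmod (c \<alpha>))\<^sup>2) * norm h"
    using left_schur_column_contractive[OF assms, of h]
    by (intro mult_mono) (auto simp: L2_set_def sum_nonneg intro!: real_le_lsqrt)
  finally show "norm (blinfun_apply (\<Sum>\<alpha>\<in>A. c \<alpha> *\<^sub>C B \<alpha>) h)
    \<le> sqrt (\<Sum>\<alpha>\<in>A. (cmod (c \<alpha>))\<^sup>2) * norm h" .
qed (auto intro: sum_nonneg)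

lemma norm_homogeneous_part_le:
  assumes "B \<in> left_schur_class"
  shows "norm (homogeneous_part B z k) \<le> norm z ^ k"
  using left_schur_norm_sum_le[OF assms finite_words, of "monomial z" k]
  by (simp add: homogeneous_part_def sum_cmod_monomial)

lemma sum_cmod_monomial_tail_le:
  assumes "norm z < 1" "finite A" "\<And>\<alpha>. \<alpha> \<in> A \<Longrightarrow> N \<le> length \<alpha>"
  shows "(\<Sum>\<alpha>\<in>A. (cmod (monomial z \<alpha>))\<^sup>2) \<le> ((norm z)\<^sup>2) ^ N / (1 - (norm z)\<^sup>2)"
proof -
  define q where "q = (norm z)\<^sup>2"
  have q: "0 \<le> q" "q < 1"
    using assms(1) by (auto simp: q_def power_less_one_iff)
  define K where "K = Max (insert N (length ` A)) + 1"
  have K: "N \<le> K" "\<And>\<alpha>. \<alpha> \<in> A \<Longrightarrow> length \<alpha> < K"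
    using assms(2) by (auto simp: K_def less_Suc_eq_le le_Suc_eq)
  have geom: "(1 - q) * (\<Sum>k = N..<K. q ^ k) = q ^ N - q ^ K"
    using K(1) by (induction K rule: dec_induct) (simp_all add: distrib_left, simp add: algebra_simps)
  have "A \<subseteq> (\<Union>k\<in>{N..<K}. words k)"
    using assms(3) K(2) by (auto simp: words_def)
  then have "(\<Sum>\<alpha>\<in>A. (cmod (monomial z \<alpha>))\<^sup>2) \<le> (\<Sum>\<alpha>\<in>(\<Union>k\<in>{N..<K}. words k). (cmod (monomial z \<alpha>))\<^sup>2)"
    by (intro sum_mono2) auto
  also have "\<dots> = (\<Sum>k = N..<K. \<Sum>\<alpha>\<in>words k. (cmod (monomial z \<alpha>))\<^sup>2)"
    by (rule sum.UNION_disjoint) (simp_all add: words_disjoint)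
  also have "\<dots> = (\<Sum>k = N..<K. q ^ k)"
    by (simp add: sum_cmod_monomial q_def power_commutes flip: power_mult power_mult_distrib)
       (simp add: mult.commute)
  also have "\<dots> \<le> q ^ N / (1 - q)"
  proof -
    have "(1 - q) * (\<Sum>k = N..<K. q ^ k) \<le> q ^ N"
      using geom q(1) by simp
    then show ?thesis
      using q(2) by (simp add: pos_le_divide_eq mult.commute)
  qed
  finally show ?thesis by (simp add: q_def)
qed

text \<open>The sum over words and the sum over degrees have the same value: by the preceding bounds, the
  words of length at least \<open>N\<close> contribute at most \<open>(q\<^sup>N / (1 - q))\<^bsup>1/2\<^esup>\<close>, where \<open>q = \<parallel>z\<parallel>\<^sup>2\<close>.\<close>

lemma left_schur_has_sum:
  fixes B :: "('d::finite, 'h::chilbert_space) nc_series"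
  assumes "B \<in> left_schur_class" "norm z < 1" "homogeneous_part B z sums S"
  shows "((\<lambda>\<alpha>. monomial z \<alpha> *\<^sub>C B \<alpha>) has_sum S) UNIV"
  unfolding has_sum_def
proof (rule tendstoI)
  fix e :: real assume "e > 0"
  let ?f = "\<lambda>\<alpha>. monomial z \<alpha> *\<^sub>C B \<alpha>"
  define q where "q = (norm z)\<^sup>2"
  have q: "0 \<le> q" "q < 1"
    using assms(2) by (auto simp: q_def power_less_one_iff)
  have "(\<lambda>N. sqrt (q ^ N / (1 - q))) \<longlonglongrightarrow> sqrt (0 / (1 - q))"
    using q by (intro tendsto_intros LIMSEQ_realpow_zero) auto
  then have "\<forall>\<^sub>F N in sequentially. sqrt (q ^ N / (1 - q)) < e / 2"
    using \<open>e > 0\<close> by (intro order_tendstoD(2)) auto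
  moreover have "\<forall>\<^sub>F N in sequentially. dist (\<Sum>k<N. homogeneous_part B z k) S < e / 2"
    using assms(3) \<open>e > 0\<close> unfolding sums_def by (intro tendstoD) auto
  ultimately obtain N where N: "sqrt (q ^ N / (1 - q)) < e / 2"
      "dist (\<Sum>k<N. homogeneous_part B z k) S < e / 2"
    using eventually_happens'[OF sequentially_bot eventually_conj] by blast
  define W where "W = (\<Union>k<N. words k :: 'd list set)"
  have W: "finite W"
    by (simp add: W_def)
  have long: "N \<le> length \<alpha>" if "\<alpha> \<notin> W" for \<alpha>
    using that by (auto simp: W_def words_def not_less)
  have sumW: "sum ?f W = (\<Sum>k<N. homogeneous_part B z k)"
    unfolding W_def homogeneous_part_def by (rule sum.UNION_disjoint) (simp_all add: words_disjoint)
  have "dist (sum ?f A) S < e" if "finite A" "W \<subseteq> A" for A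
  proof -
    have "sum ?f A = sum ?f (A - W) + sum ?f W"
      using that by (intro sum.subset_diff) auto
    then have "dist (sum ?f A) (sum ?f W) = norm (sum ?f (A - W))"
      by (simp add: dist_norm)
    also have "\<dots> \<le> sqrt (\<Sum>\<alpha>\<in>A - W. (cmod (monomial z \<alpha>))\<^sup>2)"
      using that by (intro left_schur_norm_sum_le[OF assms(1)]) auto
    also have "\<dots> \<le> sqrt (q ^ N / (1 - q))"
      unfolding q_def using that long
      by (intro real_sqrt_le_mono sum_cmod_monomial_tail_le[OF assms(2)]) auto
    finally show ?thesis
      using N dist_triangle[of "sum ?f A" S "sum ?f W"] by (simp add: sumW)
  qed
  then show "\<forall>\<^sub>F A in finite_subsets_at_top UNIV. dist (sum ?f A) S < e"
    unfolding eventually_finite_subsets_at_top using W by blast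
qed

lemma summable_norm_homogeneous_part:
  assumes "B \<in> left_schur_class" "norm z < 1"
  shows "summable (\<lambda>k. norm (homogeneous_part B z k))"
  using assms(2)
  by (intro summable_comparison_test'[OF summable_geometric[of "norm z"], of 0])
    (auto simp: norm_homogeneous_part_le[OF assms(1)])

lemma symmetrizes_to_iff_sums:
  assumes "B \<in> left_schur_class"
  shows "symmetrizes_to B b \<longleftrightarrow> (\<forall>z\<in>ball 0 1. homogeneous_part B z sums b z)"
proof -
  have "((\<lambda>\<alpha>. monomial z \<alpha> *\<^sub>C B \<alpha>) has_sum b z) UNIV \<longleftrightarrow> homogeneous_part B z sums b z"
    if "norm z < 1" for z
  proof
    assume *: "((\<lambda>\<alpha>. monomial z \<alpha> *\<^sub>C B \<alpha>) has_sum b z) UNIV"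
    have "homogeneous_part B z sums (\<Sum>k. homogeneous_part B z k)"
      using summable_norm_homogeneous_part[OF assms that] summable_norm_cancel by blast
    then show "homogeneous_part B z sums b z"
      using has_sum_unique[OF * left_schur_has_sum[OF assms that]] by metis
  qed (rule left_schur_has_sum[OF assms that])
  then show ?thesis
    by (simp add: symmetrizes_to_def monomial_def)
qed

lemma symmetrizes_to_transpose:
  fixes BL BR :: "('d::finite, 'h::chilbert_space) nc_series"
  assumes "transpose_conjugate BL BR"
  shows "symmetrizes_to BR b \<longleftrightarrow> symmetrizes_to BL b"
proof -
  have "BR \<alpha> = BL (rev \<alpha>)" for \<alpha>
    using assms by (metis rev_rev_ident transpose_conjugate_def)
  then have "((\<lambda>\<alpha>. monomial z \<alpha> *\<^sub>C BR \<alpha>) has_sum s) UNIV \<longleftrightarrow> ((\<lambda>\<alpha>. monomial z \<alpha> *\<^sub>C BL \<alpha>) has_sum s) UNIV" for z s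
    by (intro has_sum_reindex_bij_witness[of _ rev rev]) (auto simp: monomial_rev)
  then show ?thesis
    by (simp add: symmetrizes_to_def monomial_def)
qed


section \<open>Herglotz kernels\<close>

definition herglotz_kernel :: "complex ^ 'd::finite \<Rightarrow> 'd fock_op" where
  "herglotz_kernel z = op_inverse (id_blinfun - zL_star z) o\<^sub>L (id_blinfun + zL_star z)"

lemma herglotz_kernel_expansion:
  assumes "norm z < 1"
  shows "(\<lambda>k. herglotz_coeff k *\<^sub>C op_power (zL_star z) k) sums herglotz_kernel z"
  unfolding herglotz_kernel_def
  by (rule herglotz_kernel_sums) (rule le_less_trans[OF norm_zL_star_le assms])

lemma herglotz_term_in: "herglotz_coeff k *\<^sub>C op_power (zL_star z) k \<in> op_system sym_disk_space"
  by (rule complex_vector.subspace_scale[OF csubspace_op_system_sym zL_star_power_in])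

lemma zL_star_scale: "zL_star (\<chi> j. t * z $ j) = t *\<^sub>C zL_star z"
  by (simp add: zL_star_def complex_vector.scale_sum_right scaleC_scaleC)

lemma op_power_scaleC:
  assumes "T \<in> bounded_ops"
  shows "op_power (t *\<^sub>C T) k = t ^ k *\<^sub>C op_power T k"
proof (induction k)
  case 0
  show ?case by (simp add: complex_vector.scale_one)
next
  case (Suc k)
  then show ?case
    by (simp add: compose_scaleC_left compose_scaleC_right assms scaleC_scaleC)
qed

lemma norm_scaled_vec: "norm (\<chi> j. t * z $ j) = cmod t * norm (z :: complex ^ 'd::finite)"
  by (simp add: norm_vec_def norm_mult L2_set_right_distrib)

text \<open>Dilating \<open>z\<close> and comparing coefficients in one variable gives equality on the powers of \<open>zL\<^sup>*\<close>,
  which are generating polynomials of the \<open>(L\<^sup>n)\<^sup>*\<close>.\<close>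

lemma cp_maps_eq_of_herglotz_kernels:
  fixes \<phi> \<psi> :: "'d::finite fock_op \<Rightarrow> ('h::chilbert_space \<Rightarrow>\<^sub>L 'h)"
  assumes \<phi>: "\<phi> \<in> cp_maps (op_system sym_disk_space)"
    and \<psi>: "\<psi> \<in> cp_maps (op_system sym_disk_space)"
    and eq: "\<And>z. norm z < 1 \<Longrightarrow> \<phi> (herglotz_kernel z) = \<psi> (herglotz_kernel z)"
    and T: "T \<in> op_system sym_disk_space"
  shows "\<phi> T = \<psi> T"
proof -
  define D where "D T x y = cinner x (blinfun_apply (\<phi> T - \<psi> T) y)" for T x y
  have D_eq: "\<phi> T = \<psi> T" if "\<And>x y. D T x y = 0" for T
  proof (rule blinfun_eqI, rule cinner_right_eqI)
    show "cinner x (blinfun_apply (\<phi> T) y) = cinner x (blinfun_apply (\<psi> T) y)" for x y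
      using that[of x y] by (simp add: D_def blinfun.diff_left cinner_diff_right)
  qed
  have D_scaleC: "D (c *\<^sub>C T) x y = c * D T x y" if "T \<in> op_system sym_disk_space" for c T x y
    by (simp add: D_def cp_maps_scaleC[OF \<phi> that] cp_maps_scaleC[OF \<psi> that] cinner_scaleC_right
        scaleC_blinfun.rep_eq flip: complex_vector.scale_right_diff_distrib)
  have D_sum: "D (\<Sum>i\<in>I. T i) x y = (\<Sum>i\<in>I. D (T i) x y)"
    if "\<And>i. i \<in> I \<Longrightarrow> T i \<in> op_system sym_disk_space" for I :: "('d \<Rightarrow> nat) set" and T x y
    using cp_maps_sum[OF \<phi> operator_system_sym, of I T] cp_maps_sum[OF \<psi> operator_system_sym, of I T] that
    by (simp add: D_def blinfun.sum_left cinner_sum_right flip: sum_subtractf)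
  have power: "D (op_power (zL_star z) k) x y = 0" if z: "norm z < 1" for z k x y
  proof -
    have "(\<lambda>k. (herglotz_coeff k * D (op_power (zL_star z) k) x y) * t ^ k) sums 0" if t: "cmod t < 1" for t
    proof -
      let ?u = "\<chi> j. t * z $ j" and ?T = "\<lambda>k. herglotz_coeff k *\<^sub>C op_power (zL_star (\<chi> j. t * z $ j)) k"
      have u: "norm ?u < 1"
        using z t mult_strict_mono[of "cmod t" 1 "norm z" 1] by (simp add: norm_scaled_vec)
      note sums = herglotz_kernel_expansion[OF u]
      have "(\<lambda>k. \<phi> (?T k) - \<psi> (?T k)) sums (\<phi> (herglotz_kernel ?u) - \<psi> (herglotz_kernel ?u))"
        using sums_diff cp_maps_sums(2)[OF \<phi> operator_system_sym sums herglotz_term_in]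
          cp_maps_sums(2)[OF \<psi> operator_system_sym sums herglotz_term_in] by blast
      then have "(\<lambda>k. \<phi> (?T k) - \<psi> (?T k)) sums 0"
        by (simp add: eq[OF u])
      then have "(\<lambda>k. D (?T k) x y) sums cinner x (blinfun_apply 0 y)"
        unfolding D_def
        by (rule bounded_linear.sums[OF bounded_linear_compose[OF bounded_linear_cinner_right
                blinfun.bounded_linear_left]])
      moreover have "D (?T k) x y = (herglotz_coeff k * D (op_power (zL_star z) k) x y) * t ^ k" for k
        by (simp add: zL_star_scale op_power_scaleC zL_star_bounded_ops scaleC_scaleC D_scaleC zL_star_power_in)
      ultimately show ?thesis by simp
    qed
    then have "herglotz_coeff k * D (op_power (zL_star z) k) x y = 0"
      by (rule powser_zero_imp_coeff_zero)
    then show ?thesis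
      by (simp add: herglotz_coeff_def split: if_splits)
  qed
  have adjoint: "\<phi> (cadjoint (creation_sym n)) = \<psi> (cadjoint (creation_sym n))" for n
  proof (rule D_eq)
    fix x y
    show "D (cadjoint (creation_sym n)) x y = 0"
    proof (cases "\<exists>\<alpha>. count_list \<alpha> = n")
      case True
      then obtain \<alpha> where \<alpha>: "count_list \<alpha> = n" by blast
      show ?thesis
      proof (rule multivariate_coeff_zero)
        show "n \<in> count_list ` words (length \<alpha>)"
          using \<alpha> by (auto simp: words_def)
        fix z :: "complex ^ 'd" assume z: "norm z < 1"
        have "(\<Sum>m\<in>count_list ` words (length \<alpha>). (\<Prod>j\<in>UNIV. z $ j ^ m j) * D (cadjoint (creation_sym m)) x y)
          = D (op_power (zL_star z) (length \<alpha>)) x y"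
          unfolding zL_star_power_sym
          by (subst D_sum) (simp_all add: D_scaleC cadjoint_creation_sym_in
              complex_vector.subspace_scale[OF csubspace_op_system_sym])
        then show "(\<Sum>m\<in>count_list ` words (length \<alpha>). (\<Prod>j\<in>UNIV. z $ j ^ m j) * D (cadjoint (creation_sym m)) x y) = 0"
          by (simp add: power[OF z])
      qed simp
    next
      case False
      then have "creation_sym n = 0"
        by (simp add: creation_sym_def)
      then show ?thesis
        using D_sum[of "{}"] by simp
    qed
  qed
  have "\<phi> S = \<psi> S" if "S \<in> range creation_sym" for S
  proof -
    from that obtain n where n: "S = creation_sym n" by blast
    have "\<phi> (cadjoint (cadjoint S)) = \<psi> (cadjoint (cadjoint S))"
      unfolding n
      by (simp only: cp_maps_cadjoint[OF \<phi> operator_system_sym cadjoint_creation_sym_in]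
          cp_maps_cadjoint[OF \<psi> operator_system_sym cadjoint_creation_sym_in] adjoint)
    then show ?thesis
      by (simp add: n cadjoint_cadjoint creation_sym_bounded_ops)
  qed
  moreover have "range creation_sym \<subseteq> op_system (sym_disk_space :: 'd fock_op set)"
    using subset_op_system[OF csubspace_sym_disk_space] creation_sym_in_sym_disk_space by blast
  ultimately show ?thesis
    using cp_maps_eq_on_op_system[OF \<phi> \<psi> operator_system_sym] T unfolding sym_disk_space_def by blast
qed


section \<open>Herglotz functions of free lifts\<close>

lemma cp_maps_antimono: "E \<subseteq> E' \<Longrightarrow> cp_maps E' \<subseteq> cp_maps E"
  unfolding cp_maps_def
  by (intro Collect_mono impI conjI; elim conjE) (simp_all add: subset_iff)

text \<open>The moments \<open>\<mu>\<^sub>B ((L\<^sup>\<alpha>)\<^sup>*)\<close> are the coefficients of \<open>H\<close> at the reversed words, up to the factor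
  \<open>1/2\<close>, and \<open>(zL\<^sup>*)\<^sup>k\<close> is the generating polynomial of the \<open>(L\<^sup>\<alpha>)\<^sup>*\<close>. The constant coefficient \<open>H\<^sub>\<emptyset>\<close> enters the
  moments only through its real part, which accounts for the correction in degree \<open>0\<close>.\<close>

lemma nc_clark_map_homogeneous_part:
  fixes BL :: "('d::finite, 'h::chilbert_space) nc_series"
  assumes "nc_clark_map BL \<mu>"
  shows "homogeneous_part (nc_herglotz BL) z k =
    \<mu> (herglotz_coeff k *\<^sub>C op_power (zL_star z) k)
    + (if k = 0 then \<i> *\<^sub>C op_Im (nc_herglotz BL []) else 0)"
proof -
  let ?E = "op_system (free_disk_algebra :: 'd fock_op set)"
  have \<mu>: "\<mu> \<in> cp_maps ?E" and one: "\<mu> id_blinfun = op_Re (nc_herglotz BL [])"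
    and word: "\<And>\<alpha>. \<alpha> \<noteq> [] \<Longrightarrow> cadjoint (\<mu> (creation_word (rev \<alpha>))) = (1/2) *\<^sub>C nc_herglotz BL \<alpha>"
    using assms by (auto simp: nc_clark_map_def)
  show ?thesis
  proof (cases "k = 0")
    case True
    then show ?thesis
      by (simp add: homogeneous_part_def herglotz_coeff_def complex_vector.scale_one one op_Re_plus_op_Im)
  next
    case False
    have cw: "creation_word \<alpha> \<in> ?E" "cadjoint (creation_word \<alpha>) \<in> ?E" for \<alpha> :: "'d list"
      using operator_system_free subset_op_system[OF csubspace_free_disk_algebra]
        creation_word_in_free_disk_algebra by (auto simp: operator_system_def)
    have "\<mu> (herglotz_coeff k *\<^sub>C op_power (zL_star z) k)
      = \<mu> (\<Sum>\<alpha>\<in>words k. (2 * monomial z \<alpha>) *\<^sub>C cadjoint (creation_word (rev \<alpha>)))"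
      using False by (simp add: herglotz_coeff_def zL_star_power complex_vector.scale_sum_right scaleC_scaleC)
    also have "\<dots> = (\<Sum>\<alpha>\<in>words k. \<mu> ((2 * monomial z \<alpha>) *\<^sub>C cadjoint (creation_word (rev \<alpha>))))"
      by (rule cp_maps_sum[OF \<mu> operator_system_free]) (rule complex_vector.subspace_scale[OF csubspace_op_system_free cw(2)])
    also have "\<dots> = (\<Sum>\<alpha>\<in>words k. monomial z \<alpha> *\<^sub>C nc_herglotz BL \<alpha>)"
    proof (rule sum.cong[OF refl])
      fix \<alpha> :: "'d list" assume "\<alpha> \<in> words k"
      with False have "\<alpha> \<noteq> []" by (auto simp: words_def)
      then show "\<mu> ((2 * monomial z \<alpha>) *\<^sub>C cadjoint (creation_word (rev \<alpha>))) = monomial z \<alpha> *\<^sub>C nc_herglotz BL \<alpha>"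
        by (simp add: cp_maps_scaleC[OF \<mu> cw(2)] cp_maps_cadjoint[OF \<mu> operator_system_free cw(1)] word scaleC_scaleC)
    qed
    finally show ?thesis
      using False by (simp add: homogeneous_part_def)
  qed
qed

text \<open>Both sides are the value at \<open>z\<close> of the formal identity \<open>(1 - B) H = 1 + B\<close>. On the left, \<open>H\<close> has
  been summed by means of \<open>\<mu>\<^sub>B\<close>, which is what makes its series converge on the whole ball.\<close>

lemma herglotz_of_symmetrization:
  fixes BL :: "('d::finite, 'h::chilbert_space) nc_series"
  assumes B: "BL \<in> left_schur_class" and nu: "nc_non_unital_series BL"
    and clark: "nc_clark_map BL \<mu>" and z: "norm z < 1" and b: "homogeneous_part BL z sums \<beta>"
  shows "(id_blinfun - \<beta>) o\<^sub>L (\<mu> (herglotz_kernel z) + \<i> *\<^sub>C op_Im (nc_herglotz BL []))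
    = id_blinfun + \<beta>"
proof -
  let ?E = "op_system (free_disk_algebra :: 'd fock_op set)"
  let ?H = "nc_herglotz BL"
  let ?M = "\<lambda>\<alpha>. nc_one \<alpha> - BL \<alpha>"
  have \<mu>: "\<mu> \<in> cp_maps ?E"
    using clark by (simp add: nc_clark_map_def)
  have bd: "range BL \<subseteq> bounded_ops"
    using B by (simp add: left_schur_class_def)
  obtain R where R: "R \<in> bounded_ops" "(id_blinfun - BL []) o\<^sub>L R = id_blinfun"
    "R o\<^sub>L (id_blinfun - BL []) = id_blinfun"
    using nc_non_unital_constant_coefficient[OF nu] .
  note eq = nc_herglotz_equation(1)[OF bd R]
  have one: "homogeneous_part nc_one z k = (if k = 0 then id_blinfun else 0)" for k
  proof (cases "k = 0")
    case False
    then show ?thesis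
      by (auto simp: homogeneous_part_def nc_one_def words_def intro!: sum.neutral)
  qed (simp add: homogeneous_part_def nc_one_def complex_vector.scale_one)
  have one_sums: "homogeneous_part nc_one z sums id_blinfun"
    unfolding one using sums_single[of 0 "\<lambda>_. id_blinfun"] by simp
  have partM: "homogeneous_part ?M z = (\<lambda>k. homogeneous_part nc_one z k - homogeneous_part BL z k)"
    by (simp add: homogeneous_part_def complex_vector.scale_right_diff_distrib sum_subtractf fun_eq_iff)
  have partP: "homogeneous_part (\<lambda>\<alpha>. nc_one \<alpha> + BL \<alpha>) z
      = (\<lambda>k. homogeneous_part nc_one z k + homogeneous_part BL z k)"
    by (simp add: homogeneous_part_def scaleC_add_right sum.distrib fun_eq_iff)
  \<comment> \<open>The Cauchy product of the series for \<open>1 - B\<close> and \<open>H\<close> requires that both converge absolutely.\<close>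
  have M_sums: "homogeneous_part ?M z sums (id_blinfun - \<beta>)"
    unfolding partM by (rule sums_diff[OF one_sums b])
  have P_sums: "homogeneous_part (\<lambda>\<alpha>. nc_one \<alpha> + BL \<alpha>) z sums (id_blinfun + \<beta>)"
    unfolding partP by (rule sums_add[OF one_sums b])
  have M_abs: "summable (\<lambda>k. norm (homogeneous_part ?M z k))"
  proof (rule summable_comparison_test')
    show "summable (\<lambda>k. norm (homogeneous_part nc_one z k :: 'h \<Rightarrow>\<^sub>L 'h) + norm (homogeneous_part BL z k))"
      by (intro summable_add summable_norm_homogeneous_part[OF B z] summable_finite[of "{0}"]) (auto simp: one)
    show "norm (norm (homogeneous_part ?M z k))
        \<le> norm (homogeneous_part nc_one z k :: 'h \<Rightarrow>\<^sub>L 'h) + norm (homogeneous_part BL z k)" if "k \<ge> 0" for k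
      by (simp add: partM norm_triangle_ineq4)
  qed
  let ?T = "\<lambda>k. herglotz_coeff k *\<^sub>C op_power (zL_star z) k"
  let ?c = "\<lambda>k :: nat. if k = 0 then \<i> *\<^sub>C op_Im (?H []) else 0"
  have T: "?T k \<in> ?E" for k
    using herglotz_term_in op_system_sym_subset by blast
  have H: "homogeneous_part ?H z = (\<lambda>k. \<mu> (?T k) + ?c k)"
    by (rule ext) (rule nc_clark_map_homogeneous_part[OF clark])
  have "?c sums (\<i> *\<^sub>C op_Im (?H []))"
    using sums_single[of 0 "\<lambda>_. \<i> *\<^sub>C op_Im (?H [])"] by simp
  then have H_sums: "homogeneous_part ?H z sums (\<mu> (herglotz_kernel z) + \<i> *\<^sub>C op_Im (?H []))"
    unfolding H
    by (rule sums_add[OF cp_maps_sums(2)[OF \<mu> operator_system_free herglotz_kernel_expansion[OF z] T]])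
  have H_abs: "summable (\<lambda>k. norm (homogeneous_part ?H z k))"
  proof (rule summable_comparison_test')
    show "summable (\<lambda>k. 4 * norm (\<mu> id_blinfun) * (2 * norm z ^ k) + norm (?c k))"
      using z by (intro summable_add summable_mult summable_geometric summable_finite[of "{0}"]) auto
    fix k
    have "norm (\<mu> (?T k)) \<le> 4 * norm (\<mu> id_blinfun) * norm (?T k)"
      by (rule cp_maps_norm_le[OF \<mu> operator_system_free T])
    also have "norm (?T k) \<le> 2 * norm z ^ k"
    proof -
      have "norm (op_power (zL_star z) k) \<le> norm z ^ k"
        using norm_op_power_le[of "zL_star z" k] power_mono[OF norm_zL_star_le, of z k] by simp
      then show ?thesis
        unfolding norm_scaleC by (intro mult_mono) (auto simp: herglotz_coeff_def)
    qed
    finally show "norm (norm (homogeneous_part ?H z k)) \<le> 4 * norm (\<mu> id_blinfun) * (2 * norm z ^ k) + norm (?c k)"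
      using norm_triangle_ineq[of "\<mu> (?T k)" "?c k"] unfolding H by (simp add: mult_left_mono)
  qed
  have one_bd: "nc_one \<alpha> \<in> bounded_ops" for \<alpha> :: "'d list"
    by (simp add: nc_one_def bounded_ops_id bounded_ops_zero)
  have "homogeneous_part (nc_mult ?M ?H) z =
      (\<lambda>k. \<Sum>i\<le>k. homogeneous_part ?M z i o\<^sub>L homogeneous_part ?H z (k - i))"
    using bd by (intro ext homogeneous_part_mult) (auto intro!: bounded_ops_diff one_bd)
  then have "homogeneous_part (nc_mult ?M ?H) z sums
      ((id_blinfun - \<beta>) o\<^sub>L (\<mu> (herglotz_kernel z) + \<i> *\<^sub>C op_Im (?H [])))"
    using blinfun_Cauchy_product_sums[OF M_abs H_abs M_sums H_sums] by simp
  then show ?thesis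
    unfolding eq using P_sums by (rule sums_unique2)
qed

lemma op_inverse_op_invertible:
  assumes "op_invertible T"
  shows "op_inverse T o\<^sub>L T = id_blinfun" "T o\<^sub>L op_inverse T = id_blinfun"
  using assms op_inverse_eqI unfolding op_invertible_def by metis+

text \<open>The Cayley transform \<open>\<beta> \<mapsto> (1 - \<beta>)\<^sup>-\<^sup>1 (1 + \<beta>)\<close> is injective: if \<open>X\<close> is the transform of \<open>b z\<close>, then
  \<open>X + 1 = 2 (1 - b z)\<^sup>-\<^sup>1\<close>, while the second hypothesis reads \<open>(1 - \<beta>) (X + 1) = 2\<close>. Hence
  \<open>1 - \<beta> = 1 - b z\<close>.\<close>

lemma herglotz_determines:
  assumes "op_invertible (id_blinfun - b z)"
    and "(id_blinfun - \<beta>) o\<^sub>L X = id_blinfun + \<beta>"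
  shows "herglotz b z = X \<longleftrightarrow> b z = \<beta>"
proof -
  define R where "R = op_inverse (id_blinfun - b z)"
  have R: "R o\<^sub>L (id_blinfun - b z) = id_blinfun" "(id_blinfun - b z) o\<^sub>L R = id_blinfun"
    unfolding R_def by (rule op_inverse_op_invertible[OF assms(1)])+
  have hb: "herglotz b z = R o\<^sub>L (id_blinfun + b z)"
    by (simp add: herglotz_def R_def)
  show ?thesis
  proof
    assume X: "herglotz b z = X"
    have "id_blinfun + X = (R o\<^sub>L (id_blinfun - b z)) + (R o\<^sub>L (id_blinfun + b z))"
      using R X hb by simp
    also have "\<dots> = R + R"
      by (simp flip: compose_add_right) (simp add: compose_add_right)
    finally have "(id_blinfun - \<beta>) o\<^sub>L (R + R) = (id_blinfun - \<beta>) o\<^sub>L (id_blinfun + X)"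
      by simp
    also have "\<dots> = id_blinfun + id_blinfun"
      by (simp add: compose_add_right assms(2))
    finally have "2 *\<^sub>R ((id_blinfun - \<beta>) o\<^sub>L R) = 2 *\<^sub>R id_blinfun"
      by (simp add: compose_add_right scaleR_2)
    then have inv: "(id_blinfun - \<beta>) o\<^sub>L R = id_blinfun"
      by simp
    have "id_blinfun - \<beta> = ((id_blinfun - \<beta>) o\<^sub>L R) o\<^sub>L (id_blinfun - b z)"
      by (simp add: blinfun_compose_assoc R)
    also have "\<dots> = id_blinfun - b z"
      by (simp add: inv)
    finally show "b z = \<beta>" by simp
  next
    assume "b z = \<beta>"
    then have "herglotz b z = R o\<^sub>L ((id_blinfun - b z) o\<^sub>L X)"
      by (simp add: hb assms(2))
    then show "herglotz b z = X"
      by (simp add: R flip: blinfun_compose_assoc)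
  qed
qed

theorem corollary7p1:
  fixes b :: "complex ^ 'd::finite \<Rightarrow> 'h::chilbert_space \<Rightarrow>\<^sub>L 'h"
    and BL BR :: "('d, 'h) nc_series"
    and mu_B mu_b :: "'d fock_op \<Rightarrow> ('h \<Rightarrow>\<^sub>L 'h)"
  assumes "b \<in> schur_class"
    and "BL \<in> left_schur_class" and "BR \<in> right_schur_class"
    and "transpose_conjugate BL BR"
    and "non_unital b" and "nc_non_unital BL BR"
    and "op_Im (nc_herglotz BL []) = op_Im (herglotz b 0)"
    and "nc_clark_map BL mu_B" and "clark_map b mu_b"
  shows "free_lifts BL BR b \<longleftrightarrow>
    cp_extension (op_system sym_disk_space) (op_system free_disk_algebra) mu_b mu_B"
proof -
  let ?S = "op_system (sym_disk_space :: 'd fock_op set)"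
  have sub: "?S \<subseteq> op_system free_disk_algebra"
    by (rule op_system_sym_subset)
  have B: "mu_B \<in> cp_maps (op_system free_disk_algebra)"
    using assms(8) by (simp add: nc_clark_map_def)
  then have BS: "mu_B \<in> cp_maps ?S"
    using cp_maps_antimono[OF sub] by blast
  have bS: "mu_b \<in> cp_maps ?S"
    using assms(9) unfolding clark_map_def by (rule conjunct1)
  have b: "herglotz b z = mu_b (herglotz_kernel z) + \<i> *\<^sub>C op_Im (herglotz b 0)" if "norm z < 1" for z
    using assms(9) that unfolding clark_map_def herglotz_kernel_def by (elim conjE) (drule bspec[of _ _ z], simp)
  have kernel_in: "herglotz_kernel z \<in> ?S" if "norm z < 1" for z
    by (rule cp_maps_sums(1)[OF bS operator_system_sym herglotz_kernel_expansion[OF that] herglotz_term_in])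
  have pointwise: "homogeneous_part BL z sums b z \<longleftrightarrow> mu_b (herglotz_kernel z) = mu_B (herglotz_kernel z)"
    if z: "norm z < 1" for z
  proof -
    have s: "homogeneous_part BL z sums (\<Sum>k. homogeneous_part BL z k)"
      using summable_norm_homogeneous_part[OF assms(2) z] summable_norm_cancel by blast
    have "mu_b (herglotz_kernel z) = mu_B (herglotz_kernel z)
        \<longleftrightarrow> herglotz b z = mu_B (herglotz_kernel z) + \<i> *\<^sub>C op_Im (nc_herglotz BL [])"
      by (simp add: b[OF z] assms(7))
    also have "\<dots> \<longleftrightarrow> b z = (\<Sum>k. homogeneous_part BL z k)"
      using assms(5,6) z
      by (intro herglotz_determines herglotz_of_symmetrization[OF assms(2) _ assms(8) z s])
        (auto simp: non_unital_def nc_non_unital_def)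
    also have "\<dots> \<longleftrightarrow> homogeneous_part BL z sums b z"
      using s sums_unique2 by metis
    finally show ?thesis by simp
  qed
  have "free_lifts BL BR b \<longleftrightarrow> (\<forall>z. norm z < 1 \<longrightarrow> mu_b (herglotz_kernel z) = mu_B (herglotz_kernel z))"
    unfolding free_lifts_def symmetrizes_to_transpose[OF assms(4)] symmetrizes_to_iff_sums[OF assms(2)]
    using pointwise by auto
  also have "\<dots> \<longleftrightarrow> (\<forall>T\<in>?S. mu_B T = mu_b T)"
    using cp_maps_eq_of_herglotz_kernels[OF BS bS] kernel_in by metis
  also have "\<dots> \<longleftrightarrow> cp_extension ?S (op_system free_disk_algebra) mu_b mu_B"
    using sub B by (simp add: cp_extension_def)
  finally show ?thesis .
qed

end
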